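(* Let $G$ and $G'$ be quantum graphs, connected or not. (1) The spectrum of the standard Laplacian $\Delta_0$ determines the number of connected components: if $\mathrm{Spec}_0(G)=\mathrm{Spec}_0(G')$, then $G$ and $G'$ have the same number of connected components. (2) Given a generic $\alpha$, the part $\mathrm{Spec}_{t\alpha}(G)$, $t\in[0,\varepsilon)$, of the Bloch spectrum determines the groups $H_1(G_i,\mathbb{Z})$ and the length of the minimal periodic orbit(s) of each element of $H_1(G_i,\mathbb{Z})$ for each connected component $G_i$ of $G$. That is: let $\alpha$, $\alpha'$ be generic real $1$-forms on $G$, $G'$ respectively, let $\varepsilon>0$, and suppose $\mathrm{Spec}_{t\alpha}(G)=\mathrm{Spec}_{t\alpha'}(G')$ for all $t\in[0,\varepsilon)$. Then the connected components of $G$ and $G'$ can be numbered $G_1,\dots,G_k$ and $G'_1,\dots,G'_k$ such that for each $i$ there is a group isomorphism $\varphi_i:H_1(G_i,\mathbb{Z})\to H_1(G'_i,\mathbb{Z})$ with $\left|\int_{\varphi_i(c)}\alpha'\right|=\left|\int_c\alpha\right|$ and $\ell_{G'_i}(\varphi_i(c))=\ell_{G_i}(c)$ for all $c\in H_1(G_i,\mathbb{Z})$.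
   Context: Quantum graphs. Here a quantum graph $G$ is a finite, possibly disconnected, graph (loops and multiple edges allowed, no vertices of degree $2$) with vertex set $V$ and edge set $E$, in which every edge $e$ has a length $L_e>0$ and is identified with the interval $[0,L_e]$. For a vertex $v$, $e\sim v$ ranges over the edges adjacent to $v$ (a loop at $v$ is counted once for each of its two ends), and $\nu_{v,e}$ is the outward unit normal of $e$ at $v$. A $0$-form is a continuous function $f$ on $G$ that is $C^\infty$ on each closed edge and satisfies $\sum_{e\sim v}\nu_{v,e}(f|_e)=0$ at every vertex $v$ (Kirchhoff condition). A $1$-form $\alpha$ consists of a smooth $1$-form $\alpha_e$ on each closed edge such that $\sum_{e\sim v}\alpha_e(\nu_{v,e})=0$ at every $v$. $H^1_{dR}(G,\mathbb{R})$ is the space of real $1$-forms modulo $d$ of real $0$-forms, and $H^1_{dR}(G,\mathbb{Z})$ is the subgroup of classes whose integrals over all closed walks are integers. Spectra. For a real $1$-form $\alpha$ put $d_\alpha f=df+2\pi i f\alpha$ and $\Delta_\alpha=d_\alpha^*d_\alpha$; explicitly, if $\alpha=a\,dx$ in the arc length coordinate on an edge, then $\Delta_\alpha f=-\left(\frac{d}{dx}+2\pi i a\right)^2 f$ on that edge. Its domain consists of the continuous $f$ that lie in the $L^2$-Sobolev space of order $2$ on each edge and satisfy the Kirchhoff condition at each vertex. $\mathrm{Spec}_\alpha(G)$ is the spectrum of $\Delta_\alpha$, with multiplicities. A real $1$-form $\alpha$ is generic if the image of the ray $t\alpha$ in the torus $H^1_{dR}(G,\mathbb{R})/H^1_{dR}(G,\mathbb{Z})$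 is dense. A periodic orbit is an oriented closed walk in the graph; it is minimal if it has minimal length within its homology class. For a connected component $G_i$ and $c\in H_1(G_i,\mathbb{Z})$, $\ell_{G_i}(c)$ denotes the length of the minimal periodic orbit(s) representing $c$ (with the convention $\ell_{G_i}(0)=0$, realized by a trivial closed walk). *)

theory Defs
  imports
    "HOL-Analysis.Analysis"
    "HOL-Library.Function_Algebras"
    "HOL-Algebra.Coset"
    "Graph_Theory.Digraph_Component"
begin

section \<open>Quantum graphs\<close>

text \<open>
  A quantum graph is a finite multigraph \<open>G\<close> with edge lengths \<open>L\<close>. The arc \<open>e\<close> is the interval
  \<open>[0, L e]\<close>, with \<open>0\<close> at \<open>tail G e\<close> and \<open>L e\<close> at \<open>head G e\<close>; this orientation only serves to fix
  the coordinate. The degree counts a loop twice. Isolated vertices and the empty graph are allowed.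
\<close>

locale quantum_graph = fin_digraph G for G :: "('v, 'e) pre_digraph" +
  fixes L :: "'e \<Rightarrow> real"
  assumes length_pos: "e \<in> arcs G \<Longrightarrow> 0 < L e"
    and degree_neq_2: "v \<in> verts G \<Longrightarrow> in_degree G v + out_degree G v \<noteq> 2"

definition graph_components :: "('v, 'e) pre_digraph \<Rightarrow> ('v, 'e) pre_digraph set" where
  "graph_components G = {H. pre_digraph.max_subgraph G Digraph_Component.connected H}"

text \<open>
  Walks traverse edges in either direction: \<open>(e, True)\<close> is \<open>e\<close> from tail to head and \<open>(e, False)\<close>
  is its reverse. The empty list is the trivial closed walk.
\<close>

definition double :: "('v, 'e) pre_digraph \<Rightarrow> ('v, 'e \<times> bool) pre_digraph" where
  "double G = \<lparr>verts = verts G, arcs = arcs G \<times> UNIV,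
     tail = (\<lambda>(e, b). if b then tail G e else head G e),
     head = (\<lambda>(e, b). if b then head G e else tail G e)\<rparr>"

definition closed_walk :: "('v, 'e) pre_digraph \<Rightarrow> ('e \<times> bool) list \<Rightarrow> bool" where
  "closed_walk G w \<longleftrightarrow> (\<exists>v. pre_digraph.awalk (double G) v w v)"

definition walk_length :: "('e \<Rightarrow> real) \<Rightarrow> ('e \<times> bool) list \<Rightarrow> real" where
  "walk_length L w = (\<Sum>(e, b)\<leftarrow>w. L e)"

definition walk_integral :: "('e \<Rightarrow> real) \<Rightarrow> ('e \<Rightarrow> real \<Rightarrow> real) \<Rightarrow> ('e \<times> bool) list \<Rightarrow> real" where
  "walk_integral L \<alpha> w = (\<Sum>(e, b)\<leftarrow>w. (if b then 1 else - 1) * integral {0..L e} (\<alpha> e))"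


section \<open>Integral homology\<close>

text \<open>
  The homology of the one-dimensional complex \<open>G\<close>: there are no boundaries in degree 1, so
  \<open>H\<^sub>1(G, \<int>)\<close> is the kernel of the boundary map from integral edge chains to vertex chains.
\<close>

definition homology1 :: "('v, 'e) pre_digraph \<Rightarrow> ('e \<Rightarrow> int) monoid" where
  "homology1 G = \<lparr>carrier = {c. (\<forall>e. e \<notin> arcs G \<longrightarrow> c e = 0) \<and>
       (\<forall>v\<in>verts G. (\<Sum>e\<in>in_arcs G v. c e) - (\<Sum>e\<in>out_arcs G v. c e) = 0)},
     monoid.mult = (+), one = 0\<rparr>"

definition walk_class :: "('e \<times> bool) list \<Rightarrow> 'e \<Rightarrow> int" where
  "walk_class w e = int (count_list w (e, True)) - int (count_list w (e, False))"

definition cycle_integral ::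
    "('v, 'e) pre_digraph \<Rightarrow> ('e \<Rightarrow> real) \<Rightarrow> ('e \<Rightarrow> real \<Rightarrow> real) \<Rightarrow> ('e \<Rightarrow> int) \<Rightarrow> real" where
  "cycle_integral G L \<alpha> c = (\<Sum>e\<in>arcs G. of_int (c e) * integral {0..L e} (\<alpha> e))"

definition minimal_orbit ::
    "('v, 'e) pre_digraph \<Rightarrow> ('e \<Rightarrow> real) \<Rightarrow> ('e \<times> bool) list \<Rightarrow> bool" where
  "minimal_orbit G L w \<longleftrightarrow> closed_walk G w \<and>
     (\<forall>w'. closed_walk G w' \<and> walk_class w' = walk_class w \<longrightarrow> walk_length L w \<le> walk_length L w')"

text \<open>For connected \<open>G\<close> and a cycle \<open>c\<close> a minimal orbit exists; its length is determined by \<open>c\<close>.\<close>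

definition minimal_length ::
    "('v, 'e) pre_digraph \<Rightarrow> ('e \<Rightarrow> real) \<Rightarrow> ('e \<Rightarrow> int) \<Rightarrow> real" where
  "minimal_length G L c = (THE l. \<exists>w. minimal_orbit G L w \<and> walk_class w = c \<and> walk_length L w = l)"


section \<open>Functions and forms\<close>

text \<open>
  A function on \<open>G\<close> is given by its values at the vertices and at the points of the closed edges,
  and is \<open>0\<close> at all other arguments. Vertices and edge ends are separate arguments; continuity
  makes the values agree.
\<close>

datatype ('v, 'e) point = Vertex 'v | At 'e real

definition edgewise :: "(('v, 'e) point \<Rightarrow> 'b) \<Rightarrow> 'e \<Rightarrow> real \<Rightarrow> 'b" where
  "edgewise f e x = f (At e x)"

definition points :: "('v, 'e) pre_digraph \<Rightarrow> ('e \<Rightarrow> real) \<Rightarrow> ('v, 'e) point set" where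
  "points G L = Vertex ` verts G \<union> {At e x | e x. e \<in> arcs G \<and> x \<in> {0..L e}}"

definition continuous_functions ::
    "('v, 'e) pre_digraph \<Rightarrow> ('e \<Rightarrow> real) \<Rightarrow> (('v, 'e) point \<Rightarrow> 'b::real_normed_vector) set" where
  "continuous_functions G L = {f. (\<forall>p. p \<notin> points G L \<longrightarrow> f p = 0) \<and>
     (\<forall>e\<in>arcs G. continuous_on {0..L e} (edgewise f e) \<and>
        f (At e 0) = f (Vertex (tail G e)) \<and> f (At e (L e)) = f (Vertex (head G e)))}"

definition edge_deriv ::
    "('e \<Rightarrow> real) \<Rightarrow> ('e \<Rightarrow> real \<Rightarrow> 'b::real_normed_vector) \<Rightarrow> 'e \<Rightarrow> real \<Rightarrow> 'b" where
  "edge_deriv L u e x = vector_derivative (u e) (at x within {0..L e})"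

text \<open>The outward unit normal is \<open>d/dx\<close> at the head end of an edge and \<open>- d/dx\<close> at its tail end.\<close>

definition kirchhoff ::
    "('v, 'e) pre_digraph \<Rightarrow> ('e \<Rightarrow> real) \<Rightarrow> ('e \<Rightarrow> real \<Rightarrow> 'b::real_normed_vector) \<Rightarrow> bool" where
  "kirchhoff G L a \<longleftrightarrow>
     (\<forall>v\<in>verts G. (\<Sum>e\<in>in_arcs G v. a e (L e)) - (\<Sum>e\<in>out_arcs G v. a e 0) = 0)"

definition smooth_upto :: "real \<Rightarrow> (real \<Rightarrow> 'b::real_normed_vector) \<Rightarrow> bool" where
  "smooth_upto l f \<longleftrightarrow> (\<exists>D :: nat \<Rightarrow> real \<Rightarrow> 'b. (\<forall>x\<in>{0..l}. D 0 x = f x) \<and>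
     (\<forall>n. \<forall>x\<in>{0..l}. (D n has_vector_derivative D (Suc n) x) (at x within {0..l})))"

definition zero_forms ::
    "('v, 'e) pre_digraph \<Rightarrow> ('e \<Rightarrow> real) \<Rightarrow> (('v, 'e) point \<Rightarrow> real) set" where
  "zero_forms G L = {f \<in> continuous_functions G L.
     (\<forall>e\<in>arcs G. smooth_upto (L e) (edgewise f e)) \<and> kirchhoff G L (edge_deriv L (edgewise f))}"

text \<open>The 1-form \<open>a dx\<close> on the edges is represented by its coefficients \<open>a\<close>.\<close>

definition one_forms ::
    "('v, 'e) pre_digraph \<Rightarrow> ('e \<Rightarrow> real) \<Rightarrow> ('e \<Rightarrow> real \<Rightarrow> real) set" where
  "one_forms G L = {\<alpha>. (\<forall>e x. \<not> (e \<in> arcs G \<and> x \<in> {0..L e}) \<longrightarrow> \<alpha> e x = 0) \<and>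
     (\<forall>e\<in>arcs G. smooth_upto (L e) (\<alpha> e)) \<and> kirchhoff G L \<alpha>}"

definition differential ::
    "('v, 'e) pre_digraph \<Rightarrow> ('e \<Rightarrow> real) \<Rightarrow> (('v, 'e) point \<Rightarrow> real) \<Rightarrow> 'e \<Rightarrow> real \<Rightarrow> real" where
  "differential G L f e x =
     (if e \<in> arcs G \<and> x \<in> {0..L e} then edge_deriv L (edgewise f) e x else 0)"


section \<open>De Rham cohomology and generic forms\<close>

definition one_form_group ::
    "('v, 'e) pre_digraph \<Rightarrow> ('e \<Rightarrow> real) \<Rightarrow> ('e \<Rightarrow> real \<Rightarrow> real) monoid" where
  "one_form_group G L = \<lparr>carrier = one_forms G L, monoid.mult = (+), one = 0\<rparr>"

definition exact_forms ::
    "('v, 'e) pre_digraph \<Rightarrow> ('e \<Rightarrow> real) \<Rightarrow> ('e \<Rightarrow> real \<Rightarrow> real) set" where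
  "exact_forms G L = differential G L ` zero_forms G L"

definition de_rham ::
    "('v, 'e) pre_digraph \<Rightarrow> ('e \<Rightarrow> real) \<Rightarrow> ('e \<Rightarrow> real \<Rightarrow> real) set monoid" where
  "de_rham G L = one_form_group G L Mod exact_forms G L"

definition de_rham_int ::
    "('v, 'e) pre_digraph \<Rightarrow> ('e \<Rightarrow> real) \<Rightarrow> ('e \<Rightarrow> real \<Rightarrow> real) set set" where
  "de_rham_int G L = {A \<in> carrier (de_rham G L).
     \<forall>\<alpha>\<in>A. \<forall>w. closed_walk G w \<longrightarrow> walk_integral L \<alpha> w \<in> \<int>}"

definition torus ::
    "('v, 'e) pre_digraph \<Rightarrow> ('e \<Rightarrow> real) \<Rightarrow> ('e \<Rightarrow> real \<Rightarrow> real) set set monoid" where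
  "torus G L = de_rham G L Mod de_rham_int G L"

definition torus_class ::
    "('v, 'e) pre_digraph \<Rightarrow> ('e \<Rightarrow> real) \<Rightarrow> ('e \<Rightarrow> real \<Rightarrow> real) \<Rightarrow> ('e \<Rightarrow> real \<Rightarrow> real) set set" where
  "torus_class G L \<alpha> =
     de_rham_int G L #>\<^bsub>de_rham G L\<^esub> (exact_forms G L #>\<^bsub>one_form_group G L\<^esub> \<alpha>)"

text \<open>
  The quotient topology for the uniform norm on 1-forms. The exact forms, being those with vanishing
  integrals over all closed walks, are closed for this norm, so on the finite-dimensional space
  \<open>H\<^sup>1\<close> it induces the usual vector space topology, and on the torus the usual one.
\<close>

definition torus_open ::
    "('v, 'e) pre_digraph \<Rightarrow> ('e \<Rightarrow> real) \<Rightarrow> ('e \<Rightarrow> real \<Rightarrow> real) set set set \<Rightarrow> bool" where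
  "torus_open G L U \<longleftrightarrow> U \<subseteq> carrier (torus G L) \<and>
     (\<forall>\<alpha>\<in>one_forms G L. torus_class G L \<alpha> \<in> U \<longrightarrow>
        (\<exists>\<epsilon>>0. \<forall>\<beta>\<in>one_forms G L.
           (\<forall>e\<in>arcs G. \<forall>x\<in>{0..L e}. \<bar>\<beta> e x - \<alpha> e x\<bar> < \<epsilon>) \<longrightarrow> torus_class G L \<beta> \<in> U))"

definition torus_topology ::
    "('v, 'e) pre_digraph \<Rightarrow> ('e \<Rightarrow> real) \<Rightarrow> ('e \<Rightarrow> real \<Rightarrow> real) set set topology" where
  "torus_topology G L = topology (torus_open G L)"

lemma istopology_torus_open: "istopology (torus_open G L)"
  unfolding istopology_def
proof (intro conjI allI impI)
  fix S T
  assume S: "torus_open G L S" and T: "torus_open G L T"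
  show "torus_open G L (S \<inter> T)"
    unfolding torus_open_def
  proof (intro conjI ballI impI)
    show "S \<inter> T \<subseteq> carrier (torus G L)"
      using S by (auto simp: torus_open_def)
    fix \<alpha> assume \<alpha>: "\<alpha> \<in> one_forms G L" "torus_class G L \<alpha> \<in> S \<inter> T"
    obtain d where d: "d > 0" "\<forall>\<beta>\<in>one_forms G L.
        (\<forall>e\<in>arcs G. \<forall>x\<in>{0..L e}. \<bar>\<beta> e x - \<alpha> e x\<bar> < d) \<longrightarrow> torus_class G L \<beta> \<in> S"
      using S \<alpha> unfolding torus_open_def by (meson IntD1)
    obtain d' where d': "d' > 0" "\<forall>\<beta>\<in>one_forms G L.
        (\<forall>e\<in>arcs G. \<forall>x\<in>{0..L e}. \<bar>\<beta> e x - \<alpha> e x\<bar> < d') \<longrightarrow> torus_class G L \<beta> \<in> T"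
      using T \<alpha> unfolding torus_open_def by (meson IntD2)
    show "\<exists>\<epsilon>>0. \<forall>\<beta>\<in>one_forms G L.
        (\<forall>e\<in>arcs G. \<forall>x\<in>{0..L e}. \<bar>\<beta> e x - \<alpha> e x\<bar> < \<epsilon>) \<longrightarrow> torus_class G L \<beta> \<in> S \<inter> T"
      by (rule exI[of _ "min d d'"]) (use d d' in auto)
  qed
next
  fix \<K> assume K: "\<forall>K\<in>\<K>. torus_open G L K"
  show "torus_open G L (\<Union>\<K>)"
    unfolding torus_open_def
  proof (intro conjI ballI impI)
    show "\<Union>\<K> \<subseteq> carrier (torus G L)"
      using K by (auto simp: torus_open_def)
    fix \<alpha> assume \<alpha>: "\<alpha> \<in> one_forms G L" "torus_class G L \<alpha> \<in> \<Union>\<K>"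
    then obtain K where "K \<in> \<K>" "torus_class G L \<alpha> \<in> K" by blast
    with K \<alpha>(1) obtain d where "d > 0" "\<forall>\<beta>\<in>one_forms G L.
        (\<forall>e\<in>arcs G. \<forall>x\<in>{0..L e}. \<bar>\<beta> e x - \<alpha> e x\<bar> < d) \<longrightarrow> torus_class G L \<beta> \<in> K"
      unfolding torus_open_def by meson
    with \<open>K \<in> \<K>\<close> show "\<exists>\<epsilon>>0. \<forall>\<beta>\<in>one_forms G L.
        (\<forall>e\<in>arcs G. \<forall>x\<in>{0..L e}. \<bar>\<beta> e x - \<alpha> e x\<bar> < \<epsilon>) \<longrightarrow> torus_class G L \<beta> \<in> \<Union>\<K>"
      by blast
  qed
qed

lemma openin_torus_topology: "openin (torus_topology G L) = torus_open G L"
  by (simp add: torus_topology_def istopology_torus_open)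

definition scale_form :: "real \<Rightarrow> ('e \<Rightarrow> real \<Rightarrow> real) \<Rightarrow> 'e \<Rightarrow> real \<Rightarrow> real" where
  "scale_form t \<alpha> = (\<lambda>e x. t * \<alpha> e x)"

definition generic ::
    "('v, 'e) pre_digraph \<Rightarrow> ('e \<Rightarrow> real) \<Rightarrow> ('e \<Rightarrow> real \<Rightarrow> real) \<Rightarrow> bool" where
  "generic G L \<alpha> \<longleftrightarrow> \<alpha> \<in> one_forms G L \<and>
     torus_topology G L closure_of {torus_class G L (scale_form t \<alpha>) | t. t \<ge> 0}
       = topspace (torus_topology G L)"


section \<open>The spectrum\<close>

text \<open>
  The Sobolev space \<open>H\<^sup>2\<close> of an interval, in terms of continuous representatives: differentiable
  functions whose derivative is the indefinite integral of a square-integrable function.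
\<close>

definition sobolev2 :: "real \<Rightarrow> (real \<Rightarrow> complex) \<Rightarrow> bool" where
  "sobolev2 l f \<longleftrightarrow> (\<exists>g h.
     (\<forall>x\<in>{0..l}. (f has_vector_derivative g x) (at x within {0..l})) \<and>
     h \<in> borel_measurable (lebesgue_on {0..l}) \<and>
     integrable (lebesgue_on {0..l}) (\<lambda>x. (cmod (h x))\<^sup>2) \<and>
     (\<forall>x\<in>{0..l}. (h has_integral (g x - g 0)) {0..x}))"

definition laplace_domain ::
    "('v, 'e) pre_digraph \<Rightarrow> ('e \<Rightarrow> real) \<Rightarrow> (('v, 'e) point \<Rightarrow> complex) set" where
  "laplace_domain G L = {f \<in> continuous_functions G L.
     (\<forall>e\<in>arcs G. sobolev2 (L e) (edgewise f e)) \<and> kirchhoff G L (edge_deriv L (edgewise f))}"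

definition cov_deriv ::
    "('e \<Rightarrow> real) \<Rightarrow> ('e \<Rightarrow> real \<Rightarrow> real) \<Rightarrow> ('e \<Rightarrow> real \<Rightarrow> complex) \<Rightarrow> 'e \<Rightarrow> real \<Rightarrow> complex" where
  "cov_deriv L \<alpha> u e x = edge_deriv L u e x + 2 * pi * \<i> * \<alpha> e x * u e x"

text \<open>
  An isolated vertex is a component without edges. On it \<open>d\<^sub>\<alpha>\<close>, and hence \<open>\<Delta>\<^sub>\<alpha>\<close>, vanishes, and its
  functions form a summand \<open>\<complex>\<close> of \<open>L\<^sup>2(G)\<close>, so that \<open>ker \<Delta>\<^sub>0\<close> is the space of locally constant
  functions. The values of elements of \<open>L\<^sup>2(G)\<close> at other vertices are immaterial.
\<close>

definition laplacian ::
    "('e \<Rightarrow> real) \<Rightarrow> ('e \<Rightarrow> real \<Rightarrow> real) \<Rightarrow> (('v, 'e) point \<Rightarrow> complex) \<Rightarrow> ('v, 'e) point \<Rightarrow> complex" where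
  "laplacian L \<alpha> f p = (case p of Vertex v \<Rightarrow> 0
     | At e x \<Rightarrow> - cov_deriv L \<alpha> (cov_deriv L \<alpha> (edgewise f)) e x)"

definition isolated_verts :: "('v, 'e) pre_digraph \<Rightarrow> 'v set" where
  "isolated_verts G = {v \<in> verts G. in_arcs G v = {} \<and> out_arcs G v = {}}"

definition L2_functions ::
    "('v, 'e) pre_digraph \<Rightarrow> ('e \<Rightarrow> real) \<Rightarrow> (('v, 'e) point \<Rightarrow> complex) set" where
  "L2_functions G L = {h. \<forall>e\<in>arcs G. edgewise h e \<in> borel_measurable (lebesgue_on {0..L e}) \<and>
     integrable (lebesgue_on {0..L e}) (\<lambda>x. (cmod (edgewise h e x))\<^sup>2)}"

definition L2_norm ::
    "('v, 'e) pre_digraph \<Rightarrow> ('e \<Rightarrow> real) \<Rightarrow> (('v, 'e) point \<Rightarrow> complex) \<Rightarrow> real" where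
  "L2_norm G L h = sqrt ((\<Sum>e\<in>arcs G. \<integral>x. (cmod (edgewise h e x))\<^sup>2 \<partial>lebesgue_on {0..L e}) +
     (\<Sum>v\<in>isolated_verts G. (cmod (h (Vertex v)))\<^sup>2))"

definition L2_eq :: "('v, 'e) pre_digraph \<Rightarrow> ('e \<Rightarrow> real) \<Rightarrow>
    (('v, 'e) point \<Rightarrow> complex) \<Rightarrow> (('v, 'e) point \<Rightarrow> complex) \<Rightarrow> bool" where
  "L2_eq G L g h \<longleftrightarrow>
     (\<forall>e\<in>arcs G. AE x in lebesgue_on {0..L e}. edgewise g e x = edgewise h e x) \<and>
     (\<forall>v\<in>isolated_verts G. g (Vertex v) = h (Vertex v))"

definition shifted_laplacian :: "('e \<Rightarrow> real) \<Rightarrow> ('e \<Rightarrow> real \<Rightarrow> real) \<Rightarrow> complex \<Rightarrow>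
    (('v, 'e) point \<Rightarrow> complex) \<Rightarrow> ('v, 'e) point \<Rightarrow> complex" where
  "shifted_laplacian L \<alpha> z f p = laplacian L \<alpha> f p - z * f p"

definition laplace_resolvent_set ::
    "('v, 'e) pre_digraph \<Rightarrow> ('e \<Rightarrow> real) \<Rightarrow> ('e \<Rightarrow> real \<Rightarrow> real) \<Rightarrow> complex set" where
  "laplace_resolvent_set G L \<alpha> = {z.
     (\<forall>h\<in>L2_functions G L. \<exists>!f. f \<in> laplace_domain G L \<and> L2_eq G L (shifted_laplacian L \<alpha> z f) h) \<and>
     (\<exists>C. \<forall>f\<in>laplace_domain G L. L2_norm G L f \<le> C * L2_norm G L (shifted_laplacian L \<alpha> z f))}"

definition eigenspace :: "('v, 'e) pre_digraph \<Rightarrow> ('e \<Rightarrow> real) \<Rightarrow> ('e \<Rightarrow> real \<Rightarrow> real) \<Rightarrow>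
    complex \<Rightarrow> (('v, 'e) point \<Rightarrow> complex) set" where
  "eigenspace G L \<alpha> z = {f \<in> laplace_domain G L. L2_eq G L (shifted_laplacian L \<alpha> z f) (\<lambda>p. 0)}"

text \<open>The spectrum with multiplicities, as the graph of the multiplicity function on the spectrum.\<close>

definition Spec ::
    "('v, 'e) pre_digraph \<Rightarrow> ('e \<Rightarrow> real) \<Rightarrow> ('e \<Rightarrow> real \<Rightarrow> real) \<Rightarrow> (complex \<times> nat) set" where
  "Spec G L \<alpha> = {(z, m). z \<notin> laplace_resolvent_set G L \<alpha> \<and>
     m = vector_space.dim (\<lambda>c f p. c * f p) (eigenspace G L \<alpha> z)}"

end

theory Submission
  imports Defs "Jordan_Normal_Form.Determinant" "HOL-Complex_Analysis.Complex_Analysis" "HOL-Real_Asymp.Real_Asymp"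
begin

text \<open>
  An eigenfunction for \<open>k\<^sup>2\<close>, \<open>k \<noteq> 0\<close>, is on every edge a superposition of two waves that run in opposite
  directions, and is determined by the amplitudes of the waves that leave the vertices. Let \<open>T k\<close>
  be the matrix that lets these waves travel along their edges with frequency \<open>k\<close> and scatters them at
  the other end; it is an isometry composed with the diagonal matrix of the phases \<open>exp (\<i> k l)\<close>, and
  the eigenfunctions correspond to its fixed vectors (\<open>dim_eigenspace\<close>). So the spectrum determines
  \<open>dim ker (1 - T k)\<close> for all real \<open>k \<noteq> 0\<close>.

  This determines the function \<open>tr ((1 - T k)\<^sup>-\<^sup>1 T k \<Lambda>)\<close>, where \<open>\<Lambda>\<close> multiplies by the lengths
  (\<open>resolvent_trace_determined\<close>). It is meromorphic and bounded by a multiple of \<open>1 + 1 / \<bar>Im k\<bar>\<close>,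
  because \<open>T k\<close> contracts in the upper half plane and expands in the lower one. So it has at most
  simple poles, on the real axis, and the residue is \<open>\<i>\<close> times the dimension of the kernel. The
  difference of two such functions with the same residues is entire and bounded, and it decays; a
  pole at \<open>0\<close>, which the eigenvalues \<open>k\<^sup>2 \<noteq> 0\<close> do not control, is excluded by the decay as well. For
  large \<open>Im k\<close> the trace expands into a sum over closed sequences of directed edges, which have non-zero
  weight only if they are closed walks. The spectrum thus determines the sum of the weights of the closed
  walks of each length (\<open>orbit_sums_determined\<close>). With the form \<open>t \<alpha>\<close>, the weight of a walk \<open>w\<close> acquires
  the factor \<open>exp (- 2 \<pi> \<i> t \<integral>\<^sub>w \<alpha>)\<close>, so the spectra for small \<open>t\<close> determine this sum even for the walks of
  given length and given integral (\<open>flux_orbit_sums_determined\<close>).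

  A walk that is shortest among those with the same non-zero integral does not backtrack, and therefore
  has positive weight; so the length of these walks is determined (\<open>flux_minimal_transfer\<close>). For generic \<open>\<alpha>\<close>,
  integration of \<open>\<alpha>\<close> is injective on the homology of \<open>G\<close> (\<open>generic_cycle_integral_nonzero\<close>), so these
  walks are the minimal orbits, and each \<open>H\<^sub>1(G\<^sub>i, \<int>)\<close> is isomorphic to the group of the integrals of its
  elements. The union of these groups of real numbers is determined, and so is the way it decomposes
  into groups, since the sum of non-zero elements of two of them lies in none (\<open>periods_subset\<close>).

  The components with trivial homology are not seen by the closed walks with non-zero integral. They are
  counted by the multiplicity of the eigenvalue \<open>0\<close> for \<open>t = 0\<close>, which is the number of all
  components (\<open>dim_zero_eigenspace\<close>).
\<close>


section \<open>Inverses of holomorphic matrices\<close>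

lemma holomorphic_det:
  fixes A :: "complex \<Rightarrow> complex mat"
  assumes "\<And>k. A k \<in> carrier_mat n n"
    and "\<And>i j. i < n \<Longrightarrow> j < n \<Longrightarrow> (\<lambda>k. A k $$ (i, j)) holomorphic_on S"
  shows "(\<lambda>k. Determinant.det (A k)) holomorphic_on S"
proof -
  have "(\<lambda>k. \<Sum>p | p permutes {0..<n}. signof p * (\<Prod>i = 0..<n. A k $$ (i, p i))) holomorphic_on S"
    by (intro holomorphic_intros assms(2)) (auto simp: permutes_in_image)
  then show ?thesis
    by (simp add: det_def'[OF assms(1)])
qed

lemma holomorphic_cofactor:
  fixes A :: "complex \<Rightarrow> complex mat"
  assumes A: "\<And>k. A k \<in> carrier_mat n n" and "i < n" "j < n"
    and hol: "\<And>i j. i < n \<Longrightarrow> j < n \<Longrightarrow> (\<lambda>k. A k $$ (i, j)) holomorphic_on S"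
  shows "(\<lambda>k. Determinant.cofactor (A k) i j) holomorphic_on S"
proof -
  have dims: "dim_row (A k) = n" "dim_col (A k) = n" for k
    using A[of k] by auto
  have "(\<lambda>k. Determinant.det (mat_delete (A k) i j)) holomorphic_on S"
  proof (rule holomorphic_det[of _ "n - 1"])
    show "mat_delete (A k) i j \<in> carrier_mat (n - 1) (n - 1)" for k
      using A[of k] by (rule mat_delete_carrier)
    fix a b assume "a < n - 1" "b < n - 1"
    then show "(\<lambda>k. mat_delete (A k) i j $$ (a, b)) holomorphic_on S"
      by (auto simp: mat_delete_def dims intro!: hol)
  qed
  then show ?thesis
    unfolding Determinant.cofactor_def by (intro holomorphic_intros)
qed

text \<open>
  Cramer's rule for matrices indexed by a finite set: the inverse of a holomorphic matrix is
  meromorphic, with poles only where the matrix is singular.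
\<close>

lemma holomorphic_cramer:
  fixes A :: "complex \<Rightarrow> 'b \<Rightarrow> 'b \<Rightarrow> complex"
  assumes fin: "finite B"
    and hol: "\<And>b c. b \<in> B \<Longrightarrow> c \<in> B \<Longrightarrow> (\<lambda>k. A k b c) holomorphic_on UNIV"
  obtains d N where "d holomorphic_on UNIV"
    and "\<And>b c. b \<in> B \<Longrightarrow> c \<in> B \<Longrightarrow> (\<lambda>k. N k b c) holomorphic_on UNIV"
    and "\<And>k b c. b \<in> B \<Longrightarrow> c \<in> B \<Longrightarrow> (\<Sum>e\<in>B. A k b e * N k e c) = (if b = c then d k else 0)"
    and "\<And>k b c. b \<in> B \<Longrightarrow> c \<in> B \<Longrightarrow> (\<Sum>e\<in>B. N k b e * A k e c) = (if b = c then d k else 0)"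
    and "\<And>k. d k = 0 \<Longrightarrow> \<exists>x. (\<exists>b\<in>B. x b \<noteq> 0) \<and> (\<forall>b\<in>B. (\<Sum>c\<in>B. A k b c * x c) = 0)"
proof -
  define n where "n = card B"
  obtain h where h: "bij_betw h {0..<n} B"
    using ex_bij_betw_nat_finite[OF fin] unfolding n_def by blast
  define g where "g = inv_into {0..<n} h"
  have g: "g b < n" "h (g b) = b" if "b \<in> B" for b
    using that h bij_betw_inv_into_right[OF h that] inv_into_into[of b h "{0..<n}"]
    by (auto simp: g_def bij_betw_def)
  have hB: "h i \<in> B" "g (h i) = i" if "i < n" for i
    using that h by (auto simp: g_def bij_betw_def)
  have inj: "g b = g c \<longleftrightarrow> b = c" if "b \<in> B" "c \<in> B" for b c
    using that g by metis
  have re: "(\<Sum>e\<in>B. f e) = (\<Sum>j = 0..<n. f (h j))" for f :: "'b \<Rightarrow> complex"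
    using sum.reindex_bij_betw[OF h, of f] by simp
  define X where "X k = mat n n (\<lambda>(i, j). A k (h i) (h j))" for k
  have X: "X k \<in> carrier_mat n n" for k by (simp add: X_def)
  have Xij: "X k $$ (i, j) = A k (h i) (h j)" if "i < n" "j < n" for k i j
    using that by (simp add: X_def)
  have Xhol: "(\<lambda>k. X k $$ (i, j)) holomorphic_on UNIV" if "i < n" "j < n" for i j
    using hol[of "h i" "h j"] that hB by (simp add: Xij)
  define N where "N k b c = adj_mat (X k) $$ (g b, g c)" for k b c
  have adjc: "adj_mat (X k) \<in> carrier_mat n n" for k by (rule adj_mat(1)[OF X])
  show thesis
  proof (rule that[of "\<lambda>k. Determinant.det (X k)" N])
    show "(\<lambda>k. Determinant.det (X k)) holomorphic_on UNIV"
      by (rule holomorphic_det[OF X Xhol])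
    fix b c assume bc: "b \<in> B" "c \<in> B"
    have "(\<lambda>k. Determinant.cofactor (X k) (g c) (g b)) holomorphic_on UNIV"
      by (rule holomorphic_cofactor[OF X _ _ Xhol]) (use bc g in auto)
    then show "(\<lambda>k. N k b c) holomorphic_on UNIV"
      using bc g X by (simp add: N_def adj_mat_def X_def)
  next
    fix k b c assume bc: "b \<in> B" "c \<in> B"
    have "(X k * adj_mat (X k)) $$ (g b, g c) = (\<Sum>j = 0..<n. A k b (h j) * N k (h j) c)"
      using bc g hB X[of k] adjc[of k] by (auto simp: scalar_prod_def N_def Xij intro!: sum.cong)
    then show "(\<Sum>e\<in>B. A k b e * N k e c) = (if b = c then Determinant.det (X k) else 0)"
      using bc g by (auto simp: adj_mat(2)[OF X] re inj split: if_splits)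
  next
    fix k b c assume bc: "b \<in> B" "c \<in> B"
    have "(adj_mat (X k) * X k) $$ (g b, g c) = (\<Sum>j = 0..<n. N k b (h j) * A k (h j) c)"
      using bc g hB X[of k] adjc[of k] by (auto simp: scalar_prod_def N_def Xij intro!: sum.cong)
    then show "(\<Sum>e\<in>B. N k b e * A k e c) = (if b = c then Determinant.det (X k) else 0)"
      using bc g by (auto simp: adj_mat(3)[OF X] re inj split: if_splits)
  next
    fix k assume "Determinant.det (X k) = 0"
    then obtain v where v: "v \<in> carrier_vec n" "v \<noteq> 0\<^sub>v n" "X k *\<^sub>v v = 0\<^sub>v n"
      using det_0_iff_vec_prod_zero_field[OF X] by auto
    define x where "x b = v $ g b" for b
    obtain i where i: "i < n" "v $ i \<noteq> 0"
      using v(1,2) by (metis carrier_vecD eq_vecI index_zero_vec)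
    have "x (h i) \<noteq> 0" using i hB by (simp add: x_def)
    moreover have "(\<Sum>c\<in>B. A k b c * x c) = 0" if "b \<in> B" for b
    proof -
      have "(X k *\<^sub>v v) $ g b = (\<Sum>j = 0..<n. A k b (h j) * x (h j))"
        using that v(1) g hB X[of k] by (auto simp: scalar_prod_def x_def Xij intro!: sum.cong)
      then show ?thesis using v(3) g that by (simp add: re)
    qed
    ultimately show "\<exists>x. (\<exists>b\<in>B. x b \<noteq> 0) \<and> (\<forall>b\<in>B. (\<Sum>c\<in>B. A k b c * x c) = 0)"
      using hB i by blast
  qed
qed


section \<open>Functions on a finite set\<close>

interpretation fs: vector_space "\<lambda>c (f :: 'p \<Rightarrow> complex) p. c * f p"
  by unfold_locales (auto simp: fun_eq_iff algebra_simps)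

lemma fun_sum_eval: "(\<Sum>i\<in>A. f i) p = (\<Sum>i\<in>A. f i p)"
  for f :: "'i \<Rightarrow> 'p \<Rightarrow> 'a::comm_monoid_add"
  by (induction A rule: infinite_finite_induct) auto

definition unit_fun :: "'b \<Rightarrow> 'b \<Rightarrow> complex" where
  "unit_fun b = (\<lambda>c. if c = b then 1 else 0)"

lemma sum_unit_fun:
  assumes "finite B" "\<And>b. b \<notin> B \<Longrightarrow> x b = 0"
  shows "(\<Sum>b\<in>B. (\<lambda>p. x b * unit_fun b p)) = x"
proof
  fix p
  show "(\<Sum>b\<in>B. (\<lambda>p. x b * unit_fun b p)) p = x p"
    using assms by (cases "p \<in> B") (auto simp: unit_fun_def fun_sum_eval if_distrib cong: if_cong)
qed

lemma finite_independent_supported: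
  assumes "finite B" "fs.independent S" "\<And>x b. x \<in> S \<Longrightarrow> b \<notin> B \<Longrightarrow> x b = 0"
  shows "finite S"
proof -
  have "x \<in> fs.span (unit_fun ` B)" if "x \<in> S" for x
  proof -
    have "(\<Sum>b\<in>B. (\<lambda>p. x b * unit_fun b p)) \<in> fs.span (unit_fun ` B)"
      by (intro fs.span_sum fs.span_scale fs.span_base) auto
    then show ?thesis
      using sum_unit_fun[of B x] assms that by auto
  qed
  then show ?thesis
    using fs.independent_span_bound[of "unit_fun ` B" S] assms by auto
qed

text \<open>
  The trace of a projection is the dimension of its image. In terms of a basis \<open>S\<close> of the image \<open>K\<close>
  with coordinate functionals \<open>w\<^sub>v\<close>, the trace is \<open>\<Sum>\<^sub>v w\<^sub>v (P v)\<close>, and each summand is \<open>1\<close>.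
\<close>

lemma trace_projection:
  assumes fin: "finite B" and K: "fs.subspace K"
    and supp: "\<And>x b. x \<in> K \<Longrightarrow> b \<notin> B \<Longrightarrow> x b = 0"
    and lin: "Vector_Spaces.linear (\<lambda>c (f :: 'b \<Rightarrow> complex) p. c * f p) (\<lambda>c f p. c * f p) P"
    and PK: "\<And>x. P x \<in> K" and id: "\<And>x. x \<in> K \<Longrightarrow> P x = x"
  shows "(\<Sum>b\<in>B. P (unit_fun b) b) = of_nat (fs.dim K)"
proof -
  interpret P: Vector_Spaces.linear "\<lambda>c (f :: 'b \<Rightarrow> complex) p. c * f p" "\<lambda>c f p. c * f p" P
    by (fact lin)
  obtain S where S: "S \<subseteq> K" "fs.independent S" "K \<subseteq> fs.span S" "card S = fs.dim K"
    by (rule fs.basis_exists)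
  have finS: "finite S"
    using finite_independent_supported[OF fin S(2)] S(1) supp by blast
  define w where "w v x = fs.representation S (P x) v" for v x
  have span: "P x \<in> fs.span S" for x using PK S(3) by auto
  have expand: "P x b = (\<Sum>v\<in>S. w v x * v b)" for x b
  proof -
    have "P x = (\<Sum>v\<in>S. (\<lambda>p. w v x * v p))"
      using fs.sum_representation_eq[OF S(2) span finS order_refl, of x] by (simp add: w_def)
    then show ?thesis by (simp add: fun_sum_eval)
  qed
  have w_sum: "w v x = (\<Sum>b\<in>B. x b * w v (unit_fun b))" if "x \<in> K" for v x
  proof -
    have "P x = P (\<Sum>b\<in>B. (\<lambda>p. x b * unit_fun b p))"
      using sum_unit_fun[of B x] fin supp that by simp
    also have "\<dots> = (\<Sum>b\<in>B. (\<lambda>p. x b * P (unit_fun b) p))"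
      by (simp add: P.sum P.scale)
    finally have "w v x = fs.representation S (\<Sum>b\<in>B. (\<lambda>p. x b * P (unit_fun b) p)) v"
      by (simp add: w_def)
    also have "\<dots> = (\<Sum>b\<in>B. fs.representation S (\<lambda>p. x b * P (unit_fun b) p) v)"
      by (subst fs.representation_sum[OF S(2)]) (auto intro!: fs.span_scale span)
    also have "\<dots> = (\<Sum>b\<in>B. x b * w v (unit_fun b))"
      by (simp add: fs.representation_scale[OF S(2) span] w_def)
    finally show ?thesis .
  qed
  have "(\<Sum>b\<in>B. P (unit_fun b) b) = (\<Sum>b\<in>B. \<Sum>v\<in>S. w v (unit_fun b) * v b)"
    by (simp add: expand)
  also have "\<dots> = (\<Sum>v\<in>S. \<Sum>b\<in>B. v b * w v (unit_fun b))"
    by (subst sum.swap) (simp add: mult.commute)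
  also have "\<dots> = (\<Sum>v\<in>S. w v v)"
    using w_sum S(1) by (intro sum.cong) auto
  also have "\<dots> = (\<Sum>v\<in>S. 1)"
    using S(1,2) id by (intro sum.cong) (auto simp: w_def fs.representation_basis)
  finally show ?thesis using S(4) by simp
qed

section \<open>Bond scattering\<close>

text \<open>
  Waves travel along the bonds in \<open>B\<close>, each in one direction only, and are redistributed by \<open>U\<close> when
  they arrive at the ends; \<open>evolve k\<close> lets all of them pass one bond and the following scattering.
\<close>

locale scattering =
  fixes B :: "'b set" and U :: "'b \<Rightarrow> 'b \<Rightarrow> complex" and l :: "'b \<Rightarrow> real"
  assumes finite_bonds: "finite B"
    and bond_length_pos: "b \<in> B \<Longrightarrow> 0 < l b"
    and isometry: "(\<Sum>b\<in>B. (cmod (\<Sum>c\<in>B. U b c * x c))\<^sup>2) = (\<Sum>c\<in>B. (cmod (x c))\<^sup>2)"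
begin

definition evolve :: "complex \<Rightarrow> ('b \<Rightarrow> complex) \<Rightarrow> 'b \<Rightarrow> complex" where
  "evolve k x = (\<lambda>b. if b \<in> B then \<Sum>c\<in>B. U b c * exp (\<i> * k * l c) * x c else 0)"

definition stationary :: "complex \<Rightarrow> ('b \<Rightarrow> complex) set" where
  "stationary k = {x. evolve k x = x}"

definition amplitude :: "('b \<Rightarrow> complex) \<Rightarrow> real" where
  "amplitude x = L2_set (\<lambda>b. cmod (x b)) B"

definition supported :: "('b \<Rightarrow> complex) \<Rightarrow> bool" where
  "supported x \<longleftrightarrow> (\<forall>b. b \<notin> B \<longrightarrow> x b = 0)"

text \<open>
  The value for an empty set of bonds only has to be positive.
\<close>

definition min_length :: real where
  "min_length = (if B = {} then 1 else Min (l ` B))"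

lemma min_length_pos: "0 < min_length"
  using finite_bonds bond_length_pos by (auto simp: min_length_def)

lemma min_length_le: "b \<in> B \<Longrightarrow> min_length \<le> l b"
  using finite_bonds by (auto simp: min_length_def)

lemma supported_evolve [simp]: "supported (evolve k x)"
  by (simp add: supported_def evolve_def)

lemma supported_unit_fun [simp]: "b \<in> B \<Longrightarrow> supported (unit_fun b)"
  by (auto simp: supported_def unit_fun_def)

lemma supported_stationary: "x \<in> stationary k \<Longrightarrow> supported x"
  using supported_evolve[of k x] by (simp add: stationary_def)

lemma linear_evolve:
  "Vector_Spaces.linear (\<lambda>c (f :: 'b \<Rightarrow> complex) p. c * f p) (\<lambda>c f p. c * f p) (evolve k)"
  by unfold_locales
    (auto simp: evolve_def fun_eq_iff algebra_simps sum.distrib sum_distrib_left)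

sublocale evolve: Vector_Spaces.linear "\<lambda>c (f :: 'b \<Rightarrow> complex) p. c * f p" "\<lambda>c f p. c * f p" "evolve k" for k
  by (rule linear_evolve)

lemma subspace_stationary: "fs.subspace (stationary k)"
  by (auto simp: fs.subspace_def stationary_def evolve.add evolve.scale evolve.zero)

lemma amplitude_nonneg [simp]: "0 \<le> amplitude x"
  by (simp add: amplitude_def)

lemma amplitude_triangle: "amplitude (\<lambda>b. x b + y b) \<le> amplitude x + amplitude y"
proof -
  have "amplitude (\<lambda>b. x b + y b) \<le> L2_set (\<lambda>b. cmod (x b) + cmod (y b)) B"
    unfolding amplitude_def by (intro L2_set_mono norm_triangle_ineq) auto
  also have "\<dots> \<le> amplitude x + amplitude y"
    unfolding amplitude_def by (rule L2_set_triangle_ineq)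
  finally show ?thesis .
qed

lemma amplitude_scale: "amplitude (\<lambda>b. c * x b) = cmod c * amplitude x"
  by (simp add: amplitude_def L2_set_right_distrib norm_mult)

lemma amplitude_diff: "amplitude (\<lambda>b. x b - y b) \<le> amplitude x + amplitude y"
  using amplitude_triangle[of x "\<lambda>b. - 1 * y b"] amplitude_scale[of "-1" y] by simp

lemma amplitude_eq_0: "supported x \<Longrightarrow> amplitude x = 0 \<Longrightarrow> x = (\<lambda>_. 0)"
  using finite_bonds by (auto simp: amplitude_def L2_set_eq_0_iff supported_def fun_eq_iff)

lemma cmod_le_amplitude: "b \<in> B \<Longrightarrow> cmod (x b) \<le> amplitude x"
  unfolding amplitude_def using finite_bonds by (rule member_le_L2_set)

lemma amplitude_unit_fun: "b \<in> B \<Longrightarrow> amplitude (unit_fun b) = 1"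
  using finite_bonds
  by (simp add: amplitude_def L2_set_def unit_fun_def if_distrib[of cmod] if_distrib[of "\<lambda>t. t\<^sup>2"] cong: if_cong)

lemma amplitude_evolve:
  "amplitude (evolve k x) = L2_set (\<lambda>c. exp (- Im k * l c) * cmod (x c)) B"
proof -
  have "(\<Sum>b\<in>B. (cmod (evolve k x b))\<^sup>2) = (\<Sum>b\<in>B. (cmod (\<Sum>c\<in>B. U b c * (exp (\<i> * k * l c) * x c)))\<^sup>2)"
    by (intro sum.cong) (auto simp: evolve_def mult.assoc)
  also have "\<dots> = (\<Sum>c\<in>B. (cmod (exp (\<i> * k * l c) * x c))\<^sup>2)"
    by (rule isometry)
  also have "\<dots> = (\<Sum>c\<in>B. (exp (- Im k * l c) * cmod (x c))\<^sup>2)"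
    by (intro sum.cong) (auto simp: norm_mult)
  finally show ?thesis by (simp add: amplitude_def L2_set_def)
qed

lemma amplitude_evolve_le:
  assumes "0 \<le> Im k"
  shows "amplitude (evolve k x) \<le> exp (- Im k * min_length) * amplitude x"
proof -
  have "amplitude (evolve k x) \<le> L2_set (\<lambda>c. exp (- Im k * min_length) * cmod (x c)) B"
    unfolding amplitude_evolve using assms min_length_le
    by (intro L2_set_mono mult_right_mono) (auto intro: mult_left_mono)
  then show ?thesis by (simp add: amplitude_def L2_set_right_distrib)
qed

lemma amplitude_evolve_ge:
  assumes "Im k \<le> 0"
  shows "exp (- Im k * min_length) * amplitude x \<le> amplitude (evolve k x)"
proof -
  have "L2_set (\<lambda>c. exp (- Im k * min_length) * cmod (x c)) B \<le> amplitude (evolve k x)"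
    unfolding amplitude_evolve using assms min_length_le
    by (intro L2_set_mono mult_right_mono) (auto intro: mult_left_mono_neg)
  then show ?thesis by (simp add: amplitude_def L2_set_right_distrib)
qed

text \<open>
  Off the real axis, travelling strictly decreases or strictly increases all amplitudes.
\<close>

lemma stationary_trivial:
  assumes "Im k \<noteq> 0"
  shows "stationary k = {\<lambda>_. 0}"
proof -
  have "x = (\<lambda>_. 0)" if x: "evolve k x = x" for x
  proof (rule amplitude_eq_0)
    show "supported x" using supported_evolve[of k x] x by simp
    show "amplitude x = 0"
    proof (rule ccontr)
      assume "amplitude x \<noteq> 0"
      then have pos: "0 < amplitude x" using amplitude_nonneg[of x] by linarith
      show False
      proof (cases "0 < Im k")
        case True
        then have "exp (- Im k * min_length) * amplitude x < 1 * amplitude x"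
          using min_length_pos pos by (intro mult_strict_right_mono) auto
        then show False using amplitude_evolve_le[of k x] True x by simp
      next
        case False
        then have "0 < - Im k * min_length"
          using assms min_length_pos by (intro mult_pos_pos) auto
        then have "1 * amplitude x < exp (- Im k * min_length) * amplitude x"
          using pos by (intro mult_strict_right_mono) auto
        then show False using amplitude_evolve_ge[of k x] False x by simp
      qed
    qed
  qed
  moreover have "evolve k (\<lambda>_. 0) = (\<lambda>_. 0)"
    by (simp add: evolve_def fun_eq_iff)
  ultimately show ?thesis unfolding stationary_def by blast
qed

text \<open>
  The inverse of \<open>1 - evolve k\<close> on the functions supported in \<open>B\<close>.
\<close>

definition resolvent :: "complex \<Rightarrow> ('b \<Rightarrow> complex) \<Rightarrow> 'b \<Rightarrow> complex" where
  "resolvent k y = (THE x. supported x \<and> (\<lambda>b. x b - evolve k x b) = y)"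

text \<open>
  The denominator \<open>d\<close> is the determinant of \<open>1 - evolve k\<close>, and \<open>N\<close> is the adjugate matrix.
\<close>

lemma resolvent_meromorphic:
  obtains d N where "d holomorphic_on UNIV"
    and "\<And>b c. b \<in> B \<Longrightarrow> c \<in> B \<Longrightarrow> (\<lambda>k. N k b c) holomorphic_on UNIV"
    and "\<And>k. d k = 0 \<longleftrightarrow> stationary k \<noteq> {\<lambda>_. 0}"
    and "\<And>k y b. d k \<noteq> 0 \<Longrightarrow> supported y \<Longrightarrow>
           resolvent k y = (\<lambda>b. if b \<in> B then (\<Sum>c\<in>B. N k b c / d k * y c) else 0)"
    and "\<And>k y. d k \<noteq> 0 \<Longrightarrow> supported y \<Longrightarrow> (\<lambda>b. resolvent k y b - evolve k (resolvent k y) b) = y"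
    and "\<And>k x. d k \<noteq> 0 \<Longrightarrow> supported x \<Longrightarrow> resolvent k (\<lambda>b. x b - evolve k x b) = x"
    and "\<And>k y. d k \<noteq> 0 \<Longrightarrow> supported y \<Longrightarrow> supported (resolvent k y)"
proof -
  define A where "A k b c = (if b = c then 1 else 0) - U b c * exp (\<i> * k * l c)" for k b c
  have hol: "(\<lambda>k. A k b c) holomorphic_on UNIV" for b c
    unfolding A_def by (cases "b = c") (auto intro!: holomorphic_intros)
  obtain d N where dN: "d holomorphic_on UNIV"
    "\<And>b c. b \<in> B \<Longrightarrow> c \<in> B \<Longrightarrow> (\<lambda>k. N k b c) holomorphic_on UNIV"
    "\<And>k b c. b \<in> B \<Longrightarrow> c \<in> B \<Longrightarrow> (\<Sum>e\<in>B. A k b e * N k e c) = (if b = c then d k else 0)"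
    "\<And>k b c. b \<in> B \<Longrightarrow> c \<in> B \<Longrightarrow> (\<Sum>e\<in>B. N k b e * A k e c) = (if b = c then d k else 0)"
    "\<And>k. d k = 0 \<Longrightarrow> \<exists>x. (\<exists>b\<in>B. x b \<noteq> 0) \<and> (\<forall>b\<in>B. (\<Sum>c\<in>B. A k b c * x c) = 0)"
    by (rule holomorphic_cramer[OF finite_bonds hol]) (rule that)
  have A_apply: "(\<Sum>c\<in>B. A k b c * x c) = x b - evolve k x b" if "b \<in> B" for k b x
    using that finite_bonds
    by (simp add: A_def evolve_def left_diff_distrib sum_subtractf if_distrib[of "\<lambda>t. t * _"] cong: if_cong)
  define R where "R k y = (\<lambda>b. if b \<in> B then (\<Sum>c\<in>B. N k b c / d k * y c) else 0)" for k y
  have supp_R: "supported (R k y)" for k y by (simp add: R_def supported_def)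
  have left: "R k (\<lambda>b. x b - evolve k x b) = x" if "d k \<noteq> 0" "supported x" for k x
  proof
    fix b
    show "R k (\<lambda>b. x b - evolve k x b) b = x b"
    proof (cases "b \<in> B")
      case True
      have "R k (\<lambda>b. x b - evolve k x b) b = (\<Sum>e\<in>B. N k b e / d k * (\<Sum>c\<in>B. A k e c * x c))"
        using True by (simp add: R_def A_apply)
      also have "\<dots> = (\<Sum>c\<in>B. (\<Sum>e\<in>B. N k b e * A k e c) * x c) / d k"
        by (simp add: sum_distrib_left sum_distrib_right sum_divide_distrib)
          (subst sum.swap, simp add: mult_ac)
      also have "\<dots> = x b"
        using True that(1) finite_bonds by (simp add: dN(4) if_distrib[of "\<lambda>t. t * _"] cong: if_cong)
      finally show ?thesis .
    qed (use that in \<open>simp add: R_def supported_def\<close>)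
  qed
  have right: "(\<lambda>b. R k y b - evolve k (R k y) b) = y" if "d k \<noteq> 0" "supported y" for k y
  proof
    fix b
    show "R k y b - evolve k (R k y) b = y b"
    proof (cases "b \<in> B")
      case True
      have "R k y b - evolve k (R k y) b = (\<Sum>e\<in>B. A k b e * (\<Sum>c\<in>B. N k e c / d k * y c))"
        using True A_apply[of b k "R k y"] by (simp add: R_def)
      also have "\<dots> = (\<Sum>c\<in>B. (\<Sum>e\<in>B. A k b e * N k e c) * y c) / d k"
        by (simp add: sum_distrib_left sum_distrib_right sum_divide_distrib)
          (subst sum.swap, simp add: mult_ac)
      also have "\<dots> = y b"
        using True that(1) finite_bonds by (simp add: dN(3) if_distrib[of "\<lambda>t. t * _"] cong: if_cong)
      finally show ?thesis .
    qed (use that in \<open>simp add: R_def supported_def evolve_def\<close>)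
  qed
  have res: "resolvent k y = R k y" if "d k \<noteq> 0" "supported y" for k y
    unfolding resolvent_def
  proof (rule the_equality)
    show "supported (R k y) \<and> (\<lambda>b. R k y b - evolve k (R k y) b) = y"
      using supp_R right[OF that] by blast
    fix x assume "supported x \<and> (\<lambda>b. x b - evolve k x b) = y"
    then show "x = R k y" using left[OF that(1), of x] by simp
  qed
  have sing: "d k = 0 \<longleftrightarrow> stationary k \<noteq> {\<lambda>_. 0}" for k
  proof
    assume "d k = 0"
    then obtain x b where x: "b \<in> B" "x b \<noteq> 0" "\<forall>b\<in>B. (\<Sum>c\<in>B. A k b c * x c) = 0"
      using dN(5) by blast
    define x' where "x' = (\<lambda>b. if b \<in> B then x b else 0)"
    have ev: "evolve k x' = evolve k x"
      by (auto simp: evolve_def x'_def fun_eq_iff intro!: sum.cong)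
    have "evolve k x b = x' b" for b
      using x(3) A_apply[of b k x] by (cases "b \<in> B") (auto simp: x'_def evolve_def)
    with ev have "evolve k x' = x'" by (auto simp: fun_eq_iff)
    then have "x' \<in> stationary k" by (auto simp: stationary_def fun_eq_iff)
    moreover have "x' \<noteq> (\<lambda>_. 0)" using x(1,2) by (auto simp: x'_def fun_eq_iff)
    ultimately show "stationary k \<noteq> {\<lambda>_. 0}" by auto
  next
    assume "stationary k \<noteq> {\<lambda>_. 0}"
    moreover have "(\<lambda>_. 0) \<in> stationary k"
      by (auto simp: stationary_def evolve_def fun_eq_iff)
    ultimately obtain x where x: "x \<in> stationary k" "x \<noteq> (\<lambda>_. 0)" by auto
    show "d k = 0"
    proof (rule ccontr)
      assume d: "d k \<noteq> 0"
      have "x = R k (\<lambda>b. x b - evolve k x b)"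
        using left[OF d supported_stationary[OF x(1)]] by simp
      also have "\<dots> = (\<lambda>_. 0)"
        using x(1) by (auto simp: stationary_def R_def fun_eq_iff)
      finally show False using x(2) by simp
    qed
  qed
  show thesis
  proof (rule that[of d N])
    show "d holomorphic_on UNIV" by (fact dN(1))
    show "(\<lambda>k. N k b c) holomorphic_on UNIV" if "b \<in> B" "c \<in> B" for b c by (rule dN(2)[OF that])
    show "d k = 0 \<longleftrightarrow> stationary k \<noteq> {\<lambda>_. 0}" for k by (fact sing)
    show "resolvent k y = (\<lambda>b. if b \<in> B then (\<Sum>c\<in>B. N k b c / d k * y c) else 0)"
      if "d k \<noteq> 0" "supported y" for k y
      using res[OF that] by (simp add: R_def)
    show "(\<lambda>b. resolvent k y b - evolve k (resolvent k y) b) = y" if "d k \<noteq> 0" "supported y" for k y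
      using res[OF that] right[OF that] by simp
    show "resolvent k (\<lambda>b. x b - evolve k x b) = x" if "d k \<noteq> 0" "supported x" for k x
    proof -
      have "supported (\<lambda>b. x b - evolve k x b)"
        using that(2) supported_evolve[of k x] by (simp add: supported_def)
      then show ?thesis using res that left by simp
    qed
    show "supported (resolvent k y)" if "d k \<noteq> 0" "supported y" for k y
      using res[OF that] supp_R by simp
  qed
qed

end


section \<open>The resolvent trace\<close>

context scattering
begin

definition total_length :: real where
  "total_length = (\<Sum>b\<in>B. l b)"

text \<open>
  With \<open>T = evolve k\<close> and the multiplication \<open>\<Lambda>\<close> by the lengths, this is \<open>tr ((1 - T)\<^sup>-\<^sup>1 T \<Lambda>)\<close>, which
  equals \<open>\<i>\<close> times the logarithmic derivative of \<open>det (1 - T)\<close>.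
\<close>

definition resolvent_trace :: "complex \<Rightarrow> complex" where
  "resolvent_trace k = (\<Sum>b\<in>B. of_real (l b) * resolvent k (evolve k (unit_fun b)) b)"

lemma total_length_nonneg: "0 \<le> total_length"
  unfolding total_length_def using bond_length_pos by (intro sum_nonneg) (auto intro: less_imp_le)

lemma resolvent_properties:
  assumes "stationary k = {\<lambda>_. 0}"
  shows resolvent_eq: "supported y \<Longrightarrow> (\<lambda>b. resolvent k y b - evolve k (resolvent k y) b) = y"
    and resolvent_inverse: "supported x \<Longrightarrow> resolvent k (\<lambda>b. x b - evolve k x b) = x"
    and supported_resolvent: "supported y \<Longrightarrow> supported (resolvent k y)"
  using assms resolvent_meromorphic by metis+

lemma cmod_resolvent_trace_le:
  assumes "\<And>b. b \<in> B \<Longrightarrow> amplitude (resolvent k (evolve k (unit_fun b))) \<le> C"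
  shows "cmod (resolvent_trace k) \<le> total_length * C"
proof -
  have "cmod (resolvent_trace k) \<le> (\<Sum>b\<in>B. l b * C)"
    unfolding resolvent_trace_def
  proof (rule sum_norm_le)
    fix b assume b: "b \<in> B"
    have "cmod (resolvent k (evolve k (unit_fun b)) b) \<le> C"
      using cmod_le_amplitude[OF b] assms[OF b] by (rule order_trans)
    then show "cmod (of_real (l b) * resolvent k (evolve k (unit_fun b)) b) \<le> l b * C"
      using bond_length_pos[OF b] by (simp add: norm_mult)
  qed
  then show ?thesis by (simp add: total_length_def sum_distrib_right)
qed

lemma amplitude_resolvent_le:
  assumes "0 < Im k" "supported y"
  shows "amplitude (resolvent k y) \<le> amplitude y / (1 - exp (- Im k * min_length))"
proof -
  have triv: "stationary k = {\<lambda>_. 0}" using assms stationary_trivial by simp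
  define z where "z = resolvent k y"
  have "z = (\<lambda>b. y b + evolve k z b)"
    using resolvent_eq[OF triv assms(2)] unfolding z_def by (metis diff_add_cancel)
  then have "amplitude z \<le> amplitude y + amplitude (evolve k z)"
    using amplitude_triangle by metis
  also have "amplitude (evolve k z) \<le> exp (- Im k * min_length) * amplitude z"
    using assms by (intro amplitude_evolve_le) simp
  finally have "amplitude z * (1 - exp (- Im k * min_length)) \<le> amplitude y"
    by (simp add: algebra_simps)
  moreover have "exp (- Im k * min_length) < 1"
    using assms min_length_pos by simp
  ultimately show ?thesis by (simp add: z_def pos_le_divide_eq)
qed

lemma resolvent_trace_upper:
  assumes "0 < Im k"
  shows "cmod (resolvent_trace k) \<le> total_length * (1 / (exp (Im k * min_length) - 1))"
proof (rule cmod_resolvent_trace_le)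
  fix b assume b: "b \<in> B"
  define q where "q = exp (- Im k * min_length)"
  have q: "0 < q" "q < 1" using assms min_length_pos by (auto simp: q_def)
  have "amplitude (resolvent k (evolve k (unit_fun b))) \<le> amplitude (evolve k (unit_fun b)) / (1 - q)"
    unfolding q_def using assms by (intro amplitude_resolvent_le) auto
  also have "\<dots> \<le> q / (1 - q)"
    using amplitude_evolve_le[of k "unit_fun b"] assms q b
    by (intro divide_right_mono) (auto simp: amplitude_unit_fun q_def)
  also have "\<dots> = 1 / (exp (Im k * min_length) - 1)"
    using q by (simp add: q_def exp_minus field_simps)
  finally show "amplitude (resolvent k (evolve k (unit_fun b))) \<le> 1 / (exp (Im k * min_length) - 1)" .
qed

text \<open>
  In the lower half plane the evolution is expanding. If \<open>w\<close> solves \<open>w - T w = T u\<close>, then \<open>z = w + u\<close>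
  solves \<open>T z = z - u\<close>, and since \<open>T\<close> expands \<open>z\<close>, it is controlled by \<open>u\<close>.
\<close>

lemma resolvent_trace_lower:
  assumes "Im k < 0"
  shows "cmod (resolvent_trace k) \<le> total_length * (1 + 1 / (exp (- Im k * min_length) - 1))"
proof (rule cmod_resolvent_trace_le)
  fix b assume b: "b \<in> B"
  define q where "q = exp (- Im k * min_length)"
  have "0 < - Im k * min_length" using assms min_length_pos by (intro mult_pos_pos) auto
  then have q: "1 < q" by (simp add: q_def)
  have triv: "stationary k = {\<lambda>_. 0}" using assms stationary_trivial by simp
  define u where "u = (unit_fun b :: 'b \<Rightarrow> complex)"
  define w where "w = resolvent k (evolve k u)"
  define z where "z = w + u"
  have w: "w b - evolve k w b = evolve k u b" for b
    using resolvent_eq[OF triv supported_evolve[of k u]] unfolding w_def by (metis (no_types))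
  have "evolve k z b = z b - u b" for b
    using w[of b] by (simp add: z_def evolve.add algebra_simps)
  then have "evolve k z = (\<lambda>b. z b - u b)" by auto
  then have "amplitude (evolve k z) \<le> amplitude z + 1"
    using amplitude_diff[of z u] amplitude_unit_fun[OF b] by (simp add: u_def)
  moreover have "q * amplitude z \<le> amplitude (evolve k z)"
    unfolding q_def using assms by (intro amplitude_evolve_ge) simp
  ultimately have "amplitude z * (q - 1) \<le> 1" by (simp add: algebra_simps)
  then have "amplitude z \<le> 1 / (q - 1)" using q by (simp add: field_simps)
  moreover have "amplitude w \<le> amplitude z + amplitude u"
    using amplitude_diff[of z u] by (simp add: z_def)
  ultimately show "amplitude (resolvent k (evolve k (unit_fun b))) \<le> 1 + 1 / (exp (- Im k * min_length) - 1)"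
    using amplitude_unit_fun[OF b] by (simp add: u_def w_def q_def)
qed

lemma resolvent_trace_bound:
  assumes "Im k \<noteq> 0"
  shows "cmod (resolvent_trace k) \<le> total_length * (1 + 1 / (\<bar>Im k\<bar> * min_length))"
proof -
  define x where "x = \<bar>Im k\<bar> * min_length"
  have x: "0 < x" using assms min_length_pos by (simp add: x_def)
  have ex: "1 / (exp x - 1) \<le> 1 / x"
  proof (rule divide_left_mono)
    show "x \<le> exp x - 1" using exp_ge_add_one_self[of x] by linarith
  qed (use x in auto)
  show ?thesis
  proof (cases "0 < Im k")
    case True
    have "cmod (resolvent_trace k) \<le> total_length * (1 / (exp x - 1))"
      using resolvent_trace_upper[OF True] True by (simp add: x_def)
    also have "\<dots> \<le> total_length * (1 + 1 / x)"
      using ex total_length_nonneg by (intro mult_left_mono) auto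
    finally show ?thesis by (simp add: x_def)
  next
    case False
    then have neg: "Im k < 0" using assms by simp
    have "cmod (resolvent_trace k) \<le> total_length * (1 + 1 / (exp x - 1))"
      using resolvent_trace_lower[OF neg] neg by (simp add: x_def)
    also have "\<dots> \<le> total_length * (1 + 1 / x)"
      using ex total_length_nonneg by (intro mult_left_mono) auto
    finally show ?thesis by (simp add: x_def)
  qed
qed

lemma resolvent_trace_punctured:
  obtains r where "0 < r" and "resolvent_trace holomorphic_on ball k0 r - {k0}"
    and "Im k0 \<noteq> 0 \<Longrightarrow> resolvent_trace holomorphic_on ball k0 r"
proof -
  obtain d N where dN: "d holomorphic_on UNIV"
    "\<And>b c. b \<in> B \<Longrightarrow> c \<in> B \<Longrightarrow> (\<lambda>k. N k b c) holomorphic_on UNIV"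
    "\<And>k. d k = 0 \<longleftrightarrow> stationary k \<noteq> {\<lambda>_. 0}"
    "\<And>k y b. d k \<noteq> 0 \<Longrightarrow> supported y \<Longrightarrow>
           resolvent k y = (\<lambda>b. if b \<in> B then (\<Sum>c\<in>B. N k b c / d k * y c) else 0)"
    by (rule resolvent_meromorphic) blast
  have hol: "resolvent_trace holomorphic_on {k. d k \<noteq> 0}"
  proof -
    have "(\<lambda>k. \<Sum>b\<in>B. of_real (l b) * (\<Sum>c\<in>B. N k b c / d k * (\<Sum>e\<in>B. U c e * exp (\<i> * k * l e) * unit_fun b e)))
        holomorphic_on {k. d k \<noteq> 0}"
      by (intro holomorphic_intros holomorphic_on_subset[OF dN(1)] holomorphic_on_subset[OF dN(2)]) auto
    then show ?thesis
      by (rule holomorphic_transform) (simp add: resolvent_trace_def dN(4), simp add: evolve_def)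
  qed
  have nz: "d \<i> \<noteq> 0" using dN(3)[of \<i>] stationary_trivial[of \<i>] by simp
  have "\<exists>r>0. \<forall>k\<in>ball k0 r - {k0}. d k \<noteq> 0"
  proof (cases "d k0 = 0")
    case True
    then show ?thesis
      using isolated_zeros[OF dN(1) open_UNIV connected_UNIV _ True _ nz] by (metis UNIV_I)
  next
    case False
    have "open {k. d k \<noteq> 0}"
      using holomorphic_on_imp_continuous_on[OF dN(1)] by (intro open_Collect_neq) auto
    then obtain r where "0 < r" "ball k0 r \<subseteq> {k. d k \<noteq> 0}"
      using False openE by (metis mem_Collect_eq)
    then show ?thesis by blast
  qed
  then obtain r where r: "0 < r" "\<forall>k\<in>ball k0 r - {k0}. d k \<noteq> 0" by blast
  show thesis
  proof (rule that[OF r(1)])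
    show "resolvent_trace holomorphic_on ball k0 r - {k0}"
      by (rule holomorphic_on_subset[OF hol]) (use r in auto)
    assume "Im k0 \<noteq> 0"
    then have "d k0 \<noteq> 0" using dN(3)[of k0] stationary_trivial[of k0] by simp
    then show "resolvent_trace holomorphic_on ball k0 r"
      using r by (intro holomorphic_on_subset[OF hol]) auto
  qed
qed

lemma deriv_evolve:
  fixes v :: "'b \<Rightarrow> complex"
  assumes "c \<in> B"
  shows "((\<lambda>k. evolve k v c) has_field_derivative \<i> * evolve k0 (\<lambda>f. of_real (l f) * v f) c) (at k0)"
proof -
  have "((\<lambda>k. \<Sum>f\<in>B. U c f * exp (\<i> * k * l f) * v f) has_field_derivative
      (\<Sum>f\<in>B. U c f * (exp (\<i> * k0 * l f) * (\<i> * l f)) * v f)) (at k0)"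
    by (auto intro!: derivative_eq_intros simp: algebra_simps)
  also have "(\<Sum>f\<in>B. U c f * (exp (\<i> * k0 * l f) * (\<i> * l f)) * v f) = \<i> * evolve k0 (\<lambda>f. l f * v f) c"
    using assms by (simp add: evolve_def sum_distrib_left mult_ac)
  finally show ?thesis using assms by (simp add: evolve_def)
qed

text \<open>
  The resolvent has at most simple poles on the real axis, because it is bounded by a multiple of
  \<open>1 / Im k\<close>. If \<open>R\<close> is its residue at \<open>k\<^sub>0\<close> and \<open>A k = 1 - evolve k\<close>, then \<open>A k\<^sub>0 R = 0\<close>, and \<open>R A'(k\<^sub>0)\<close>
  is the identity on the kernel of \<open>A k\<^sub>0\<close>: it is a projection onto this kernel, and its trace, which
  up to the factor \<open>\<i>\<close> is the residue of the resolvent trace, is the dimension of the kernel.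
\<close>

lemma residue_resolvent_trace:
  assumes real: "Im k0 = 0"
  shows "((\<lambda>k. (k - k0) * resolvent_trace k) \<longlongrightarrow> \<i> * of_nat (fs.dim (stationary k0))) (at k0)"
proof -
  obtain d N where dN: "d holomorphic_on UNIV"
    "\<And>b c. b \<in> B \<Longrightarrow> c \<in> B \<Longrightarrow> (\<lambda>k. N k b c) holomorphic_on UNIV"
    "\<And>k. d k = 0 \<longleftrightarrow> stationary k \<noteq> {\<lambda>_. 0}"
    "\<And>k y b. d k \<noteq> 0 \<Longrightarrow> supported y \<Longrightarrow>
           resolvent k y = (\<lambda>b. if b \<in> B then (\<Sum>c\<in>B. N k b c / d k * y c) else 0)"
    by (rule resolvent_meromorphic) blast
  have nz: "d \<i> \<noteq> 0" using dN(3)[of \<i>] stationary_trivial[of \<i>] by simp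
  have ev_nz: "\<forall>\<^sub>F k in at k0. d k \<noteq> 0"
  proof (cases "d k0 = 0")
    case True
    then obtain r where "0 < r" "\<And>z. z \<in> ball k0 r - {k0} \<Longrightarrow> d z \<noteq> 0"
      using isolated_zeros[OF dN(1) open_UNIV connected_UNIV _ True _ nz] by (metis UNIV_I)
    then show ?thesis unfolding eventually_at by (auto intro!: exI[of _ r] simp: dist_commute)
  next
    case False
    have "isCont d k0"
      using holomorphic_on_imp_continuous_on[OF dN(1)] by (simp add: continuous_on_eq_continuous_at)
    then show ?thesis using False unfolding isCont_def by (rule tendsto_imp_eventually_ne)
  qed
  define G where "G b c k = (k - k0) * N k b c / d k" for b c k
  have res_unit: "resolvent k (unit_fun c) b = N k b c / d k" if "d k \<noteq> 0" "b \<in> B" "c \<in> B" for k b c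
  proof -
    have "(\<Sum>e\<in>B. N k b e / d k * unit_fun c e) = N k b c / d k"
      using that finite_bonds by (simp add: unit_fun_def if_distrib cong: if_cong)
    then show ?thesis using that by (simp add: dN(4))
  qed
  have "\<exists>R. (G b c \<longlongrightarrow> R) (at k0)" if bc: "b \<in> B" "c \<in> B" for b c
  proof -
    have num: "(\<lambda>k. (k - k0) * N k b c) holomorphic_on UNIV"
      by (intro holomorphic_intros dN bc)
    have "not_essential (G b c) k0"
      unfolding G_def using num dN(1)
      by (intro not_essential_divide not_essential_holomorphic[of _ UNIV]
          isolated_singularity_at_holomorphic[of _ UNIV]) (auto intro: holomorphic_on_subset)
    moreover have "\<not> is_pole (G b c) k0"
    proof
      assume "is_pole (G b c) k0"
      then have "filterlim (\<lambda>k. norm (G b c k)) at_top (at k0)"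
        unfolding is_pole_def by (rule filterlim_at_infinity_imp_norm_at_top)
      \<comment> \<open>At distance \<open>y \<le> 1\<close> above \<open>k0\<close>, the resolvent bound gives \<open>norm (G b c k) \<le> 1 / min_length + y\<close>.\<close>
      then have "\<forall>\<^sub>F k in at k0. 1 / min_length + 1 < norm (G b c k)"
        by (simp add: filterlim_at_top_dense)
      then obtain \<delta> where \<delta>: "0 < \<delta>"
        "\<And>k. k \<noteq> k0 \<Longrightarrow> dist k k0 < \<delta> \<Longrightarrow> 1 / min_length + 1 < norm (G b c k)"
        unfolding eventually_at by blast
      define y where "y = min (\<delta> / 2) 1"
      have y: "0 < y" "y < \<delta>" "y \<le> 1" using \<delta>(1) by (auto simp: y_def)
      define k where "k = k0 + \<i> * of_real y"
      have Imk: "Im k = y" using real by (simp add: k_def)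
      have kk0: "cmod (k - k0) = y" using y by (simp add: k_def norm_mult)
      have dk: "d k \<noteq> 0" using dN(3)[of k] stationary_trivial[of k] y Imk by simp
      define q where "q = exp (- y * min_length)"
      have pos: "0 < y * min_length" using y min_length_pos by simp
      have "q \<le> 1 / (1 + y * min_length)"
        using exp_ge_add_one_self[of "y * min_length"] pos
        by (auto simp: q_def exp_minus inverse_eq_divide intro!: divide_left_mono)
      then have q: "y * min_length / (1 + y * min_length) \<le> 1 - q"
        using pos by (simp add: field_simps)
      have "0 < y * min_length / (1 + y * min_length)" using pos by simp
      then have q1: "0 < 1 - q" using q by linarith
      have "cmod (N k b c / d k) \<le> amplitude (resolvent k (unit_fun c))"
        using res_unit[OF dk bc] cmod_le_amplitude[OF bc(1)] by metis
      also have "\<dots> \<le> 1 / (1 - q)"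
        using amplitude_resolvent_le[of k "unit_fun c"] y(1) Imk bc by (simp add: q_def amplitude_unit_fun)
      also have "\<dots> \<le> 1 / (y * min_length / (1 + y * min_length))"
        using q pos q1 by (intro divide_left_mono) (auto intro!: mult_pos_pos divide_pos_pos)
      finally have "y * cmod (N k b c / d k) \<le> y * (1 / (y * min_length / (1 + y * min_length)))"
        using y by (intro mult_left_mono) auto
      also have "\<dots> = 1 / min_length + y"
        using y min_length_pos pos by (simp add: field_simps)
      finally have "norm (G b c k) \<le> 1 / min_length + y"
        using kk0 by (simp add: G_def norm_mult norm_divide)
      moreover have "1 / min_length + 1 < norm (G b c k)"
        using y kk0 by (intro \<delta>(2)) (auto simp: dist_norm)
      ultimately show False using y by linarith
    qed
    ultimately show ?thesis by (simp add: not_essential_def)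
  qed
  then obtain R where R: "\<And>b c. b \<in> B \<Longrightarrow> c \<in> B \<Longrightarrow> (G b c \<longlongrightarrow> R b c) (at k0)"
    by metis
  have ev_tendsto: "((\<lambda>k. evolve k x c) \<longlongrightarrow> evolve k0 x c) (at k0)" if "c \<in> B" for x :: "'b \<Rightarrow> complex" and c
    using DERIV_isCont[OF deriv_evolve[OF that]] by (simp add: isCont_def)
  have kernel: "(\<Sum>f\<in>B. U b f * exp (\<i> * k0 * l f) * R f c) = R b c" if bc: "b \<in> B" "c \<in> B" for b c
  proof -
    have "\<forall>\<^sub>F k in at k0. (k - k0) * unit_fun c b =
        G b c k - (\<Sum>f\<in>B. U b f * exp (\<i> * k * l f) * G f c k)"
      using ev_nz
    proof eventually_elim
      case (elim k)
      have "resolvent k (unit_fun c) b - evolve k (resolvent k (unit_fun c)) b = unit_fun c b"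
        using resolvent_eq[of k "unit_fun c"] dN(3)[of k] elim bc by (auto simp: fun_eq_iff)
      then have "(k - k0) * unit_fun c b = (k - k0) * (N k b c / d k - (\<Sum>f\<in>B. U b f * exp (\<i> * k * l f) * (N k f c / d k)))"
        using bc by (simp add: evolve_def res_unit[OF elim])
      then show ?case
        by (simp add: G_def right_diff_distrib sum_distrib_left mult_ac)
    qed
    moreover have "((\<lambda>k. (k - k0) * unit_fun c b) \<longlongrightarrow> (k0 - k0) * unit_fun c b) (at k0)"
      by (intro tendsto_intros)
    ultimately have 1: "((\<lambda>k. G b c k - (\<Sum>f\<in>B. U b f * exp (\<i> * k * l f) * G f c k)) \<longlongrightarrow> 0) (at k0)"
      by (simp add: Lim_transform_eventually)
    have "((\<lambda>k. G b c k - (\<Sum>f\<in>B. U b f * exp (\<i> * k * l f) * G f c k)) \<longlongrightarrow>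
        R b c - (\<Sum>f\<in>B. U b f * exp (\<i> * k0 * l f) * R f c)) (at k0)"
      by (intro tendsto_intros R bc) auto
    from tendsto_unique[OF _ this 1] show ?thesis by simp
  qed
  define P where "P x = (\<lambda>b. if b \<in> B then - \<i> * (\<Sum>c\<in>B. R b c * evolve k0 (\<lambda>f. of_real (l f) * x f) c) else 0)" for x :: "'b \<Rightarrow> complex"
  have P_stationary: "P x \<in> stationary k0" for x
  proof -
    define w where "w = evolve k0 (\<lambda>f. of_real (l f) * x f)"
    have P_apply: "P x f = - \<i> * (\<Sum>c\<in>B. R f c * w c)" if "f \<in> B" for f
      using that by (simp add: P_def w_def)
    have "evolve k0 (P x) b = P x b" for b
    proof (cases "b \<in> B")
      case True
      have "evolve k0 (P x) b = - \<i> * (\<Sum>c\<in>B. (\<Sum>f\<in>B. U b f * exp (\<i> * k0 * l f) * R f c) * w c)"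
        using True by (simp add: evolve_def P_apply sum_distrib_left sum_distrib_right sum_negf mult_ac)
          (rule sum.swap)
      also have "\<dots> = P x b" using True by (simp add: kernel P_apply)
      finally show ?thesis .
    qed (simp add: evolve_def P_def)
    then show ?thesis by (auto simp: stationary_def)
  qed
  have P_id: "P v = v" if v: "v \<in> stationary k0" for v
  proof
    fix b
    show "P v b = v b"
    proof (cases "b \<in> B")
      case True
      have "\<forall>\<^sub>F k in at k0. v b = (\<Sum>c\<in>B. G b c k * (- ((evolve k v c - evolve k0 v c) / (k - k0))))"
        using ev_nz eventually_neq_at_within[of k0 k0 UNIV]
      proof eventually_elim
        case (elim k)
        have "v b = resolvent k (\<lambda>b. v b - evolve k v b) b"
          using resolvent_inverse[of k v] dN(3)[of k] elim supported_stationary[OF v] by simp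
        also have "\<dots> = (\<Sum>c\<in>B. N k b c / d k * (v c - evolve k v c))"
        proof -
          have "supported (\<lambda>b. v b - evolve k v b)"
            using supported_stationary[OF v] supported_evolve[of k v] by (simp add: supported_def)
          then show ?thesis using dN(4)[OF elim(1)] True by simp
        qed
        also have "\<dots> = (\<Sum>c\<in>B. G b c k * (- ((evolve k v c - evolve k0 v c) / (k - k0))))"
        proof -
          have "evolve k0 v = v" using v by (simp add: stationary_def)
          then show ?thesis using elim by (intro sum.cong) (simp_all add: G_def field_simps)
        qed
        finally show ?case .
      qed
      then have "((\<lambda>k. \<Sum>c\<in>B. G b c k * (- ((evolve k v c - evolve k0 v c) / (k - k0)))) \<longlongrightarrow> v b) (at k0)"
        by (rule Lim_transform_eventually[OF tendsto_const])
      moreover have "((\<lambda>k. \<Sum>c\<in>B. G b c k * (- ((evolve k v c - evolve k0 v c) / (k - k0)))) \<longlongrightarrow>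
          (\<Sum>c\<in>B. R b c * (- (\<i> * evolve k0 (\<lambda>f. l f * v f) c)))) (at k0)"
        using deriv_evolve True unfolding has_field_derivative_iff
        by (intro tendsto_intros R) auto
      ultimately have "v b = (\<Sum>c\<in>B. R b c * (- (\<i> * evolve k0 (\<lambda>f. l f * v f) c)))"
        by (rule tendsto_unique[rotated]) simp
      then show ?thesis using True by (simp add: P_def sum_distrib_left mult_ac sum_negf)
    next
      case False
      then show ?thesis using supported_stationary[OF v] by (simp add: P_def supported_def)
    qed
  qed
  have lin: "Vector_Spaces.linear (\<lambda>c (f :: 'b \<Rightarrow> complex) p. c * f p) (\<lambda>c f p. c * f p) P"
    by unfold_locales
      (auto simp: P_def evolve_def fun_eq_iff algebra_simps sum.distrib sum_distrib_left)
  have trace: "(\<Sum>b\<in>B. P (unit_fun b) b) = of_nat (fs.dim (stationary k0))"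
    using supported_stationary
    by (intro trace_projection finite_bonds subspace_stationary lin P_stationary P_id) (auto simp: supported_def)
  have "\<forall>\<^sub>F k in at k0. (\<Sum>b\<in>B. of_real (l b) * (\<Sum>c\<in>B. G b c k * evolve k (unit_fun b) c)) = (k - k0) * resolvent_trace k"
    using ev_nz
    by eventually_elim
      (simp add: resolvent_trace_def dN(4) G_def sum_distrib_left mult_ac)
  moreover have "((\<lambda>k. \<Sum>b\<in>B. of_real (l b) * (\<Sum>c\<in>B. G b c k * evolve k (unit_fun b) c)) \<longlongrightarrow>
      (\<Sum>b\<in>B. of_real (l b) * (\<Sum>c\<in>B. R b c * evolve k0 (unit_fun b) c))) (at k0)"
    by (intro tendsto_intros R ev_tendsto)
  ultimately have lim: "((\<lambda>k. (k - k0) * resolvent_trace k) \<longlongrightarrow>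
      (\<Sum>b\<in>B. of_real (l b) * (\<Sum>c\<in>B. R b c * evolve k0 (unit_fun b) c))) (at k0)"
    by (rule Lim_transform_eventually[rotated])
  define X where "X b = (\<Sum>c\<in>B. R b c * evolve k0 (unit_fun b) c)" for b
  define \<rho> where "\<rho> = (\<Sum>b\<in>B. of_real (l b) * X b)"
  have "P (unit_fun b) b = - \<i> * (of_real (l b) * X b)" if "b \<in> B" for b
  proof -
    have "(\<lambda>f. of_real (l f) * unit_fun b f) = (\<lambda>f. complex_of_real (l b) * unit_fun b f)"
      by (auto simp: unit_fun_def)
    then have "P (unit_fun b) b = - \<i> * (\<Sum>c\<in>B. R b c * evolve k0 (\<lambda>f. complex_of_real (l b) * unit_fun b f) c)"
      using that by (simp add: P_def)
    also have "\<dots> = - \<i> * (of_real (l b) * X b)"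
      unfolding evolve.scale X_def by (simp add: sum_distrib_left mult.left_commute)
    finally show ?thesis .
  qed
  then have "(\<Sum>b\<in>B. P (unit_fun b) b) = - \<i> * \<rho>"
    by (simp add: sum_distrib_left sum_negf \<rho>_def)
  then have "of_nat (fs.dim (stationary k0)) = - \<i> * \<rho>"
    using trace by simp
  then have "\<i> * of_nat (fs.dim (stationary k0)) = \<rho>"
    by simp
  with lim have "((\<lambda>k. (k - k0) * resolvent_trace k) \<longlongrightarrow> \<i> * of_nat (fs.dim (stationary k0))) (at k0)"
    by (simp add: \<rho>_def X_def)
  then show ?thesis .
qed

end


section \<open>Rigidity of the resolvent trace\<close>

text \<open>
  An entire function that grows at most like \<open>1 / Im z\<close> towards the real axis is bounded. On the unit
  circle around a real \<open>x\<close> the polynomial \<open>(z - x)\<^sup>2 - 1\<close> has modulus \<open>2 \<bar>Im z\<bar>\<close> and compensates the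
  growth; on the imaginary diameter it has modulus at least \<open>1\<close>.
\<close>

lemma bounded_entire_of_Im_bound:
  assumes hol: "H holomorphic_on UNIV" and C: "0 \<le> C"
    and bound: "\<And>k. Im k \<noteq> 0 \<Longrightarrow> cmod (H k) \<le> C * (1 + 1 / \<bar>Im k\<bar>)"
  shows "bounded (range H)"
proof -
  have "cmod (H k) \<le> 4 * C" for k
  proof (cases "\<bar>Im k\<bar> < 1")
    case False
    then have "cmod (H k) \<le> C * (1 + 1 / \<bar>Im k\<bar>)" by (intro bound) auto
    also have "\<dots> \<le> C * 4" using C False by (intro mult_left_mono) (auto simp: field_simps)
    finally show ?thesis by simp
  next
    case True
    define x where "x = complex_of_real (Re k)"
    define g where "g z = ((z - x)\<^sup>2 - 1) * H z" for z
    have circle: "cmod (g z) \<le> 4 * C" if z: "z \<in> sphere x 1" for z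
    proof -
      define w where "w = z - x"
      have w: "cmod w = 1" "Im w = Im z" using z by (simp_all add: w_def x_def dist_norm norm_minus_commute)
      have "w\<^sup>2 - 1 = w * (w - cnj w)"
        using complex_norm_square[of w] w(1) by (simp add: power2_eq_square right_diff_distrib)
      also have "w - cnj w = 2 * Im z * \<i>" using w(2) by (simp add: complex_eq_iff)
      finally have "cmod (w\<^sup>2 - 1) = 2 * \<bar>Im z\<bar>" using w(1) by (simp add: norm_mult)
      then have g: "cmod (g z) = 2 * \<bar>Im z\<bar> * cmod (H z)" by (simp add: g_def w_def norm_mult)
      show ?thesis
      proof (cases "Im z = 0")
        case False
        have "cmod (g z) \<le> 2 * \<bar>Im z\<bar> * (C * (1 + 1 / \<bar>Im z\<bar>))"
          unfolding g by (intro mult_left_mono bound False) auto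
        also have "\<dots> = 2 * C * (\<bar>Im z\<bar> + 1)" using False by (simp add: field_simps)
        also have "\<dots> \<le> 2 * C * 2"
          using abs_Im_le_cmod[of w] w C by (intro mult_left_mono) auto
        finally show ?thesis by simp
      qed (use g C in auto)
    qed
    have "cmod (g k) \<le> 4 * C"
    proof (rule maximum_modulus_frontier[of g "cball x 1"])
      have "g holomorphic_on UNIV" unfolding g_def by (intro holomorphic_intros hol)
      then show "g holomorphic_on interior (cball x 1)" "continuous_on (closure (cball x 1)) g"
        by (auto intro: holomorphic_on_subset holomorphic_on_imp_continuous_on)
      show "k \<in> cball x 1" using True
        by (auto simp: x_def dist_norm cmod_eq_Im norm_minus_commute)
    qed (use circle in auto)
    moreover have "(k - x)\<^sup>2 - 1 = of_real (- ((Im k)\<^sup>2 + 1))"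
      by (simp add: x_def complex_eq_iff power2_eq_square)
    then have "cmod ((k - x)\<^sup>2 - 1) = \<bar>(Im k)\<^sup>2 + 1\<bar>" by (simp only: norm_of_real abs_minus_cancel)
    then have "cmod ((k - x)\<^sup>2 - 1) = (Im k)\<^sup>2 + 1" by simp
    then have "cmod (H k) \<le> cmod (g k)"
      by (simp add: g_def norm_mult mult_le_cancel_right1)
    ultimately show ?thesis by linarith
  qed
  then show ?thesis unfolding bounded_iff by blast
qed

lemma eq_zero_if_le_inverse:
  fixes a D :: real
  assumes "0 \<le> a" and "\<And>y. 0 < y \<Longrightarrow> a \<le> D / y"
  shows "a = 0"
proof -
  have "((\<lambda>y. D / y) \<longlongrightarrow> 0) at_top"
    by (intro tendsto_divide_0[OF tendsto_const] filterlim_at_top_imp_at_infinity filterlim_ident)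
  moreover have "\<forall>\<^sub>F y in at_top. a \<le> D / y"
    using eventually_gt_at_top[of 0] by eventually_elim (rule assms(2))
  ultimately have "a \<le> 0" by (intro tendsto_lowerbound) auto
  then show ?thesis using assms(1) by simp
qed

text \<open>
  The difference of the two resolvent traces has no pole except possibly a simple one at \<open>0\<close>, since
  elsewhere the residues are determined by the dimensions. After subtracting this pole it is
  entire, bounded and decays in the upper half plane, so it vanishes; the exponential decay of
  both traces then excludes the pole at \<open>0\<close>.
\<close>

theorem resolvent_trace_determined:
  fixes B :: "'b set" and B' :: "'c set"
  assumes S: "scattering B U l" and S': "scattering B' U' l'"
    and dims: "\<And>\<kappa> :: real. \<kappa> \<noteq> 0 \<Longrightarrow>
      fs.dim (scattering.stationary B U l \<kappa>) = fs.dim (scattering.stationary B' U' l' \<kappa>)"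
    and k: "0 < Im k"
  shows "scattering.resolvent_trace B U l k = scattering.resolvent_trace B' U' l' k"
proof -
  interpret S: scattering B U l by (fact S)
  interpret S': scattering B' U' l' by (fact S')
  define m :: complex where
    "m = of_nat (fs.dim (S.stationary 0)) - of_nat (fs.dim (S'.stationary 0))"
  \<comment> \<open>The spectra do not control the residue at \<open>0\<close>, so a possible pole is subtracted.\<close>
  define F where "F k = S.resolvent_trace k - S'.resolvent_trace k - \<i> * m / k" for k
  have ext: "isolated_singularity_at F k0 \<and> (\<exists>c. (F \<longlongrightarrow> c) (at k0)) \<and> (Im k0 \<noteq> 0 \<longrightarrow> F analytic_on {k0})" for k0
  proof -
    obtain r where r: "0 < r" "S.resolvent_trace holomorphic_on ball k0 r - {k0}"
      "Im k0 \<noteq> 0 \<Longrightarrow> S.resolvent_trace holomorphic_on ball k0 r"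
      by (rule S.resolvent_trace_punctured[of k0]) blast
    obtain r' where r': "0 < r'" "S'.resolvent_trace holomorphic_on ball k0 r' - {k0}"
      "Im k0 \<noteq> 0 \<Longrightarrow> S'.resolvent_trace holomorphic_on ball k0 r'"
      by (rule S'.resolvent_trace_punctured[of k0]) blast
    define \<rho> where "\<rho> = (if k0 = 0 then min r r' else min (min r r') (cmod k0))"
    have \<rho>: "0 < \<rho>" "\<rho> \<le> r" "\<rho> \<le> r'" using r(1) r'(1) by (auto simp: \<rho>_def)
    have nz: "k \<noteq> 0" if "k \<in> ball k0 \<rho> - {k0}" for k
      using that by (auto simp: \<rho>_def split: if_splits)
    have hol: "F holomorphic_on ball k0 \<rho> - {k0}"
      unfolding F_def using \<rho> nz
      by (intro holomorphic_intros holomorphic_on_subset[OF r(2)] holomorphic_on_subset[OF r'(2)]) auto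
    have iso: "isolated_singularity_at F k0"
      by (rule isolated_singularity_at_holomorphic[OF hol]) (use \<rho> in auto)
    have pole: "((\<lambda>k. (k - k0) * (\<i> * m / k)) \<longlongrightarrow> (if k0 = 0 then \<i> * m else 0)) (at k0)"
    proof (cases "k0 = 0")
      case True
      have "\<forall>\<^sub>F k in at k0. \<i> * m = (k - k0) * (\<i> * m / k)"
        using eventually_neq_at_within[of k0 k0 UNIV] by eventually_elim (use True in simp)
      then show ?thesis using True
        by (auto intro: Lim_transform_eventually[OF tendsto_const])
    next
      case False
      have "((\<lambda>k. (k - k0) * (\<i> * m / k)) \<longlongrightarrow> (k0 - k0) * (\<i> * m / k0)) (at k0)"
        by (intro tendsto_intros False)
      then show ?thesis using False by simp
    qed
    have analytic: "F analytic_on {k0}" if "Im k0 \<noteq> 0"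
    proof -
      have "k \<noteq> 0" if "k \<in> ball k0 \<rho>" for k
        using nz[of k] that \<open>Im k0 \<noteq> 0\<close> by (cases "k = k0") auto
      then have "F holomorphic_on ball k0 \<rho>"
        unfolding F_def using \<rho> r(3)[OF that] r'(3)[OF that]
        by (intro holomorphic_intros) (auto intro: holomorphic_on_subset)
      then show ?thesis using \<rho>(1) unfolding analytic_at by (intro exI[of _ "ball k0 \<rho>"]) auto
    qed
    have "\<exists>c. (F \<longlongrightarrow> c) (at k0)"
    proof (cases "Im k0 = 0")
      case False
      have "isCont F k0" using analytic[OF False] by (simp add: analytic_at_imp_isCont)
      then show ?thesis by (auto simp: isCont_def)
    next
      case True
      then have k0: "k0 = of_real (Re k0)" by (simp add: complex_eq_iff)
      have "((\<lambda>k. (k - k0) * S.resolvent_trace k - (k - k0) * S'.resolvent_trace k - (k - k0) * (\<i> * m / k))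
          \<longlongrightarrow> \<i> * of_nat (fs.dim (S.stationary k0)) - \<i> * of_nat (fs.dim (S'.stationary k0))
            - (if k0 = 0 then \<i> * m else 0)) (at k0)"
        by (intro tendsto_diff pole S.residue_resolvent_trace S'.residue_resolvent_trace True)
      also have "\<i> * of_nat (fs.dim (S.stationary k0)) - \<i> * of_nat (fs.dim (S'.stationary k0))
            - (if k0 = 0 then \<i> * m else 0) = 0"
      proof (cases "k0 = 0")
        case False
        then have "Re k0 \<noteq> 0" using k0 by auto
        then show ?thesis using dims[of "Re k0"] k0 False by simp
      qed (simp add: m_def right_diff_distrib)
      finally have lim: "((\<lambda>k. (k - k0) * F k) \<longlongrightarrow> 0) (at k0)"
        by (simp add: F_def right_diff_distrib)
      have "k0 \<in> interior (ball k0 \<rho>)" using \<rho> by simp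
      then obtain g where g: "g holomorphic_on ball k0 \<rho>" "\<forall>z\<in>ball k0 \<rho> - {k0}. g z = F z"
        using holomorphic_on_extend_lim[OF hol, of] lim by blast
      have "isCont g k0"
        using g(1) \<rho>(1) by (auto simp: continuous_on_eq_continuous_at dest!: holomorphic_on_imp_continuous_on)
      then have "(g \<longlongrightarrow> g k0) (at k0)" by (simp add: isCont_def)
      moreover have "\<forall>\<^sub>F k in at k0. g k = F k"
        unfolding eventually_at using g(2) \<rho>(1) by (intro exI[of _ \<rho>]) (auto simp: dist_commute)
      ultimately show ?thesis using Lim_transform_eventually by blast
    qed
    then show ?thesis using iso analytic by blast
  qed
  define H where "H = remove_sings F"
  have "H analytic_on UNIV"
  proof (subst analytic_on_analytic_at, rule ballI)
    fix k0 :: complex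
    show "H analytic_on {k0}"
      unfolding H_def using ext[of k0] remove_sings_analytic_at by blast
  qed
  then have hol: "H holomorphic_on UNIV" by (rule analytic_imp_holomorphic)
  have HF: "H k = F k" if "Im k \<noteq> 0" for k
    unfolding H_def using ext[of k] that by (intro remove_sings_at_analytic) auto
  define C where "C = S.total_length * (1 + 1 / S.min_length) + S'.total_length * (1 + 1 / S'.min_length) + cmod m"
  have C: "0 \<le> C"
    unfolding C_def
    using S.total_length_nonneg S'.total_length_nonneg S.min_length_pos S'.min_length_pos by auto
  have weaken: "t * (1 + 1 / (y * \<mu>)) \<le> t * (1 + 1 / \<mu>) * (1 + 1 / y)" if "0 \<le> t" "0 < y" "0 < \<mu>" for t y \<mu> :: real
    using that by (simp add: field_simps)
  have bound: "cmod (H k) \<le> C * (1 + 1 / \<bar>Im k\<bar>)" if "Im k \<noteq> 0" for k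
  proof -
    have pos: "0 < \<bar>Im k\<bar>" using that by simp
    have "cmod (\<i> * m / k) \<le> cmod m * (1 / \<bar>Im k\<bar>)"
      using pos abs_Im_le_cmod[of k] by (auto simp: norm_divide norm_mult intro!: divide_left_mono mult_pos_pos)
    also have "\<dots> \<le> cmod m * (1 + 1 / \<bar>Im k\<bar>)" by (intro mult_left_mono) auto
    finally have 1: "cmod (\<i> * m / k) \<le> cmod m * (1 + 1 / \<bar>Im k\<bar>)" .
    have "cmod (F k) \<le> cmod (S.resolvent_trace k) + cmod (S'.resolvent_trace k) + cmod (\<i> * m / k)"
      unfolding F_def by (meson norm_triangle_ineq4 order_trans add_right_mono)
    then show ?thesis
      using S.resolvent_trace_bound[OF that] S'.resolvent_trace_bound[OF that] 1
        weaken[OF S.total_length_nonneg pos S.min_length_pos]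
        weaken[OF S'.total_length_nonneg pos S'.min_length_pos]
      unfolding HF[OF that] C_def by (simp add: algebra_simps)
  qed
  obtain c where c: "\<And>k. H k = c"
    using Liouville_theorem[OF hol bounded_entire_of_Im_bound[OF hol C bound]]
    by (auto simp: constant_on_def)
  have up: "t * (1 / (exp (y * \<mu>) - 1)) \<le> t / \<mu> / y" if "0 \<le> t" "0 < y" "0 < \<mu>" for t y \<mu> :: real
  proof -
    have "y * \<mu> \<le> exp (y * \<mu>) - 1" using exp_ge_add_one_self[of "y * \<mu>"] by linarith
    moreover have "0 < y * \<mu>" using that by simp
    ultimately have "1 / (exp (y * \<mu>) - 1) \<le> 1 / (y * \<mu>)"
      using that by (intro divide_left_mono mult_pos_pos) auto
    then have "t * (1 / (exp (y * \<mu>) - 1)) \<le> t * (1 / (y * \<mu>))" using that by (intro mult_left_mono) auto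
    then show ?thesis by (simp add: mult.commute)
  qed
  have c0: "c = 0"
  proof -
    have "cmod c \<le> (S.total_length / S.min_length + S'.total_length / S'.min_length + cmod m) / y" if y: "0 < y" for y
    proof -
      define k where "k = \<i> * of_real y"
      have Im: "Im k = y" by (simp add: k_def)
      have nk: "cmod (\<i> * m / k) = cmod m / y" using y by (simp add: k_def norm_divide norm_mult)
      have "cmod (F k) \<le> cmod (S.resolvent_trace k) + cmod (S'.resolvent_trace k) + cmod (\<i> * m / k)"
        unfolding F_def by (meson norm_triangle_ineq4 order_trans add_right_mono)
      moreover have "c = F k" using c[of k] HF[of k] y Im by simp
      ultimately show ?thesis
        using S.resolvent_trace_upper[of k] S'.resolvent_trace_upper[of k] y
          up[OF S.total_length_nonneg y S.min_length_pos] up[OF S'.total_length_nonneg y S'.min_length_pos]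
        unfolding nk Im by (simp add: add_divide_distrib)
    qed
    then have "cmod c = 0" by (intro eq_zero_if_le_inverse) auto
    then show ?thesis by simp
  qed
  have diff: "S.resolvent_trace k - S'.resolvent_trace k = \<i> * m / k" if "Im k \<noteq> 0" for k
    using c[of k] HF[OF that] c0 by (simp add: F_def)
  have up2: "t * (1 / (exp (y * \<mu>) - 1)) \<le> 2 * t / \<mu>\<^sup>2 / y / y" if "0 \<le> t" "0 < y" "0 < \<mu>" for t y \<mu> :: real
  proof -
    have pos: "0 < y * \<mu>" using that by simp
    then have "(y * \<mu>)\<^sup>2 / 2 \<le> exp (y * \<mu>) - 1"
      using exp_lower_Taylor_quadratic[of "y * \<mu>"] by linarith
    moreover have "0 < (y * \<mu>)\<^sup>2 / 2" using that by simp
    ultimately have "1 / (exp (y * \<mu>) - 1) \<le> 1 / ((y * \<mu>)\<^sup>2 / 2)"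
      using pos that by (intro divide_left_mono mult_pos_pos) auto
    then have "t * (1 / (exp (y * \<mu>) - 1)) \<le> t * (1 / ((y * \<mu>)\<^sup>2 / 2))" using that by (intro mult_left_mono) auto
    also have "\<dots> = 2 * t / \<mu>\<^sup>2 / y / y" using that by (simp add: field_simps power2_eq_square)
    finally show ?thesis .
  qed
  \<comment> \<open>The traces decay like \<open>1 / y\<^sup>2\<close> at \<open>\<i> y\<close>, but \<open>m / k\<close> only like \<open>1 / y\<close>.\<close>
  have "m = 0"
  proof -
    have "cmod m \<le> (2 * S.total_length / S.min_length\<^sup>2 + 2 * S'.total_length / S'.min_length\<^sup>2) / y" if y: "0 < y" for y
    proof -
      define k where "k = \<i> * of_real y"
      have Im: "Im k = y" by (simp add: k_def)
      have "cmod m / y = cmod (S.resolvent_trace k - S'.resolvent_trace k)"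
        using diff[of k] y Im by (simp add: k_def norm_divide norm_mult)
      also have "\<dots> \<le> cmod (S.resolvent_trace k) + cmod (S'.resolvent_trace k)"
        by (rule norm_triangle_ineq4)
      also have "\<dots> \<le> (2 * S.total_length / S.min_length\<^sup>2 / y + 2 * S'.total_length / S'.min_length\<^sup>2 / y) / y"
        using S.resolvent_trace_upper[of k] S'.resolvent_trace_upper[of k] y
          up2[OF S.total_length_nonneg y S.min_length_pos] up2[OF S'.total_length_nonneg y S'.min_length_pos]
        unfolding Im by (simp add: add_divide_distrib)
      also have "\<dots> = (2 * S.total_length / S.min_length\<^sup>2 + 2 * S'.total_length / S'.min_length\<^sup>2) / y / y"
        by (simp only: add_divide_distrib)
      finally show ?thesis using y unfolding divide_le_cancel by blast
    qed
    then have "cmod m = 0" by (intro eq_zero_if_le_inverse) auto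
    then show ?thesis by simp
  qed
  then show ?thesis using diff[of k] k by simp
qed


section \<open>Expansion into closed sequences of bonds\<close>

text \<open>
  The entry \<open>W d c\<close> of a matrix is the amplitude for passing from \<open>c\<close> to \<open>d\<close>.
\<close>

fun path_weight :: "('b \<Rightarrow> 'b \<Rightarrow> complex) \<Rightarrow> 'b list \<Rightarrow> complex" where
  "path_weight W (c # d # w) = W d c * path_weight W (d # w)"
| "path_weight W w = 1"

lemma path_weight_mult:
  "path_weight (\<lambda>d c. W d c * f c) w = path_weight W w * (\<Prod>c\<leftarrow>butlast w. f c)"
  by (induction W w rule: path_weight.induct) auto

text \<open>
  The list \<open>w\<close> is read cyclically, starting from its first bond. The length of this bond
  enters because the trace contains the multiplication by the lengths.
\<close>

definition orbit_weight :: "('b \<Rightarrow> 'b \<Rightarrow> complex) \<Rightarrow> ('b \<Rightarrow> real) \<Rightarrow> 'b list \<Rightarrow> complex" where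
  "orbit_weight U l w = of_real (l (hd w)) * path_weight U (w @ [hd w])"

context scattering
begin

lemma linear_funpow_evolve:
  "(evolve k ^^ n) (\<Sum>d\<in>D. (\<lambda>p. a d * x d p)) = (\<Sum>d\<in>D. (\<lambda>p. a d * (evolve k ^^ n) (x d) p))"
  by (induction n) (simp_all add: evolve.sum evolve.scale)

lemma funpow_evolve_unit_fun:
  assumes "c \<in> B"
  shows "(evolve k ^^ n) (unit_fun c) b =
    (\<Sum>u | set u \<subseteq> B \<and> length u = n \<and> last (c # u) = b.
       path_weight (\<lambda>d c. U d c * exp (\<i> * k * l c)) (c # u))"
  using assms
proof (induction n arbitrary: c)
  case 0
  have "{u. set u \<subseteq> B \<and> length u = 0 \<and> last (c # u) = b} = (if c = b then {[]} else {})"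
    by auto
  then show ?case by (simp add: unit_fun_def)
next
  case (Suc n)
  define W where "W d c = U d c * exp (\<i> * k * l c)" for d c
  define Q where "Q d = {u. set u \<subseteq> B \<and> length u = n \<and> last (d # u) = b}" for d
  have fin: "finite (Q d)" for d
    by (rule finite_subset[OF _ finite_lists_length_eq[OF finite_bonds, of n]]) (auto simp: Q_def)
  have "evolve k (unit_fun c) = (\<lambda>d. if d \<in> B then W d c else 0)"
    using Suc.prems finite_bonds
    by (auto simp: evolve_def unit_fun_def W_def if_distrib cong: if_cong)
  also have "\<dots> = (\<Sum>d\<in>B. (\<lambda>p. W d c * unit_fun d p))"
    using sum_unit_fun[OF finite_bonds, of "\<lambda>d. if d \<in> B then W d c else 0"]
    by (simp add: fun_eq_iff fun_sum_eval cong: sum.cong)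
  finally have "(evolve k ^^ Suc n) (unit_fun c) = (\<Sum>d\<in>B. (\<lambda>p. W d c * (evolve k ^^ n) (unit_fun d) p))"
    by (simp add: funpow_Suc_right linear_funpow_evolve del: funpow.simps)
  then have "(evolve k ^^ Suc n) (unit_fun c) b = (\<Sum>d\<in>B. W d c * (\<Sum>u\<in>Q d. path_weight W (d # u)))"
    using Suc.IH by (simp add: fun_sum_eval W_def[abs_def] Q_def)
  also have "\<dots> = (\<Sum>(d, u)\<in>Sigma B Q. path_weight W (c # d # u))"
    using finite_bonds fin by (simp add: sum_distrib_left sum.Sigma)
  also have "\<dots> = (\<Sum>u | set u \<subseteq> B \<and> length u = Suc n \<and> last (c # u) = b. path_weight W (c # u))"
    by (rule sum.reindex_bij_witness[of _ "\<lambda>u. (hd u, tl u)" "\<lambda>(d, u). d # u"])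
      (auto simp: Q_def length_Suc_conv)
  finally show ?case by (simp add: W_def[abs_def])
qed

lemma trace_funpow_evolve:
  assumes "0 < n"
  shows "(\<Sum>b\<in>B. of_real (l b) * (evolve k ^^ n) (unit_fun b) b) =
    (\<Sum>w | set w \<subseteq> B \<and> length w = n. orbit_weight U l w * exp (\<i> * k * (\<Sum>b\<leftarrow>w. l b)))"
proof -
  define W where "W d c = U d c * exp (\<i> * k * l c)" for d c
  define Q where "Q b = {u. set u \<subseteq> B \<and> length u = n \<and> last (b # u) = b}" for b
  have fin: "finite (Q d)" for d
    by (rule finite_subset[OF _ finite_lists_length_eq[OF finite_bonds, of n]]) (auto simp: Q_def)
  have exp_prod: "(\<Prod>c\<leftarrow>w. exp (\<i> * k * l c)) = exp (\<i> * k * (\<Sum>b\<leftarrow>w. l b))" for w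
    by (induction w) (auto simp: exp_add distrib_left)
  have "(\<Sum>b\<in>B. of_real (l b) * (evolve k ^^ n) (unit_fun b) b) =
      (\<Sum>b\<in>B. of_real (l b) * (\<Sum>u\<in>Q b. path_weight W (b # u)))"
    by (simp add: funpow_evolve_unit_fun Q_def W_def[abs_def])
  also have "\<dots> = (\<Sum>(b, u)\<in>Sigma B Q. of_real (l b) * path_weight W (b # u))"
    using finite_bonds fin by (simp add: sum_distrib_left sum.Sigma)
  also have "\<dots> = (\<Sum>w | set w \<subseteq> B \<and> length w = n. of_real (l (hd w)) * path_weight W (w @ [hd w]))"
  proof (rule sum.reindex_bij_witness[of _ "\<lambda>w. (hd w, tl w @ [hd w])" "\<lambda>(b, u). butlast (b # u)"])
    fix a assume "a \<in> Sigma B Q"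
    then obtain b u where a: "a = (b, u)" "b \<in> B" "set u \<subseteq> B" "length u = n" "last (b # u) = b"
      by (auto simp: Q_def)
    then have u: "u \<noteq> []" "last u = b" using assms by auto
    have bu: "butlast (b # u) = b # butlast u" using u by simp
    have "butlast u @ [b] = u" using u by (metis append_butlast_last_id)
    then show "(hd (case a of (b, u) \<Rightarrow> butlast (b # u)),
        tl (case a of (b, u) \<Rightarrow> butlast (b # u)) @ [hd (case a of (b, u) \<Rightarrow> butlast (b # u))]) = a"
      "of_real (l (hd (case a of (b, u) \<Rightarrow> butlast (b # u)))) *
        path_weight W ((case a of (b, u) \<Rightarrow> butlast (b # u)) @ [hd (case a of (b, u) \<Rightarrow> butlast (b # u))]) =
        (case a of (b, u) \<Rightarrow> of_real (l b) * path_weight W (b # u))"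
      "(case a of (b, u) \<Rightarrow> butlast (b # u)) \<in> {w. set w \<subseteq> B \<and> length w = n}"
      using a bu assms by (auto dest: in_set_butlastD)
  next
    fix w assume w: "w \<in> {w. set w \<subseteq> B \<and> length w = n}"
    then have "w \<noteq> []" using assms by auto
    then obtain b v where "w = b # v" by (cases w) auto
    then show "(case (hd w, tl w @ [hd w]) of (b, u) \<Rightarrow> butlast (b # u)) = w"
      "(hd w, tl w @ [hd w]) \<in> Sigma B Q"
      using w by (auto simp: Q_def butlast_append)
  qed
  also have "\<dots> = (\<Sum>w | set w \<subseteq> B \<and> length w = n. orbit_weight U l w * exp (\<i> * k * (\<Sum>b\<leftarrow>w. l b)))"
    by (rule sum.cong) (simp_all add: orbit_weight_def path_weight_mult W_def[abs_def] exp_prod)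
  finally show ?thesis .
qed

lemma resolvent_step:
  assumes triv: "stationary k = {\<lambda>_. 0}" and y: "supported y"
  shows "resolvent k y b = y b + resolvent k (evolve k y) b"
proof -
  define z where "z = resolvent k y"
  have sz: "supported z" and z: "\<And>b. z b - evolve k z b = y b"
    using supported_resolvent[OF triv y] resolvent_eq[OF triv y] by (auto simp: z_def fun_eq_iff)
  have "supported (z - y)" using sz y by (simp add: supported_def)
  then have "resolvent k (\<lambda>b. (z - y) b - evolve k (z - y) b) = z - y"
    by (rule resolvent_inverse[OF triv])
  moreover have "(\<lambda>b. (z - y) b - evolve k (z - y) b) = evolve k y"
    using z by (simp add: evolve.diff fun_eq_iff algebra_simps)
  ultimately show ?thesis by (simp add: z_def)
qed

lemma amplitude_funpow_evolve_le:
  assumes "0 \<le> Im k"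
  shows "amplitude ((evolve k ^^ n) x) \<le> exp (- Im k * min_length) ^ n * amplitude x"
proof (induction n)
  case (Suc n)
  have "amplitude ((evolve k ^^ Suc n) x) \<le> exp (- Im k * min_length) * amplitude ((evolve k ^^ n) x)"
    using amplitude_evolve_le[OF assms] by simp
  also have "\<dots> \<le> exp (- Im k * min_length) * (exp (- Im k * min_length) ^ n * amplitude x)"
    by (intro mult_left_mono Suc) auto
  finally show ?case by (simp add: mult.assoc)
qed simp

definition orbits_upto :: "nat \<Rightarrow> 'b list set" where
  "orbits_upto N = {w. set w \<subseteq> B \<and> w \<noteq> [] \<and> length w \<le> N}"

lemma finite_orbits_upto: "finite (orbits_upto N)"
  by (rule finite_subset[OF _ finite_lists_length_le[OF finite_bonds, of N]]) (auto simp: orbits_upto_def)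

text \<open>
  \<open>(1 - T)\<^sup>-\<^sup>1 T = T + \<dots> + T\<^sup>N + (1 - T)\<^sup>-\<^sup>1 T\<^sup>N\<^sup>+\<^sup>1\<close>, with the traces of the powers expanded.
\<close>

lemma resolvent_trace_neumann:
  assumes k: "0 < Im k"
  shows "resolvent_trace k =
    (\<Sum>w\<in>orbits_upto N. orbit_weight U l w * exp (\<i> * k * (\<Sum>b\<leftarrow>w. l b))) +
    (\<Sum>b\<in>B. of_real (l b) * resolvent k ((evolve k ^^ Suc N) (unit_fun b)) b)"
proof (induction N)
  case 0
  have "orbits_upto 0 = {}" by (auto simp: orbits_upto_def)
  then show ?case by (simp add: resolvent_trace_def)
next
  case (Suc N)
  have triv: "stationary k = {\<lambda>_. 0}" using k by (intro stationary_trivial) simp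
  define D where "D = {w. set w \<subseteq> B \<and> length w = Suc N}"
  have D: "orbits_upto (Suc N) = orbits_upto N \<union> D" "orbits_upto N \<inter> D = {}" "finite D"
    using finite_orbits_upto[of "Suc N"] by (auto simp: orbits_upto_def D_def le_Suc_eq finite_lists_length_eq[OF finite_bonds])
  have step: "resolvent k ((evolve k ^^ Suc N) (unit_fun b)) b =
      (evolve k ^^ Suc N) (unit_fun b) b + resolvent k ((evolve k ^^ Suc (Suc N)) (unit_fun b)) b" for b
    using resolvent_step[OF triv supported_evolve[of k "(evolve k ^^ N) (unit_fun b)"], of b] by simp
  have "(\<Sum>b\<in>B. of_real (l b) * resolvent k ((evolve k ^^ Suc N) (unit_fun b)) b) =
      (\<Sum>b\<in>B. of_real (l b) * (evolve k ^^ Suc N) (unit_fun b) b) +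
      (\<Sum>b\<in>B. of_real (l b) * resolvent k ((evolve k ^^ Suc (Suc N)) (unit_fun b)) b)"
    by (simp only: step distrib_left sum.distrib)
  also have "(\<Sum>b\<in>B. of_real (l b) * (evolve k ^^ Suc N) (unit_fun b) b) =
      (\<Sum>w\<in>D. orbit_weight U l w * exp (\<i> * k * (\<Sum>b\<leftarrow>w. l b)))"
    unfolding D_def by (rule trace_funpow_evolve) simp
  finally show ?case
    using Suc unfolding D(1) sum.union_disjoint[OF finite_orbits_upto D(3,2)] by (simp only: add.assoc)
qed

lemma resolvent_trace_approx:
  assumes k: "0 < Im k"
  shows "cmod (resolvent_trace k - (\<Sum>w\<in>orbits_upto N. orbit_weight U l w * exp (\<i> * k * (\<Sum>b\<leftarrow>w. l b))))
    \<le> total_length * exp (- Im k * min_length) ^ Suc N / (1 - exp (- Im k * min_length))"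
proof -
  define q where "q = exp (- Im k * min_length)"
  have q: "0 < q" "q < 1" using k min_length_pos by (auto simp: q_def)
  have "cmod (\<Sum>b\<in>B. of_real (l b) * resolvent k ((evolve k ^^ Suc N) (unit_fun b)) b)
      \<le> (\<Sum>b\<in>B. l b * (q ^ Suc N / (1 - q)))"
  proof (rule sum_norm_le)
    fix b assume b: "b \<in> B"
    have "cmod (resolvent k ((evolve k ^^ Suc N) (unit_fun b)) b)
        \<le> amplitude (resolvent k ((evolve k ^^ Suc N) (unit_fun b)))"
      by (rule cmod_le_amplitude[OF b])
    also have "\<dots> \<le> amplitude ((evolve k ^^ Suc N) (unit_fun b)) / (1 - q)"
      unfolding q_def using k by (intro amplitude_resolvent_le) auto
    also have "\<dots> \<le> q ^ Suc N / (1 - q)"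
      using amplitude_funpow_evolve_le[of k "Suc N" "unit_fun b"] k q amplitude_unit_fun[OF b]
      by (intro divide_right_mono) (auto simp: q_def)
    finally have "l b * cmod (resolvent k ((evolve k ^^ Suc N) (unit_fun b)) b) \<le> l b * (q ^ Suc N / (1 - q))"
      using bond_length_pos[OF b] by (intro mult_left_mono) auto
    then show "cmod (of_real (l b) * resolvent k ((evolve k ^^ Suc N) (unit_fun b)) b) \<le> l b * (q ^ Suc N / (1 - q))"
      using bond_length_pos[OF b] by (simp only: norm_mult norm_of_real abs_of_pos)
  qed
  also have "\<dots> = total_length * q ^ Suc N / (1 - q)"
    by (simp add: total_length_def sum_distrib_right sum_divide_distrib mult.assoc)
  finally show ?thesis
    using resolvent_trace_neumann[OF k, of N] by (simp add: q_def)
qed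

lemma length_le_orbit_length:
  assumes "set w \<subseteq> B"
  shows "real (length w) * min_length \<le> (\<Sum>b\<leftarrow>w. l b)"
  using assms by (induction w) (auto simp: algebra_simps intro: add_mono min_length_le)

end

text \<open>
  The coefficient of the slowest decaying term of a finite exponential sum is read off from its
  asymptotics. Hence a sum that decays faster than \<open>exp (- y X)\<close> has no terms with exponent below \<open>X\<close>.
\<close>

lemma exp_sum_coefficients_zero:
  fixes c :: "'i \<Rightarrow> complex" and \<mu> :: "'i \<Rightarrow> real"
  assumes fin: "finite I"
    and bound: "\<And>y. 1 \<le> y \<Longrightarrow> cmod (\<Sum>i\<in>I. c i * of_real (exp (- y * \<mu> i))) \<le> C * exp (- y * X)"
    and x: "x < X"
  shows "(\<Sum>i | i \<in> I \<and> \<mu> i = x. c i) = 0"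
proof (rule ccontr)
  define a where "a x = (\<Sum>i | i \<in> I \<and> \<mu> i = x. c i)" for x
  define S where "S = {x \<in> \<mu> ` I. a x \<noteq> 0}"
  have finS: "finite S" using fin by (simp add: S_def)
  assume "(\<Sum>i | i \<in> I \<and> \<mu> i = x. c i) \<noteq> 0"
  then have ax: "a x \<noteq> 0" by (simp add: a_def)
  then have "{i. i \<in> I \<and> \<mu> i = x} \<noteq> {}" unfolding a_def by (metis sum.empty)
  with ax have xS: "x \<in> S" by (auto simp: S_def)
  define x0 where "x0 = Min S"
  have x0: "x0 \<in> S" "x0 \<le> x" "\<And>s. s \<in> S \<Longrightarrow> x0 \<le> s"
    using finS xS by (auto simp: x0_def intro: Min_in)
  have group: "(\<Sum>i\<in>I. c i * of_real (exp (- y * \<mu> i))) = (\<Sum>s\<in>S. a s * of_real (exp (- y * s)))" for y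
  proof -
    have "(\<Sum>i\<in>I. c i * of_real (exp (- y * \<mu> i))) =
        (\<Sum>s\<in>\<mu> ` I. \<Sum>i | i \<in> I \<and> \<mu> i = s. c i * of_real (exp (- y * \<mu> i)))"
      by (rule sum.image_gen[OF fin])
    also have "\<dots> = (\<Sum>s\<in>\<mu> ` I. a s * of_real (exp (- y * s)))"
      by (simp add: a_def sum_distrib_right)
    also have "\<dots> = (\<Sum>s\<in>S. a s * of_real (exp (- y * s)))"
      by (rule sum.mono_neutral_right) (use fin in \<open>auto simp: S_def\<close>)
    finally show ?thesis .
  qed
  have "((\<lambda>y. \<Sum>s\<in>S. a s * of_real (exp (- y * (s - x0)))) \<longlongrightarrow> (\<Sum>s\<in>S. if s = x0 then a s else 0)) at_top"
  proof (intro tendsto_sum)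
    fix s assume s: "s \<in> S"
    show "((\<lambda>y. a s * of_real (exp (- y * (s - x0)))) \<longlongrightarrow> (if s = x0 then a s else 0)) at_top"
    proof (cases "s = x0")
      case False
      then have "0 < s - x0" using x0(3)[OF s] by simp
      then have "((\<lambda>y. exp (- y * (s - x0))) \<longlongrightarrow> 0) at_top" by real_asymp
      then have "((\<lambda>y. a s * of_real (exp (- y * (s - x0)))) \<longlongrightarrow> a s * of_real 0) at_top"
        by (intro tendsto_intros)
      then show ?thesis using False by simp
    qed simp
  qed
  then have lim: "((\<lambda>y. \<Sum>s\<in>S. a s * of_real (exp (- y * (s - x0)))) \<longlongrightarrow> a x0) at_top"
    using finS x0(1) by simp
  have "((\<lambda>y. \<Sum>s\<in>S. a s * of_real (exp (- y * (s - x0)))) \<longlongrightarrow> 0) at_top"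
  proof (rule Lim_null_comparison)
    have "0 < X - x0" using x0(2) x by simp
    then have "((\<lambda>y. exp (- y * (X - x0))) \<longlongrightarrow> 0) at_top" by real_asymp
    from tendsto_mult_left[OF this, of C]
    show "((\<lambda>y. C * exp (- y * (X - x0))) \<longlongrightarrow> 0) at_top" by simp
    show "\<forall>\<^sub>F y in at_top. cmod (\<Sum>s\<in>S. a s * of_real (exp (- y * (s - x0)))) \<le> C * exp (- y * (X - x0))"
      using eventually_ge_at_top[of 1]
    proof eventually_elim
      case (elim y)
      have "(\<Sum>s\<in>S. a s * of_real (exp (- y * (s - x0)))) = of_real (exp (y * x0)) * (\<Sum>s\<in>S. a s * of_real (exp (- y * s)))"
        by (simp add: sum_distrib_left right_diff_distrib exp_diff exp_minus field_simps)
      then have "cmod (\<Sum>s\<in>S. a s * of_real (exp (- y * (s - x0)))) = exp (y * x0) * cmod (\<Sum>s\<in>S. a s * of_real (exp (- y * s)))"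
        by (simp add: norm_mult)
      also have "\<dots> \<le> exp (y * x0) * (C * exp (- y * X))"
        using bound[OF elim] group by (intro mult_left_mono) auto
      also have "\<dots> = C * exp (- y * (X - x0))"
        by (simp add: right_diff_distrib exp_diff exp_minus field_simps)
      finally show ?case .
    qed
  qed
  with lim have "a x0 = 0" by (rule tendsto_unique[rotated]) simp
  then show False using x0(1) by (simp add: S_def)
qed

text \<open>
  By analytic continuation the sum vanishes at imaginary \<open>t\<close> too, where it is a real exponential sum.
\<close>

lemma trig_sum_coefficients_zero:
  fixes c :: "'i \<Rightarrow> complex" and \<omega> :: "'i \<Rightarrow> real"
  assumes fin: "finite I" and \<epsilon>: "0 < \<epsilon>"
    and zero: "\<And>t. 0 \<le> t \<Longrightarrow> t < \<epsilon> \<Longrightarrow> (\<Sum>i\<in>I. c i * exp (\<i> * of_real t * of_real (\<omega> i))) = 0"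
  shows "(\<Sum>i | i \<in> I \<and> \<omega> i = x. c i) = 0"
proof -
  define f where "f z = (\<Sum>i\<in>I. c i * exp (\<i> * z * of_real (\<omega> i)))" for z
  have "f z = 0" for z
  proof (rule analytic_continuation[of f UNIV "complex_of_real ` {0..<\<epsilon>}" 0])
    show "f holomorphic_on UNIV" unfolding f_def by (intro holomorphic_intros)
    show "0 islimpt complex_of_real ` {0..<\<epsilon>}"
      unfolding islimpt_approachable
    proof (intro allI impI)
      fix e :: real assume "0 < e"
      then show "\<exists>x'\<in>complex_of_real ` {0..<\<epsilon>}. x' \<noteq> 0 \<and> dist x' 0 < e"
        using \<epsilon> by (intro bexI[of _ "complex_of_real (min (e / 2) (\<epsilon> / 2))"]) auto
    qed
  qed (auto simp: f_def zero)
  then have "f (\<i> * of_real y) = 0" for y by simp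
  then have "(\<Sum>i\<in>I. c i * of_real (exp (- y * \<omega> i))) = 0" for y
    by (simp add: f_def exp_of_real mult.assoc flip: of_real_mult of_real_minus)
  then show ?thesis
    by (intro exp_sum_coefficients_zero[of I c \<omega> 0 "x + 1"] fin) auto
qed

text \<open>
  Along the imaginary axis the resolvent trace is a Dirichlet series over the closed bond sequences,
  with the total lengths of the sequences as exponents; so it determines the sum of the weights
  of the sequences of each given length.
\<close>

theorem orbit_sums_determined:
  fixes B :: "'b set" and B' :: "'c set"
  assumes S: "scattering B U l" and S': "scattering B' U' l'"
    and dims: "\<And>\<kappa> :: real. \<kappa> \<noteq> 0 \<Longrightarrow>
      fs.dim (scattering.stationary B U l \<kappa>) = fs.dim (scattering.stationary B' U' l' \<kappa>)"
  shows "(\<Sum>w | set w \<subseteq> B \<and> w \<noteq> [] \<and> (\<Sum>b\<leftarrow>w. l b) = x. orbit_weight U l w) =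
    (\<Sum>w | set w \<subseteq> B' \<and> w \<noteq> [] \<and> (\<Sum>b\<leftarrow>w. l' b) = x. orbit_weight U' l' w)"
proof -
  interpret S: scattering B U l by (fact S)
  interpret S': scattering B' U' l' by (fact S')
  define \<mu> where "\<mu> = min S.min_length S'.min_length"
  have \<mu>: "0 < \<mu>" "\<mu> \<le> S.min_length" "\<mu> \<le> S'.min_length"
    using S.min_length_pos S'.min_length_pos by (auto simp: \<mu>_def)
  \<comment> \<open>Sequences with more than \<open>N\<close> bonds are longer than \<open>x\<close>, and the remainder of the expansion
    after \<open>N\<close> terms decays faster than the terms of length \<open>x\<close>.\<close>
  obtain N :: nat where N: "x / \<mu> < N" using reals_Archimedean2 by blast
  define X where "X = \<mu> * Suc N"
  have "x < \<mu> * N" using N \<mu> by (simp add: field_simps)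
  then have x: "x < X" using \<mu> by (simp add: X_def algebra_simps)
  define I where "I = S.orbits_upto N <+> S'.orbits_upto N"
  define c where "c = case_sum (orbit_weight U l) (\<lambda>w. - orbit_weight U' l' w)"
  define m where "m = case_sum (\<lambda>w. \<Sum>b\<leftarrow>w. l b) (\<lambda>w. \<Sum>b\<leftarrow>w. l' b)"
  have finI: "finite I" by (simp add: I_def S.finite_orbits_upto S'.finite_orbits_upto)
  define C where "C = S.total_length / (1 - exp (- \<mu>)) + S'.total_length / (1 - exp (- \<mu>))"
  have weaken: "t * exp (- y * \<nu>) ^ Suc N / (1 - exp (- y * \<nu>)) \<le> t / (1 - exp (- \<mu>)) * exp (- y * X)"
    if "0 \<le> t" "1 \<le> y" "\<mu> \<le> \<nu>" for t y \<nu>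
  proof -
    have le: "1 * \<mu> \<le> y * \<nu>" using that \<mu> by (intro mult_mono) auto
    have "exp (- y * \<nu>) ^ Suc N = exp (Suc N * (- y * \<nu>))" by (simp only: exp_of_nat_mult)
    also have "\<dots> \<le> exp (- y * X)"
    proof -
      have "y * (Suc N * \<mu>) \<le> y * (Suc N * \<nu>)" using that by (intro mult_left_mono) auto
      then show ?thesis by (simp add: X_def algebra_simps)
    qed
    finally have 1: "exp (- y * \<nu>) ^ Suc N \<le> exp (- y * X)" .
    have "exp (- y * \<nu>) \<le> exp (- \<mu>)" using le by simp
    then have "1 - exp (- \<mu>) \<le> 1 - exp (- y * \<nu>)" by simp
    moreover have "0 < 1 - exp (- \<mu>)" using \<mu> by simp
    ultimately have "t * exp (- y * \<nu>) ^ Suc N / (1 - exp (- y * \<nu>)) \<le> t * exp (- y * X) / (1 - exp (- \<mu>))"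
      using 1 that by (intro frac_le mult_left_mono) auto
    then show ?thesis by simp
  qed
  have "(\<Sum>i | i \<in> I \<and> m i = x. c i) = 0"
  proof (rule exp_sum_coefficients_zero[OF finI _ x])
    fix y :: real assume y: "1 \<le> y"
    define k where "k = \<i> * of_real y"
    have Im: "Im k = y" "0 < Im k" using y by (simp_all add: k_def)
    define s where "s = (\<Sum>w\<in>S.orbits_upto N. orbit_weight U l w * exp (\<i> * k * (\<Sum>b\<leftarrow>w. l b)))"
    define s' where "s' = (\<Sum>w\<in>S'.orbits_upto N. orbit_weight U' l' w * exp (\<i> * k * (\<Sum>b\<leftarrow>w. l' b)))"
    have "exp (\<i> * k * of_real t) = of_real (exp (- y * t))" for t
      by (simp add: k_def exp_of_real mult.assoc flip: of_real_mult of_real_minus)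
    then have "(\<Sum>i\<in>I. c i * of_real (exp (- y * m i))) = s - s'"
      unfolding I_def by (subst sum.Plus)
        (simp_all add: S.finite_orbits_upto S'.finite_orbits_upto c_def m_def s_def s'_def sum_negf)
    also have "\<dots> = (S'.resolvent_trace k - s') - (S.resolvent_trace k - s)"
      using resolvent_trace_determined[OF S S' dims Im(2)] by simp
    also have "cmod \<dots> \<le> cmod (S'.resolvent_trace k - s') + cmod (S.resolvent_trace k - s)"
      by (rule norm_triangle_ineq4)
    also have "\<dots> \<le> C * exp (- y * X)"
      using S.resolvent_trace_approx[OF Im(2), of N] S'.resolvent_trace_approx[OF Im(2), of N]
        weaken[OF S.total_length_nonneg y \<mu>(2)] weaken[OF S'.total_length_nonneg y \<mu>(3)]
      unfolding Im(1) s_def s'_def C_def by (simp add: distrib_right)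
    finally show "cmod (\<Sum>i\<in>I. c i * of_real (exp (- y * m i))) \<le> C * exp (- y * X)" .
  qed
  moreover have split: "{i. i \<in> I \<and> m i = x} =
      {w. set w \<subseteq> B \<and> w \<noteq> [] \<and> (\<Sum>b\<leftarrow>w. l b) = x} <+> {w. set w \<subseteq> B' \<and> w \<noteq> [] \<and> (\<Sum>b\<leftarrow>w. l' b) = x}"
    (is "_ = ?A <+> ?A'")
  proof -
    have len: "length w \<le> N" if "real (length w) * \<nu> \<le> x" "\<mu> \<le> \<nu>" for w :: "'d list" and \<nu>
    proof -
      have "real (length w) * \<mu> \<le> real (length w) * \<nu>" using that by (intro mult_left_mono) auto
      then have "real (length w) * \<mu> < N * \<mu>" using that \<open>x < \<mu> * N\<close> by (simp add: mult.commute)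
      then show ?thesis using \<mu> by simp
    qed
    show ?thesis
      using len[OF _ \<mu>(2)] S.length_le_orbit_length len[OF _ \<mu>(3)] S'.length_le_orbit_length
      unfolding I_def m_def S.orbits_upto_def S'.orbits_upto_def
      by (auto simp: Plus_def; blast)
  qed
  moreover have "finite (?A <+> ?A')" unfolding split[symmetric] using finI by simp
  then have "finite ?A" "finite ?A'" by (auto simp: finite_Plus_iff)
  ultimately show ?thesis
    by (simp add: sum.Plus c_def sum_negf)
qed


section \<open>Regularity of eigenfunctions\<close>

lemma lebesgue_differentiation_right:
  fixes f :: "real \<Rightarrow> complex"
  assumes "\<And>a b. f integrable_on {a..b}"
  obtains N where "negligible N"
    and "\<And>x. x \<notin> N \<Longrightarrow> ((\<lambda>h. integral {x..x + h} f /\<^sub>R h) \<longlongrightarrow> f x) (at_right 0)"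
proof -
  obtain N where N: "negligible N"
    "\<And>x e. x \<notin> N \<Longrightarrow> 0 < e \<Longrightarrow> \<exists>d>0. \<forall>h. 0 < h \<and> h < d \<longrightarrow> norm (integral (cbox x (x + h *\<^sub>R One)) f /\<^sub>R h ^ DIM(real) - f x) < e"
    by (rule integrable_ccontinuous_explicit[of f, unfolded cbox_interval, OF assms, folded cbox_interval]) (rule that)
  show thesis
  proof (rule that[OF N(1)])
    fix x assume "x \<notin> N"
    show "((\<lambda>h. integral {x..x + h} f /\<^sub>R h) \<longlongrightarrow> f x) (at_right 0)"
    proof (rule tendstoI)
      fix e :: real assume "0 < e"
      then obtain d where "d > 0" "\<forall>h. 0 < h \<and> h < d \<longrightarrow> norm (integral {x..x + h} f /\<^sub>R h - f x) < e"
        using N(2)[OF \<open>x \<notin> N\<close>, of e] by auto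
      then show "\<forall>\<^sub>F h in at_right 0. dist (integral {x..x + h} f /\<^sub>R h) (f x) < e"
        unfolding eventually_at_right_field by (intro exI[of _ d]) (auto simp: dist_norm)
    qed
  qed
qed

text \<open>
  Lebesgue's differentiation theorem on the line. The left derivative is the right derivative
  of the reflected function.
\<close>

lemma lebesgue_differentiation:
  fixes f :: "real \<Rightarrow> complex"
  assumes f: "f integrable_on {a..b}" and F: "\<And>x. x \<in> {a..b} \<Longrightarrow> F x = F a + integral {a..x} f"
  obtains N where "negligible N"
    and "\<And>x. x \<in> {a<..<b} \<Longrightarrow> x \<notin> N \<Longrightarrow> (F has_vector_derivative f x) (at x)"
proof -
  define h where "h x = (if x \<in> {a..b} then f x else 0)" for x
  have "h integrable_on UNIV"
    unfolding h_def integrable_restrict_UNIV by (rule f)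
  then have h: "h integrable_on {c..d}" for c d
    by (rule integrable_on_subinterval) auto
  have h': "(\<lambda>x. h (- x)) integrable_on {c..d}" for c d
    using h[of "- d" "- c"] Henstock_Kurzweil_Integration.integrable_reflect_real[where f = h and a = "- d" and b = "- c"] by simp
  obtain N where N: "negligible N"
    "\<And>x. x \<notin> N \<Longrightarrow> ((\<lambda>t. integral {x..x + t} h /\<^sub>R t) \<longlongrightarrow> h x) (at_right 0)"
    by (rule lebesgue_differentiation_right[OF h]) blast
  obtain N' where N': "negligible N'"
    "\<And>x. x \<notin> N' \<Longrightarrow> ((\<lambda>t. integral {x..x + t} (\<lambda>x. h (- x)) /\<^sub>R t) \<longlongrightarrow> h (- x)) (at_right 0)"
    by (rule lebesgue_differentiation_right[OF h']) blast
  have "negligible (uminus ` N')"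
    by (intro negligible_differentiable_image_negligible[OF order_refl N'(1)] differentiable_on_minus differentiable_on_ident)
  then have neg: "negligible (N \<union> uminus ` N')" using N(1) by simp
  have incr: "F y - F x = integral {x..y} h" if "a \<le> x" "x \<le> y" "y \<le> b" for x y
  proof -
    have "integral {a..x} f + integral {x..y} f = integral {a..y} f"
      using that by (intro Henstock_Kurzweil_Integration.integral_combine integrable_on_subinterval[OF f]) auto
    moreover have "integral {x..y} f = integral {x..y} h"
      using that by (intro integral_cong) (auto simp: h_def)
    ultimately show ?thesis using F[of x] F[of y] that by (simp add: diff_eq_eq add.commute)
  qed
  show thesis
  proof (rule that[OF neg])
    fix x assume x: "x \<in> {a<..<b}" "x \<notin> N \<union> uminus ` N'"
    have "- x \<notin> N'"
    proof
      assume "- x \<in> N'"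
      then have "- (- x) \<in> uminus ` N'" by (rule imageI)
      then show False using x(2) by simp
    qed
    have hx: "h x = f x" using x by (simp add: h_def)
    have right: "((\<lambda>t. (F (x + t) - F x) /\<^sub>R t) \<longlongrightarrow> f x) (at_right 0)"
    proof (rule Lim_transform_eventually)
      show "((\<lambda>t. integral {x..x + t} h /\<^sub>R t) \<longlongrightarrow> f x) (at_right 0)" using N(2)[of x] x(2) hx by simp
      show "\<forall>\<^sub>F t in at_right 0. integral {x..x + t} h /\<^sub>R t = (F (x + t) - F x) /\<^sub>R t"
        unfolding eventually_at_right_field
        by (intro exI[of _ "b - x"]) (use x(1) incr[of x] in auto)
    qed
    have "((\<lambda>t. (F (x - t) - F x) /\<^sub>R (- t)) \<longlongrightarrow> f x) (at_right 0)"
    proof (rule Lim_transform_eventually)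
      show "((\<lambda>t. integral {- x..- x + t} (\<lambda>x. h (- x)) /\<^sub>R t) \<longlongrightarrow> f x) (at_right 0)"
        using N'(2)[OF \<open>- x \<notin> N'\<close>] hx by simp
      have "integral {- x..- x + t} (\<lambda>x. h (- x)) /\<^sub>R t = (F (x - t) - F x) /\<^sub>R (- t)" if "0 < t" "t < x - a" for t
      proof -
        have "integral {- x..- x + t} (\<lambda>x. h (- x)) = integral {x - t..x} h"
          using Henstock_Kurzweil_Integration.integral_reflect_real[where f = h and a = "x - t" and b = x] by simp
        also have "\<dots> = F x - F (x - t)" using incr[of "x - t" x] that x(1) by simp
        finally show ?thesis by (simp add: scaleR_diff_right)
      qed
      then show "\<forall>\<^sub>F t in at_right 0. integral {- x..- x + t} (\<lambda>x. h (- x)) /\<^sub>R t = (F (x - t) - F x) /\<^sub>R (- t)"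
        unfolding eventually_at_right_field by (intro exI[of _ "x - a"]) (use x(1) in auto)
    qed
    then have left: "((\<lambda>t. (F (x + t) - F x) /\<^sub>R t) \<longlongrightarrow> f x) (at_left 0)"
      by (simp add: filterlim_at_left_to_right[of _ _ 0])
    have "((\<lambda>t. (F (x + t) - F x) /\<^sub>R t) \<longlongrightarrow> f x) (at 0)"
      using left right by (simp add: filterlim_split_at)
    then have "((\<lambda>t. norm ((F (x + t) - F x) /\<^sub>R t - f x)) \<longlongrightarrow> 0) (at 0)"
      by (simp add: tendsto_norm_zero_iff LIM_zero_iff)
    moreover have "\<forall>\<^sub>F t in at 0. norm ((F (x + t) - F x) /\<^sub>R t - f x) = norm (F (x + t) - F x - t *\<^sub>R f x) / norm t"
      using eventually_neq_at_within[of 0 0 UNIV]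
    proof eventually_elim
      case (elim t)
      then have "(F (x + t) - F x) /\<^sub>R t - f x = (F (x + t) - F x - t *\<^sub>R f x) /\<^sub>R t"
        by (simp add: scaleR_diff_right)
      then show ?case by (simp add: divide_inverse mult.commute)
    qed
    ultimately have "((\<lambda>t. norm (F (x + t) - F x - t *\<^sub>R f x) / norm t) \<longlongrightarrow> 0) (at 0)"
      by (rule Lim_transform_eventually)
    then show "(F has_vector_derivative f x) (at x)"
      unfolding has_vector_derivative_def has_derivative_at by (simp add: bounded_linear_scaleR_left)
  qed
qed

lemma smooth_upto_C1:
  fixes f :: "real \<Rightarrow> 'b::real_normed_vector"
  assumes "smooth_upto l f"
  obtains f' where "\<And>x. x \<in> {0..l} \<Longrightarrow> (f has_vector_derivative f' x) (at x within {0..l})"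
    and "continuous_on {0..l} f'" and "continuous_on {0..l} f"
proof -
  obtain D where D: "\<And>x. x \<in> {0..l} \<Longrightarrow> D 0 x = f x"
    "\<And>n x. x \<in> {0..l} \<Longrightarrow> (D n has_vector_derivative D (Suc n) x) (at x within {0..l})"
    using assms unfolding smooth_upto_def by blast
  have cont: "continuous_on {0..l} (D n)" for n
    using D(2) has_vector_derivative_continuous unfolding continuous_on_eq_continuous_within by blast
  show thesis
  proof (rule that[of "D 1"])
    fix x assume x: "x \<in> {0..l}"
    show "(f has_vector_derivative D 1 x) (at x within {0..l})"
      by (rule has_vector_derivative_transform[OF x _ D(2)[OF x, of 0, folded One_nat_def]]) (simp add: D(1))
  next
    have "continuous_on {0..l} (D 0) = continuous_on {0..l} f"
      by (rule continuous_on_cong) (use D(1) in auto)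
    then show "continuous_on {0..l} f" using cont[of 0] by simp
  qed (rule cont)
qed

lemma has_vector_derivative_add_potential:
  fixes a :: "real \<Rightarrow> real" and g u :: "real \<Rightarrow> complex"
  assumes "(g has_vector_derivative g') (at x within I)" "(a has_vector_derivative a') (at x within I)"
    "(u has_vector_derivative u') (at x within I)"
  shows "((\<lambda>x. g x + c * (of_real (a x) * u x)) has_vector_derivative
    g' + c * (of_real (a x) * u' + of_real a' * u x)) (at x within I)"
  by (intro has_vector_derivative_add has_vector_derivative_mult_right has_vector_derivative_mult assms
      bounded_linear.has_vector_derivative[OF bounded_linear_of_real])

lemma edge_deriv_eq:
  assumes "(u e has_vector_derivative d) (at x within {0..L e})" "0 < L e" "x \<in> {0..L e}"
  shows "edge_deriv L u e x = d"
  unfolding edge_deriv_def using assms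
  by (intro vector_derivative_within_cbox[of 0 "L e", simplified]) auto

text \<open>
  On an edge the eigenvalue equation is the first-order system \<open>D u = W\<close>, \<open>D W = - z u\<close> with
  \<open>D = d/dx + 2 \<pi> \<i> \<alpha>\<close>. It holds only almost everywhere to begin with, but it expresses the weak second
  derivative of \<open>u\<close> by continuous functions, so \<open>u\<close> is twice continuously differentiable.
\<close>

definition edge_system ::
    "real \<Rightarrow> (real \<Rightarrow> real) \<Rightarrow> complex \<Rightarrow> (real \<Rightarrow> complex) \<Rightarrow> (real \<Rightarrow> complex) \<Rightarrow> bool" where
  "edge_system l \<alpha> z u W \<longleftrightarrow> (\<forall>x\<in>{0..l}.
     (u has_vector_derivative (W x - 2 * pi * \<i> * \<alpha> x * u x)) (at x within {0..l}) \<and>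
     (W has_vector_derivative (- z * u x - 2 * pi * \<i> * \<alpha> x * W x)) (at x within {0..l}))"

lemma edge_system_of_eigenfunction:
  assumes l: "0 < L e" and \<alpha>: "smooth_upto (L e) (\<alpha> e)" and u: "sobolev2 (L e) (u e)"
    and ae: "AE x in lebesgue_on {0..L e}. - cov_deriv L \<alpha> (cov_deriv L \<alpha> u) e x - z * u e x = 0"
  shows "edge_system (L e) (\<alpha> e) z (u e) (cov_deriv L \<alpha> u e)"
proof -
  define I where "I = {0..L e}"
  define W where "W = cov_deriv L \<alpha> u"
  obtain a' where a': "\<And>x. x \<in> I \<Longrightarrow> (\<alpha> e has_vector_derivative a' x) (at x within I)"
    "continuous_on I a'" "continuous_on I (\<alpha> e)"
    using smooth_upto_C1[OF \<alpha>] unfolding I_def by blast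
  obtain g h where gh: "\<And>x. x \<in> I \<Longrightarrow> (u e has_vector_derivative g x) (at x within I)"
    "\<And>x. x \<in> I \<Longrightarrow> (h has_integral (g x - g 0)) {0..x}"
    using u unfolding sobolev2_def I_def by blast
  have W: "W e x = g x + 2 * pi * \<i> * \<alpha> e x * u e x" if "x \<in> I" for x
  proof -
    have "edge_deriv L u e x = g x"
      by (rule edge_deriv_eq) (use gh(1)[OF that] l that in \<open>auto simp: I_def\<close>)
    then show ?thesis by (simp add: W_def cov_deriv_def)
  qed
  have hint: "h integrable_on {0..L e}" using gh(2)[of "L e"] l by (auto simp: I_def)
  have g: "g x = g 0 + integral {0..x} h" if "x \<in> {0..L e}" for x
    using gh(2)[of x] that integral_unique[of h "g x - g 0" "{0..x}"] by (simp add: I_def)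
  obtain N where N: "negligible N"
    "\<And>x. x \<in> {0<..<L e} \<Longrightarrow> x \<notin> N \<Longrightarrow> (g has_vector_derivative h x) (at x)"
    by (rule lebesgue_differentiation[OF hint g]) blast+
  obtain N' where N': "N' \<in> null_sets (lebesgue_on I)"
    "\<And>x. x \<in> I \<Longrightarrow> x \<notin> N' \<Longrightarrow> - cov_deriv L \<alpha> W e x - z * u e x = 0"
  proof (rule AE_E3[OF ae])
    fix N' assume N': "\<And>x. x \<in> space (lebesgue_on {0..L e}) - N' \<Longrightarrow>
        - cov_deriv L \<alpha> (cov_deriv L \<alpha> u) e x - z * u e x = 0" "N' \<in> null_sets (lebesgue_on {0..L e})"
    show thesis by (rule that[of N']) (use N' in \<open>simp_all add: I_def W_def\<close>)
  qed
  have "negligible N'"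
    using N'(1) unfolding I_def by (simp add: null_sets_restrict_space negligible_iff_null_sets)
  then have neg: "negligible (N \<union> N' \<union> {0, L e})"
    using N(1) by (simp add: negligible_insert)
  \<comment> \<open>The second derivative of \<open>u\<close> as the equation gives it; it is continuous.\<close>
  define c where "c x = - z * u e x - 2 * pi * \<i> * (a' x * u e x + 2 * \<alpha> e x * g x) + 4 * (of_real pi)\<^sup>2 * (\<alpha> e x)\<^sup>2 * u e x" for x
  have hc: "h x = c x" if x: "x \<in> I - (N \<union> N' \<union> {0, L e})" for x
  proof -
    have xI: "x \<in> I" and x0: "x \<in> {0<..<L e}" using x by (auto simp: I_def)
    have gd: "(g has_vector_derivative h x) (at x within I)"
      using N(2)[OF x0] x by (auto intro: has_vector_derivative_at_within)
    have "((\<lambda>x. g x + 2 * pi * \<i> * (\<alpha> e x * u e x)) has_vector_derivative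
        (h x + 2 * pi * \<i> * (\<alpha> e x * g x + a' x * u e x))) (at x within I)"
      by (intro has_vector_derivative_add_potential gd a' gh(1) xI)
    then have Wd: "(W e has_vector_derivative
        (h x + 2 * pi * \<i> * (\<alpha> e x * g x + a' x * u e x))) (at x within I)"
      by (rule has_vector_derivative_transform[OF xI, rotated]) (simp add: W mult.assoc)
    have "edge_deriv L W e x = h x + 2 * pi * \<i> * (\<alpha> e x * g x + a' x * u e x)"
      by (rule edge_deriv_eq) (use Wd l xI in \<open>auto simp: I_def\<close>)
    then have "cov_deriv L \<alpha> W e x = h x + 2 * pi * \<i> * (\<alpha> e x * g x + a' x * u e x) + 2 * pi * \<i> * \<alpha> e x * W e x"
      by (simp add: cov_deriv_def I_def)
    then have eq: "- (h x + 2 * pi * \<i> * (\<alpha> e x * g x + a' x * u e x) + 2 * pi * \<i> * \<alpha> e x * W e x) - z * u e x = 0"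
      using N'(2)[OF xI] x by simp
    have "h = - s - P - Q" if "- (h + P + Q) - s = 0" for h P Q s :: complex
    proof -
      have "h = - s - P - Q - (- (h + P + Q) - s)" by simp
      also have "\<dots> = - s - P - Q" unfolding that by simp
      finally show ?thesis .
    qed
    from this[OF eq]
    show ?thesis
      by (simp add: c_def W[OF xI] algebra_simps power2_eq_square)
  qed
  have gcont: "continuous_on I g"
  proof -
    have "continuous_on I g = continuous_on I (\<lambda>x. g 0 + integral {0..x} h)"
      unfolding I_def by (rule continuous_on_cong[OF refl g])
    then show ?thesis
      using indefinite_integral_continuous_1[OF hint] by (auto simp: I_def intro!: continuous_intros)
  qed
  have ucont: "continuous_on I (u e)"
    using gh(1) has_vector_derivative_continuous unfolding continuous_on_eq_continuous_within by blast
  have ccont: "continuous_on I c"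
    unfolding c_def by (intro continuous_intros ucont gcont a')
  have gd: "(g has_vector_derivative c x) (at x within I)" if "x \<in> I" for x
  proof -
    have "((\<lambda>x. integral {0..x} c) has_vector_derivative c x) (at x within I)"
      unfolding I_def by (rule integral_has_vector_derivative) (use ccont that in \<open>auto simp: I_def\<close>)
    then have "((\<lambda>x. g 0 + integral {0..x} c) has_vector_derivative 0 + c x) (at x within I)"
      by (intro has_vector_derivative_add has_vector_derivative_const)
    moreover have "g y = g 0 + integral {0..y} c" if y: "y \<in> I" for y
    proof -
      have "integral {0..y} h = integral {0..y} c"
        by (rule integral_spike[OF neg, symmetric]) (use y hc in \<open>auto simp: I_def\<close>)
      then show ?thesis using g[of y] y by (simp add: I_def)
    qed
    ultimately show ?thesis
      using has_vector_derivative_transform[OF that, of g "\<lambda>x. g 0 + integral {0..x} c" "c x"] by simp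
  qed
  show ?thesis
    unfolding edge_system_def
  proof (intro ballI conjI)
    fix x assume "x \<in> {0..L e}"
    then have x: "x \<in> I" by (simp add: I_def)
    show "(u e has_vector_derivative (cov_deriv L \<alpha> u e x - 2 * pi * \<i> * \<alpha> e x * u e x)) (at x within {0..L e})"
      using gh(1)[OF x] W[OF x] by (simp add: W_def I_def)
    have "((\<lambda>x. g x + 2 * pi * \<i> * (\<alpha> e x * u e x)) has_vector_derivative
        (c x + 2 * pi * \<i> * (\<alpha> e x * g x + a' x * u e x))) (at x within I)"
      by (intro has_vector_derivative_add_potential gd a' gh(1) x)
    then have "(W e has_vector_derivative (c x + 2 * pi * \<i> * (\<alpha> e x * g x + a' x * u e x))) (at x within I)"
      by (rule has_vector_derivative_transform[OF x, rotated]) (simp add: W mult.assoc)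
    moreover have "c x + 2 * pi * \<i> * (\<alpha> e x * g x + a' x * u e x) = - z * u e x - 2 * pi * \<i> * \<alpha> e x * W e x"
      by (simp add: c_def W[OF x] algebra_simps power2_eq_square)
    ultimately show "(cov_deriv L \<alpha> u e has_vector_derivative
        (- z * u e x - 2 * pi * \<i> * \<alpha> e x * cov_deriv L \<alpha> u e x)) (at x within {0..L e})"
      by (simp add: W_def I_def)
  qed
qed

lemma eigenfunction_of_edge_system:
  assumes l: "0 < L e" and \<alpha>: "smooth_upto (L e) (\<alpha> e)" and sys: "edge_system (L e) (\<alpha> e) z (u e) W"
  shows "sobolev2 (L e) (u e)"
    and "\<And>x. x \<in> {0..L e} \<Longrightarrow> cov_deriv L \<alpha> u e x = W x"
    and "\<And>x. x \<in> {0..L e} \<Longrightarrow> - cov_deriv L \<alpha> (cov_deriv L \<alpha> u) e x - z * u e x = 0"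
proof -
  define I where "I = {0..L e}"
  obtain a' where a': "\<And>x. x \<in> I \<Longrightarrow> (\<alpha> e has_vector_derivative a' x) (at x within I)"
    "continuous_on I a'" "continuous_on I (\<alpha> e)"
    using smooth_upto_C1[OF \<alpha>] unfolding I_def by blast
  have ud: "(u e has_vector_derivative (W x - 2 * pi * \<i> * \<alpha> e x * u e x)) (at x within I)"
    and Wd: "(W has_vector_derivative (- z * u e x - 2 * pi * \<i> * \<alpha> e x * W x)) (at x within I)" if "x \<in> I" for x
    using sys that by (auto simp: edge_system_def I_def)
  have ucont: "continuous_on I (u e)" and Wcont: "continuous_on I W"
    using ud Wd has_vector_derivative_continuous unfolding continuous_on_eq_continuous_within by blast+
  show 1: "cov_deriv L \<alpha> u e x = W x" if "x \<in> {0..L e}" for x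
  proof -
    have "edge_deriv L u e x = W x - 2 * pi * \<i> * \<alpha> e x * u e x"
      by (rule edge_deriv_eq) (use ud[of x] l that in \<open>auto simp: I_def\<close>)
    then show ?thesis by (simp add: cov_deriv_def)
  qed
  show "- cov_deriv L \<alpha> (cov_deriv L \<alpha> u) e x - z * u e x = 0" if x: "x \<in> {0..L e}" for x
  proof -
    have "(cov_deriv L \<alpha> u e has_vector_derivative (- z * u e x - 2 * pi * \<i> * \<alpha> e x * W x)) (at x within {0..L e})"
      by (rule has_vector_derivative_transform[OF x 1]) (use Wd[of x] x in \<open>auto simp: I_def\<close>)
    then have "edge_deriv L (cov_deriv L \<alpha> u) e x = - z * u e x - 2 * pi * \<i> * \<alpha> e x * W x"
      by (rule edge_deriv_eq) (use l x in auto)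
    then show ?thesis by (simp add: cov_deriv_def[of L \<alpha> "cov_deriv L \<alpha> u"] 1[OF x])
  qed
  define g where "g x = W x - 2 * pi * \<i> * (\<alpha> e x * u e x)" for x
  define h where "h x = (- z * u e x - 2 * pi * \<i> * \<alpha> e x * W x)
    - 2 * pi * \<i> * (\<alpha> e x * (W x - 2 * pi * \<i> * \<alpha> e x * u e x) + a' x * u e x)" for x
  have gd: "(g has_vector_derivative h x) (at x within I)" if x: "x \<in> I" for x
  proof -
    have "((\<lambda>x. W x + - (2 * pi * \<i>) * (\<alpha> e x * u e x)) has_vector_derivative
        (- z * u e x - 2 * pi * \<i> * \<alpha> e x * W x) + - (2 * pi * \<i>) *
          (\<alpha> e x * (W x - 2 * pi * \<i> * \<alpha> e x * u e x) + a' x * u e x)) (at x within I)"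
      by (intro has_vector_derivative_add_potential Wd a' ud x)
    then show ?thesis by (simp add: g_def[abs_def] h_def)
  qed
  have hcont: "continuous_on I h"
    unfolding h_def by (intro continuous_intros ucont Wcont a')
  show "sobolev2 (L e) (u e)"
    unfolding sobolev2_def
  proof (rule exI[of _ g], rule exI[of _ h], intro conjI ballI)
    show "(u e has_vector_derivative g x) (at x within {0..L e})" if "x \<in> {0..L e}" for x
      using ud[of x] that by (simp add: I_def g_def mult.assoc)
    show "h \<in> borel_measurable (lebesgue_on {0..L e})"
      using hcont by (intro continuous_imp_measurable_on_sets_lebesgue) (auto simp: I_def)
    show "integrable (lebesgue_on {0..L e}) (\<lambda>x. (cmod (h x))\<^sup>2)"
      using hcont unfolding I_def by (intro continuous_imp_integrable_real continuous_intros)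
    show "(h has_integral (g x - g 0)) {0..x}" if "x \<in> {0..L e}" for x
    proof (rule fundamental_theorem_of_calculus)
      fix y assume "y \<in> {0..x}"
      then show "(g has_vector_derivative h y) (at y within {0..x})"
        using that by (intro has_vector_derivative_within_subset[OF gd]) (auto simp: I_def)
    qed (use that in auto)
  qed
qed


section \<open>Waves on an edge\<close>

lemma dim_linear_inj_image:
  fixes J :: "('a \<Rightarrow> complex) \<Rightarrow> 'p \<Rightarrow> complex"
  assumes lin: "Vector_Spaces.linear (\<lambda>c f p. c * f p) (\<lambda>c f p. c * f p) J"
    and S: "fs.subspace S" and inj: "inj_on J S"
  shows "fs.dim (J ` S) = fs.dim S"
proof -
  interpret vector_space_pair "\<lambda>c (f :: 'a \<Rightarrow> complex) p. c * f p" "\<lambda>c (f :: 'p \<Rightarrow> complex) p. c * f p"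
    by (rule vector_space_pair.intro; unfold_locales)
  obtain T where T: "T \<subseteq> S" "fs.independent T" "S \<subseteq> fs.span T" "card T = fs.dim S"
    by (rule fs.basis_exists)
  have span: "fs.span T = S"
    using T S by (simp add: fs.span_subspace)
  have "fs.independent (J ` T)"
    by (rule linear_independent_injective_image[OF lin T(2)]) (simp add: span inj)
  moreover have "fs.span (J ` T) = fs.span (J ` S)"
    using linear_span_image[OF lin, of T] linear_span_image[OF lin, of S] span S by (simp add: fs.span_eq_iff[THEN iffD2])
  ultimately have "fs.dim (J ` S) = card (J ` T)"
    by (intro fs.dim_eq_card) auto
  also have "\<dots> = card T" using inj T(1) by (intro card_image) (rule inj_on_subset)
  finally show ?thesis using T(4) by simp
qed

lemma dim_supported:
  fixes B :: "'b set"
  assumes "finite B"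
  shows "fs.dim {x :: 'b \<Rightarrow> complex. \<forall>b. b \<notin> B \<longrightarrow> x b = 0} = card B"
proof -
  let ?S = "{x :: 'b \<Rightarrow> complex. \<forall>b. b \<notin> B \<longrightarrow> x b = 0}"
  have sub: "fs.subspace ?S" by (auto simp: fs.subspace_def)
  have inj: "inj unit_fun"
    by (auto simp: inj_def unit_fun_def fun_eq_iff split: if_splits)
  have ind: "fs.independent (unit_fun ` B)"
  proof (rule fs.independent_if_scalars_zero)
    fix f x assume sum: "(\<Sum>x\<in>unit_fun ` B. (\<lambda>p. f x * x p)) = 0" and "x \<in> unit_fun ` B"
    then obtain b where b: "b \<in> B" "x = unit_fun b" by blast
    have "(\<Sum>x\<in>unit_fun ` B. (\<lambda>p. f x * x p)) b = (\<Sum>c\<in>B. f (unit_fun c) * unit_fun c b)"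
      unfolding fun_sum_eval by (rule sum.reindex_cong[of unit_fun]) (auto intro: inj_on_subset[OF inj])
    also have "\<dots> = f (unit_fun b)"
      using b assms by (simp add: unit_fun_def if_distrib cong: if_cong)
    finally show "f x = 0" using sum b by simp
  qed (use assms in simp)
  have span: "fs.span (unit_fun ` B) = ?S"
  proof (rule fs.span_subspace[OF _ _ sub])
    show "unit_fun ` B \<subseteq> ?S" by (auto simp: unit_fun_def)
    show "?S \<subseteq> fs.span (unit_fun ` B)"
    proof
      fix x assume x: "x \<in> ?S"
      have "(\<Sum>b\<in>B. (\<lambda>p. x b * unit_fun b p)) \<in> fs.span (unit_fun ` B)"
        by (intro fs.span_sum fs.span_scale fs.span_base) auto
      moreover have "(\<Sum>b\<in>B. (\<lambda>p. x b * unit_fun b p)) = x"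
        by (rule sum_unit_fun) (use assms x in auto)
      ultimately show "x \<in> fs.span (unit_fun ` B)" by (simp only:)
    qed
  qed
  have "fs.dim ?S = card (unit_fun ` B)"
    by (rule fs.dim_eq_card[OF _ ind]) (simp only: span[symmetric] fs.span_span)
  also have "\<dots> = card B" by (intro card_image inj_on_subset[OF inj]) auto
  finally show ?thesis .
qed

definition edge_phase :: "(real \<Rightarrow> real) \<Rightarrow> real \<Rightarrow> real" where
  "edge_phase \<alpha> x = 2 * pi * integral {0..x} \<alpha>"

text \<open>
  The superposition of the wave that leaves the end \<open>0\<close> with the value \<open>p\<close> and the wave that leaves
  the end \<open>l\<close> with the value \<open>q\<close>.
\<close>

definition edge_wave :: "real \<Rightarrow> (real \<Rightarrow> real) \<Rightarrow> complex \<Rightarrow> complex \<Rightarrow> complex \<Rightarrow> real \<Rightarrow> complex" where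
  "edge_wave l \<alpha> k p q x =
     exp (- \<i> * edge_phase \<alpha> x) * (p * exp (\<i> * k * x) + q * exp (\<i> * edge_phase \<alpha> l) * exp (\<i> * k * (l - x)))"

lemma edge_phase_0 [simp]: "edge_phase \<alpha> 0 = 0"
  by (simp add: edge_phase_def)

lemma edge_wave_0: "edge_wave l \<alpha> k p q 0 = p + exp (\<i> * edge_phase \<alpha> l) * exp (\<i> * k * l) * q"
  by (simp add: edge_wave_def algebra_simps)

lemma edge_wave_end: "edge_wave l \<alpha> k p q l = exp (- \<i> * edge_phase \<alpha> l) * exp (\<i> * k * l) * p + q"
  by (simp add: edge_wave_def algebra_simps exp_minus)

lemma edge_wave_add: "edge_wave l \<alpha> k (p + p') (q + q') x = edge_wave l \<alpha> k p q x + edge_wave l \<alpha> k p' q' x"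
  by (simp add: edge_wave_def algebra_simps)

lemma edge_wave_scale: "edge_wave l \<alpha> k (c * p) (c * q) x = c * edge_wave l \<alpha> k p q x"
  by (simp add: edge_wave_def algebra_simps)

lemma edge_phase_deriv:
  assumes "continuous_on {0..l} \<alpha>" "x \<in> {0..l}"
  shows "((\<lambda>x. complex_of_real (edge_phase \<alpha> x)) has_vector_derivative of_real (2 * pi * \<alpha> x)) (at x within {0..l})"
proof -
  have "((\<lambda>x. integral {0..x} \<alpha>) has_vector_derivative \<alpha> x) (at x within {0..l})"
    by (rule integral_has_vector_derivative[OF assms])
  then have "(edge_phase \<alpha> has_vector_derivative 2 * pi * \<alpha> x) (at x within {0..l})"
    unfolding edge_phase_def by (rule has_vector_derivative_mult_right)
  then show ?thesis by (rule bounded_linear.has_vector_derivative[OF bounded_linear_of_real])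
qed

lemma exp_has_vector_derivative:
  fixes f :: "real \<Rightarrow> complex"
  assumes "(f has_vector_derivative f') (at x within S)"
  shows "((\<lambda>x. exp (f x)) has_vector_derivative f' * exp (f x)) (at x within S)"
  using field_vector_diff_chain_within[OF assms, of exp "exp (f x)"]
  by (simp add: o_def has_field_derivative_at_within)

lemma of_real_has_vector_derivative:
  "((\<lambda>x. complex_of_real x) has_vector_derivative 1) (at x within S)"
proof -
  have "((\<lambda>x. complex_of_real x) has_vector_derivative complex_of_real 1) (at x within S)"
    by (rule bounded_linear.has_vector_derivative[OF bounded_linear_of_real has_vector_derivative_id])
  then show ?thesis by simp
qed

lemma edge_system_edge_wave:
  assumes "smooth_upto l \<alpha>"
  shows "edge_system l \<alpha> (k\<^sup>2) (edge_wave l \<alpha> k p q) (\<lambda>x. \<i> * k * edge_wave l \<alpha> k p (- q) x)"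
proof -
  have cont: "continuous_on {0..l} \<alpha>" using smooth_upto_C1[OF assms] by blast
  have wave: "(edge_wave l \<alpha> k p q has_vector_derivative
      (\<i> * k * edge_wave l \<alpha> k p (- q) x - 2 * pi * \<i> * \<alpha> x * edge_wave l \<alpha> k p q x)) (at x within {0..l})"
    if x: "x \<in> {0..l}" for x p q
  proof -
    define c where "c = q * exp (\<i> * edge_phase \<alpha> l)"
    have 1: "((\<lambda>x. exp (- \<i> * of_real (edge_phase \<alpha> x))) has_vector_derivative
        (- \<i> * of_real (2 * pi * \<alpha> x)) * exp (- \<i> * of_real (edge_phase \<alpha> x))) (at x within {0..l})"
      by (intro exp_has_vector_derivative has_vector_derivative_mult_right edge_phase_deriv cont x)
    have 2: "((\<lambda>x. exp (\<i> * k * of_real x)) has_vector_derivative (\<i> * k * 1) * exp (\<i> * k * of_real x)) (at x within {0..l})"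
      by (intro exp_has_vector_derivative has_vector_derivative_mult_right of_real_has_vector_derivative)
    have 3: "((\<lambda>x. exp (\<i> * k * (of_real l - of_real x))) has_vector_derivative
        (\<i> * k * (0 - 1)) * exp (\<i> * k * (of_real l - of_real x))) (at x within {0..l})"
      by (intro exp_has_vector_derivative has_vector_derivative_mult_right has_vector_derivative_diff
          has_vector_derivative_const of_real_has_vector_derivative)
    have "((\<lambda>x. exp (- \<i> * of_real (edge_phase \<alpha> x)) * (p * exp (\<i> * k * of_real x) + c * exp (\<i> * k * (of_real l - of_real x))))
       has_vector_derivative
         exp (- \<i> * of_real (edge_phase \<alpha> x)) * (p * ((\<i> * k * 1) * exp (\<i> * k * of_real x)) + c * ((\<i> * k * (0 - 1)) * exp (\<i> * k * (of_real l - of_real x))))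
       + ((- \<i> * of_real (2 * pi * \<alpha> x)) * exp (- \<i> * of_real (edge_phase \<alpha> x))) * (p * exp (\<i> * k * of_real x) + c * exp (\<i> * k * (of_real l - of_real x))))
      (at x within {0..l})"
      by (intro has_vector_derivative_mult has_vector_derivative_add has_vector_derivative_mult_right 1 2 3)
    moreover have "edge_wave l \<alpha> k p q = (\<lambda>x. exp (- \<i> * of_real (edge_phase \<alpha> x)) * (p * exp (\<i> * k * of_real x) + c * exp (\<i> * k * (of_real l - of_real x))))"
      by (simp add: edge_wave_def c_def fun_eq_iff)
    ultimately show ?thesis
      by (simp add: edge_wave_def c_def algebra_simps)
  qed
  show ?thesis
    unfolding edge_system_def
  proof (intro ballI conjI)
    fix x assume x: "x \<in> {0..l}"
    show "(edge_wave l \<alpha> k p q has_vector_derivative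
        (\<i> * k * edge_wave l \<alpha> k p (- q) x - 2 * pi * \<i> * \<alpha> x * edge_wave l \<alpha> k p q x)) (at x within {0..l})"
      by (rule wave[OF x])
    have "((\<lambda>x. \<i> * k * edge_wave l \<alpha> k p (- q) x) has_vector_derivative
        \<i> * k * (\<i> * k * edge_wave l \<alpha> k p (- (- q)) x - 2 * pi * \<i> * \<alpha> x * edge_wave l \<alpha> k p (- q) x)) (at x within {0..l})"
      by (intro has_vector_derivative_mult_right wave[OF x])
    also have "\<i> * k * (\<i> * k * edge_wave l \<alpha> k p (- (- q)) x - 2 * pi * \<i> * \<alpha> x * edge_wave l \<alpha> k p (- q) x) =
        - k\<^sup>2 * edge_wave l \<alpha> k p q x - 2 * pi * \<i> * \<alpha> x * (\<i> * k * edge_wave l \<alpha> k p (- q) x)"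
      by (simp add: algebra_simps power2_eq_square)
    finally show "((\<lambda>x. \<i> * k * edge_wave l \<alpha> k p (- q) x) has_vector_derivative
        - k\<^sup>2 * edge_wave l \<alpha> k p q x - 2 * pi * \<i> * \<alpha> x * (\<i> * k * edge_wave l \<alpha> k p (- q) x)) (at x within {0..l})" .
  qed
qed

text \<open>
  The two combinations \<open>W + \<i> k u\<close> and \<open>W - \<i> k u\<close> decouple the system; up to the factor
  \<open>exp (- \<i> edge_phase)\<close> they are multiples of \<open>exp (\<i> k x)\<close> and \<open>exp (- \<i> k x)\<close>.
\<close>

lemma edge_system_solution:
  assumes sys: "edge_system l \<alpha> (k\<^sup>2) u W" and \<alpha>: "smooth_upto l \<alpha>" and k: "k \<noteq> 0"
  obtains p q where "\<And>x. x \<in> {0..l} \<Longrightarrow> u x = edge_wave l \<alpha> k p q x"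
    and "\<And>x. x \<in> {0..l} \<Longrightarrow> W x = \<i> * k * edge_wave l \<alpha> k p (- q) x"
proof -
  have cont: "continuous_on {0..l} \<alpha>" using smooth_upto_C1[OF \<alpha>] by blast
  have const: "\<exists>c. \<forall>x\<in>{0..l}. (W x + s * u x) * exp (\<i> * of_real (edge_phase \<alpha> x)) * exp (- s * of_real x) = c"
    if s: "s\<^sup>2 = - k\<^sup>2" for s
  proof -
    have "((\<lambda>x. (W x + s * u x) * exp (\<i> * of_real (edge_phase \<alpha> x)) * exp (- s * of_real x)) has_vector_derivative 0) (at x within {0..l})"
      if x: "x \<in> {0..l}" for x
    proof -
      define E where "E = exp (\<i> * of_real (edge_phase \<alpha> x))"
      define F where "F = exp (- s * of_real x)"
      define a where "a = complex_of_real (2 * pi * \<alpha> x)"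
      have u: "(u has_vector_derivative (W x - \<i> * a * u x)) (at x within {0..l})"
        and W: "(W has_vector_derivative (- k\<^sup>2 * u x - \<i> * a * W x)) (at x within {0..l})"
        using sys x by (auto simp: edge_system_def a_def mult_ac)
      have 1: "((\<lambda>x. exp (\<i> * of_real (edge_phase \<alpha> x))) has_vector_derivative (\<i> * a) * E) (at x within {0..l})"
        unfolding E_def a_def by (intro exp_has_vector_derivative has_vector_derivative_mult_right edge_phase_deriv cont x)
      have 2: "((\<lambda>x. exp (- s * of_real x)) has_vector_derivative (- s * 1) * F) (at x within {0..l})"
        unfolding F_def by (intro exp_has_vector_derivative has_vector_derivative_mult_right of_real_has_vector_derivative)
      have "((\<lambda>x. (W x + s * u x) * exp (\<i> * of_real (edge_phase \<alpha> x)) * exp (- s * of_real x)) has_vector_derivative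
          (W x + s * u x) * E * ((- s * 1) * F) +
          ((W x + s * u x) * ((\<i> * a) * E) + ((- k\<^sup>2 * u x - \<i> * a * W x) + s * (W x - \<i> * a * u x)) * E) * F) (at x within {0..l})"
        unfolding E_def F_def
        by (intro has_vector_derivative_mult has_vector_derivative_add has_vector_derivative_mult_right
            1[unfolded E_def] 2[unfolded F_def] u W)
      moreover have "(W x + s * u x) * E * ((- s * 1) * F) +
          ((W x + s * u x) * ((\<i> * a) * E) + ((- k\<^sup>2 * u x - \<i> * a * W x) + s * (W x - \<i> * a * u x)) * E) * F
        = 0"
      proof -
        have "(W x + s * u x) * E * ((- s * 1) * F) +
            ((W x + s * u x) * ((\<i> * a) * E) + ((- k\<^sup>2 * u x - \<i> * a * W x) + s * (W x - \<i> * a * u x)) * E) * F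
          = (- k\<^sup>2 - s\<^sup>2) * u x * E * F"
          by (simp add: algebra_simps power2_eq_square)
        then show ?thesis using s by simp
      qed
      ultimately show ?thesis by (simp only:)
    qed
    from has_vector_derivative_zero_constant[OF _ this] show ?thesis by (metis convex_real_interval(5))
  qed
  obtain P where P: "\<And>x. x \<in> {0..l} \<Longrightarrow> (W x + \<i> * k * u x) * exp (\<i> * of_real (edge_phase \<alpha> x)) * exp (- (\<i> * k) * of_real x) = P"
    using const[of "\<i> * k"] by (auto simp: power_mult_distrib)
  obtain Q where Q: "\<And>x. x \<in> {0..l} \<Longrightarrow> (W x - \<i> * k * u x) * exp (\<i> * of_real (edge_phase \<alpha> x)) * exp ((\<i> * k) * of_real x) = Q"
    using const[of "- (\<i> * k)"] by (auto simp: power_mult_distrib)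
  define p where "p = P / (2 * \<i> * k)"
  define q where "q = - Q / (2 * \<i> * k) * exp (- \<i> * edge_phase \<alpha> l) * exp (- \<i> * k * l)"
  have wave: "edge_wave l \<alpha> k p (t * q) x = ((W x + \<i> * k * u x) - t * (W x - \<i> * k * u x)) / (2 * \<i> * k)"
    if x: "x \<in> {0..l}" for x t
  proof -
    define E where "E = exp (\<i> * of_real (edge_phase \<alpha> x))"
    define F where "F = exp (\<i> * k * of_real x)"
    have EF: "E \<noteq> 0" "F \<noteq> 0" by (simp_all add: E_def F_def)
    have em: "exp (- \<i> * of_real (edge_phase \<alpha> x)) = 1 / E" "exp (- (\<i> * k) * of_real x) = 1 / F"
      by (simp_all add: E_def F_def exp_minus inverse_eq_divide)
    have el: "exp (\<i> * k * (l - x)) = exp (\<i> * k * l) / F"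
      by (simp add: F_def right_diff_distrib exp_diff)
    have qe: "q * exp (\<i> * edge_phase \<alpha> l) * exp (\<i> * k * l) = - Q / (2 * \<i> * k)"
    proof -
      have 1: "exp (- \<i> * edge_phase \<alpha> l) * exp (\<i> * edge_phase \<alpha> l) = 1" "exp (- \<i> * k * l) * exp (\<i> * k * l) = 1"
        by (simp_all flip: exp_add)
      have "q * exp (\<i> * edge_phase \<alpha> l) * exp (\<i> * k * l) = - Q / (2 * \<i> * k) *
          (exp (- \<i> * edge_phase \<alpha> l) * exp (\<i> * edge_phase \<alpha> l)) * (exp (- \<i> * k * l) * exp (\<i> * k * l))"
        by (simp only: q_def mult_ac)
      then show ?thesis unfolding 1 by simp
    qed
    have PF: "P = (W x + \<i> * k * u x) * E / F" using P[OF x] em(2) by (simp add: E_def)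
    have QF: "Q = (W x - \<i> * k * u x) * E * F" using Q[OF x] by (simp add: E_def F_def)
    have "edge_wave l \<alpha> k p (t * q) x = 1 / E * (p * F + t * (q * exp (\<i> * edge_phase \<alpha> l) * exp (\<i> * k * l)) / F)"
      unfolding edge_wave_def em(1) el F_def[symmetric] by simp
    also have "\<dots> = 1 / E * (P / (2 * \<i> * k) * F + t * (- Q / (2 * \<i> * k)) / F)"
      unfolding qe p_def by simp
    also have "\<dots> = ((W x + \<i> * k * u x) - t * (W x - \<i> * k * u x)) / (2 * \<i> * k)"
      unfolding PF QF using EF k by (simp add: field_simps)
    finally show ?thesis .
  qed
  show thesis
  proof (rule that[of p q])
    fix x assume x: "x \<in> {0..l}"
    show "u x = edge_wave l \<alpha> k p q x" using wave[OF x, of 1] k by simp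
    show "W x = \<i> * k * edge_wave l \<alpha> k p (- q) x" using wave[OF x, of "- 1"] k by simp
  qed
qed

lemma edge_system_zero:
  assumes sys: "edge_system l \<alpha> z u W" and "0 < l" and u: "\<And>x. x \<in> {0..l} \<Longrightarrow> u x = 0" and x: "x \<in> {0..l}"
  shows "W x = 0"
proof -
  have "(u has_vector_derivative W x) (at x within {0..l})"
  proof -
    have "(u has_vector_derivative (W x - 2 * pi * \<i> * \<alpha> x * u x)) (at x within {0..l})"
      using sys x unfolding edge_system_def by blast
    then show ?thesis by (simp add: u[OF x])
  qed
  moreover have "(u has_vector_derivative 0) (at x within {0..l})"
    by (rule has_vector_derivative_transform[OF x u has_vector_derivative_const])
  ultimately show ?thesis
    using vector_derivative_within_cbox[of 0 l x u] assms(2) x by (metis box_real(2))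
qed

lemma edge_wave_eq_0:
  assumes "0 < l" and k: "k \<noteq> 0" and \<alpha>: "smooth_upto l \<alpha>"
    and zero: "\<And>x. x \<in> {0..l} \<Longrightarrow> edge_wave l \<alpha> k p q x = 0"
  shows "p = 0" "q = 0"
proof -
  have 0: "0 \<in> {0..l}" using assms(1) by simp
  have "\<i> * k * edge_wave l \<alpha> k p (- q) 0 = 0"
    by (rule edge_system_zero[OF edge_system_edge_wave[OF \<alpha>] assms(1) zero 0])
  then have 1: "p - exp (\<i> * edge_phase \<alpha> l) * exp (\<i> * k * l) * q = 0" using k by (simp add: edge_wave_0)
  moreover have 2: "p + exp (\<i> * edge_phase \<alpha> l) * exp (\<i> * k * l) * q = 0" using zero[OF 0] by (simp add: edge_wave_0)
  ultimately have "2 * p = 0" by (simp add: algebra_simps)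
  then show "p = 0" by simp
  with 2 show "q = 0" by simp
qed


section \<open>Scattering at the vertices\<close>

text \<open>
  A directed edge, encoded as in walks; it leaves its origin.
\<close>

definition darts :: "('v, 'e) pre_digraph \<Rightarrow> ('e \<times> bool) set" where
  "darts G = arcs G \<times> UNIV"

definition origin :: "('v, 'e) pre_digraph \<Rightarrow> 'e \<times> bool \<Rightarrow> 'v" where
  "origin G b = (if snd b then tail G (fst b) else head G (fst b))"

definition reverse :: "'e \<times> bool \<Rightarrow> 'e \<times> bool" where
  "reverse b = (fst b, \<not> snd b)"

definition out_darts :: "('v, 'e) pre_digraph \<Rightarrow> 'v \<Rightarrow> ('e \<times> bool) set" where
  "out_darts G v = {b \<in> darts G. origin G b = v}"

definition dart_flux :: "('e \<Rightarrow> real) \<Rightarrow> ('e \<Rightarrow> real \<Rightarrow> real) \<Rightarrow> 'e \<times> bool \<Rightarrow> real" where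
  "dart_flux L \<alpha> b = (if snd b then 1 else - 1) * integral {0..L (fst b)} (\<alpha> (fst b))"

text \<open>
  At a vertex of degree \<open>d\<close>, continuity and the Kirchhoff condition reflect an incoming wave with
  amplitude \<open>2 / d - 1\<close> and transmit it into every other end of an edge with amplitude \<open>2 / d\<close>.
\<close>

definition vertex_scattering :: "('v, 'e) pre_digraph \<Rightarrow> 'e \<times> bool \<Rightarrow> 'e \<times> bool \<Rightarrow> real" where
  "vertex_scattering G b c =
     (if origin G (reverse c) = origin G b
      then 2 / card (out_darts G (origin G b)) - (if b = reverse c then 1 else 0) else 0)"

text \<open>
  The potential changes the phase of a wave along an edge by its integral.
\<close>

definition bond_matrix :: "('v, 'e) pre_digraph \<Rightarrow> ('e \<Rightarrow> real) \<Rightarrow> ('e \<Rightarrow> real \<Rightarrow> real) \<Rightarrow>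
    'e \<times> bool \<Rightarrow> 'e \<times> bool \<Rightarrow> complex" where
  "bond_matrix G L \<alpha> b c = of_real (vertex_scattering G b c) * exp (- (2 * pi * \<i> * dart_flux L \<alpha> c))"

lemma reverse_reverse [simp]: "reverse (reverse b) = b"
  by (simp add: reverse_def)

lemma fst_reverse [simp]: "fst (reverse b) = fst b"
  by (simp add: reverse_def)

lemma reverse_in_darts [simp]: "reverse b \<in> darts G \<longleftrightarrow> b \<in> darts G"
  by (cases b) (simp add: reverse_def darts_def)

lemma bij_reverse: "bij_betw reverse (darts G) (darts G)"
  by (rule bij_betwI[of _ _ _ reverse]) auto

lemma dart_flux_reverse: "dart_flux L \<alpha> (reverse b) = - dart_flux L \<alpha> b"
  by (simp add: dart_flux_def reverse_def)

text \<open>Twice the mean minus the identity is the reflection in the diagonal, an isometry.\<close>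

lemma mean_reflection_isometry:
  fixes z :: "'b \<Rightarrow> complex"
  assumes "finite A"
  shows "(\<Sum>b\<in>A. (cmod (2 / card A * (\<Sum>c\<in>A. z c) - z b))\<^sup>2) = (\<Sum>b\<in>A. (cmod (z b))\<^sup>2)"
proof (cases "A = {}")
  case False
  define s where "s = (\<Sum>c\<in>A. z c)"
  define m where "m = 2 / complex_of_real (card A) * s"
  have card: "0 < card A" using False assms by (simp add: card_gt_0_iff)
  have m_s: "of_nat (card A) * m = 2 * s" using card by (simp add: m_def)
  have "(\<Sum>b\<in>A. (m - z b) * cnj (m - z b)) =
      of_nat (card A) * m * cnj m - m * cnj s - cnj m * s + (\<Sum>b\<in>A. z b * cnj (z b))"
    by (simp add: algebra_simps sum.distrib sum_subtractf s_def sum_distrib_left sum_distrib_right)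
  also have "m * cnj s = cnj m * s"
    by (simp add: m_def)
  also have "of_nat (card A) * m * cnj m - cnj m * s - cnj m * s + (\<Sum>b\<in>A. z b * cnj (z b)) = (\<Sum>b\<in>A. z b * cnj (z b))"
    by (simp add: m_s)
  finally have "complex_of_real (\<Sum>b\<in>A. (cmod (m - z b))\<^sup>2) = complex_of_real (\<Sum>b\<in>A. (cmod (z b))\<^sup>2)"
    by (simp only: of_real_sum complex_norm_square)
  then have "(\<Sum>b\<in>A. (cmod (m - z b))\<^sup>2) = (\<Sum>b\<in>A. (cmod (z b))\<^sup>2)"
    by (simp only: of_real_eq_iff)
  then show ?thesis by (simp add: m_def s_def)
qed simp

context quantum_graph
begin

lemma finite_darts: "finite (darts G)"
  by (simp add: darts_def)

lemma finite_out_darts: "finite (out_darts G v)"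
  using finite_darts by (simp add: out_darts_def)

lemma sum_out_darts:
  fixes f :: "'e \<times> bool \<Rightarrow> 'a::comm_monoid_add"
  shows "(\<Sum>b\<in>out_darts G v. f b) = (\<Sum>e\<in>out_arcs G v. f (e, True)) + (\<Sum>e\<in>in_arcs G v. f (e, False))"
proof -
  have "out_darts G v = (\<lambda>e. (e, True)) ` out_arcs G v \<union> (\<lambda>e. (e, False)) ` in_arcs G v"
    by (auto simp: out_darts_def darts_def origin_def)
  moreover have "finite (out_arcs G v)" "finite (in_arcs G v)" by auto
  ultimately show ?thesis
    by (simp add: sum.union_disjoint sum.reindex inj_on_def)
      (subst sum.union_disjoint; auto simp: sum.reindex inj_on_def)
qed

lemma out_darts_reverse:
  fixes f :: "'e \<times> bool \<Rightarrow> 'a::comm_monoid_add"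
  shows "(\<Sum>c | c \<in> darts G \<and> origin G (reverse c) = v. f c) = (\<Sum>b\<in>out_darts G v. f (reverse b))"
  by (rule sum.reindex_bij_witness[of _ reverse reverse]) (auto simp: out_darts_def)

lemma vertex_scattering_apply:
  fixes y :: "'e \<times> bool \<Rightarrow> complex"
  assumes "b \<in> darts G"
  shows "(\<Sum>c\<in>darts G. of_real (vertex_scattering G b c) * y c) =
    2 / card (out_darts G (origin G b)) * (\<Sum>b'\<in>out_darts G (origin G b). y (reverse b')) - y (reverse b)"
proof -
  define d where "d = complex_of_real (2 / card (out_darts G (origin G b)))"
  have "(\<Sum>c\<in>darts G. of_real (vertex_scattering G b c) * y c) =
      (\<Sum>c\<in>darts G. (if origin G (reverse c) = origin G b then d * y c else 0) - (if c = reverse b then y c else 0))"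
    by (intro sum.cong) (auto simp: vertex_scattering_def d_def algebra_simps)
  also have "\<dots> = (\<Sum>c | c \<in> darts G \<and> origin G (reverse c) = origin G b. d * y c) - y (reverse b)"
    using finite_darts assms by (simp add: sum_subtractf sum.inter_filter)
  also have "\<dots> = d * (\<Sum>b'\<in>out_darts G (origin G b). y (reverse b')) - y (reverse b)"
    by (simp only: out_darts_reverse sum_distrib_left)
  finally show ?thesis by (simp add: d_def)
qed

lemma sum_darts_by_origin:
  fixes f :: "'e \<times> bool \<Rightarrow> 'a::comm_monoid_add"
  shows "(\<Sum>b\<in>darts G. f b) = (\<Sum>v\<in>verts G. \<Sum>b\<in>out_darts G v. f b)"
proof -
  have "(\<Sum>b\<in>darts G. f b) = (\<Sum>v\<in>verts G. sum f {b \<in> darts G. origin G b = v})"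
    by (rule sum.group[symmetric]) (auto simp: darts_def origin_def)
  then show ?thesis by (simp add: out_darts_def)
qed

lemma scattering_bonds: "scattering (darts G) (bond_matrix G L \<alpha>) (\<lambda>b. L (fst b))"
proof
  show "finite (darts G)" by (rule finite_darts)
  show "0 < L (fst b)" if "b \<in> darts G" for b
    using that length_pos by (auto simp: darts_def)
  fix x :: "'e \<times> bool \<Rightarrow> complex"
  define y where "y c = exp (- (2 * pi * \<i> * dart_flux L \<alpha> c)) * x c" for c
  have y: "cmod (y c) = cmod (x c)" for c by (simp add: y_def norm_mult)
  have "(\<Sum>b\<in>darts G. (cmod (\<Sum>c\<in>darts G. bond_matrix G L \<alpha> b c * x c))\<^sup>2) =
      (\<Sum>b\<in>darts G. (cmod (2 / card (out_darts G (origin G b)) * (\<Sum>b'\<in>out_darts G (origin G b). y (reverse b')) - y (reverse b)))\<^sup>2)"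
  proof (intro sum.cong refl)
    fix b assume b: "b \<in> darts G"
    have "(\<Sum>c\<in>darts G. bond_matrix G L \<alpha> b c * x c) = (\<Sum>c\<in>darts G. of_real (vertex_scattering G b c) * y c)"
      by (simp add: bond_matrix_def y_def mult.assoc)
    then show "(cmod (\<Sum>c\<in>darts G. bond_matrix G L \<alpha> b c * x c))\<^sup>2 =
        (cmod (2 / card (out_darts G (origin G b)) * (\<Sum>b'\<in>out_darts G (origin G b). y (reverse b')) - y (reverse b)))\<^sup>2"
      by (simp only: vertex_scattering_apply[OF b])
  qed
  also have "\<dots> = (\<Sum>v\<in>verts G. \<Sum>b\<in>out_darts G v. (cmod (2 / card (out_darts G v) * (\<Sum>b'\<in>out_darts G v. y (reverse b')) - y (reverse b)))\<^sup>2)"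
    unfolding sum_darts_by_origin by (intro sum.cong refl) (simp add: out_darts_def)
  also have "\<dots> = (\<Sum>v\<in>verts G. \<Sum>b\<in>out_darts G v. (cmod (y (reverse b)))\<^sup>2)"
    by (intro sum.cong refl mean_reflection_isometry finite_out_darts)
  also have "\<dots> = (\<Sum>b\<in>darts G. (cmod (y (reverse b)))\<^sup>2)"
    by (rule sum_darts_by_origin[symmetric])
  also have "\<dots> = (\<Sum>b\<in>darts G. (cmod (x b))\<^sup>2)"
    using sum.reindex_bij_betw[OF bij_reverse, of "\<lambda>b. (cmod (y b))\<^sup>2"] by (simp add: y)
  finally show "(\<Sum>b\<in>darts G. (cmod (\<Sum>c\<in>darts G. bond_matrix G L \<alpha> b c * x c))\<^sup>2) = (\<Sum>c\<in>darts G. (cmod (x c))\<^sup>2)" .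
qed

end

locale quantum_graph_form = quantum_graph G L for G :: "('v, 'e) pre_digraph" and L :: "'e \<Rightarrow> real" +
  fixes \<alpha> :: "'e \<Rightarrow> real \<Rightarrow> real"
  assumes form: "\<alpha> \<in> one_forms G L"
begin

sublocale bonds: scattering "darts G" "bond_matrix G L \<alpha>" "\<lambda>b. L (fst b)"
  by (rule scattering_bonds)

lemma smooth: "e \<in> arcs G \<Longrightarrow> smooth_upto (L e) (\<alpha> e)"
  using form by (simp add: one_forms_def)

lemma kirchhoff_form: "v \<in> verts G \<Longrightarrow> (\<Sum>e\<in>in_arcs G v. \<alpha> e (L e)) - (\<Sum>e\<in>out_arcs G v. \<alpha> e 0) = 0"
  using form by (simp add: one_forms_def kirchhoff_def)

definition transit :: "complex \<Rightarrow> 'e \<times> bool \<Rightarrow> complex" where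
  "transit k c = exp (- (2 * pi * \<i> * dart_flux L \<alpha> c)) * exp (\<i> * k * L (fst c))"

definition returning :: "complex \<Rightarrow> ('e \<times> bool \<Rightarrow> complex) \<Rightarrow> 'e \<times> bool \<Rightarrow> complex" where
  "returning k x b = transit k (reverse b) * x (reverse b)"

definition vertex_value :: "complex \<Rightarrow> ('e \<times> bool \<Rightarrow> complex) \<Rightarrow> 'v \<Rightarrow> complex" where
  "vertex_value k x v = 2 / card (out_darts G v) * (\<Sum>b\<in>out_darts G v. returning k x b)"

text \<open>
  The value of the wave at the origin of \<open>b\<close> is the sum of the leaving wave \<open>x b\<close> and the wave that
  arrives along the same edge. An amplitude vector is stationary if at each vertex the values at
  all edge ends coincide and the leaving and arriving waves have equal sums.
\<close>

lemma stationary_iff: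
  "x \<in> bonds.stationary k \<longleftrightarrow>
    (\<forall>b. b \<notin> darts G \<longrightarrow> x b = 0) \<and> (\<forall>b\<in>darts G. x b + returning k x b = vertex_value k x (origin G b))"
proof -
  have ev: "bonds.evolve k x b = (if b \<in> darts G then vertex_value k x (origin G b) - returning k x b else 0)" for b
  proof (cases "b \<in> darts G")
    case True
    have "bonds.evolve k x b = (\<Sum>c\<in>darts G. of_real (vertex_scattering G b c) * (transit k c * x c))"
      using True by (simp add: bonds.evolve_def bond_matrix_def transit_def mult.assoc)
    also have "\<dots> = vertex_value k x (origin G b) - returning k x b"
      by (simp only: vertex_scattering_apply[OF True] vertex_value_def returning_def)
    finally show ?thesis using True by simp
  qed (simp add: bonds.evolve_def)
  have "x \<in> bonds.stationary k \<longleftrightarrow>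
      (\<forall>b. (if b \<in> darts G then vertex_value k x (origin G b) - returning k x b else 0) = x b)"
    unfolding bonds.stationary_def mem_Collect_eq fun_eq_iff ev ..
  moreover have "(if b \<in> darts G then vertex_value k x (origin G b) - returning k x b else 0) = x b \<longleftrightarrow>
      (b \<notin> darts G \<longrightarrow> x b = 0) \<and> (b \<in> darts G \<longrightarrow> x b + returning k x b = vertex_value k x (origin G b))" for b
    by (cases "b \<in> darts G") (auto simp only: diff_eq_eq if_True if_False simp_thms)
  ultimately show ?thesis by (simp only:) blast
qed

definition wave_function :: "complex \<Rightarrow> ('e \<times> bool \<Rightarrow> complex) \<Rightarrow> ('v, 'e) point \<Rightarrow> complex" where
  "wave_function k x p = (case p of
     Vertex v \<Rightarrow> if v \<in> verts G then vertex_value k x v else 0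
   | At e s \<Rightarrow> if e \<in> arcs G \<and> s \<in> {0..L e} then edge_wave (L e) (\<alpha> e) k (x (e, True)) (x (e, False)) s else 0)"

lemma linear_wave_function:
  "Vector_Spaces.linear (\<lambda>c f p. c * f p) (\<lambda>c f p. c * f p) (wave_function k)"
proof unfold_locales
  fix x y :: "'e \<times> bool \<Rightarrow> complex" and c
  show "wave_function k (x + y) = wave_function k x + wave_function k y"
    by (auto simp: fun_eq_iff wave_function_def edge_wave_add vertex_value_def returning_def
        algebra_simps sum.distrib split: point.split)
  show "wave_function k (\<lambda>p. c * x p) = (\<lambda>p. c * wave_function k x p)"
    by (auto simp: fun_eq_iff wave_function_def edge_wave_scale vertex_value_def returning_def
        sum_distrib_left mult_ac split: point.split)
qed

lemma edge_phase_flux: "edge_phase (\<alpha> e) (L e) = 2 * pi * dart_flux L \<alpha> (e, True)"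
  by (simp add: edge_phase_def dart_flux_def)

lemma edge_wave_ends:
  shows "edge_wave (L e) (\<alpha> e) k (x (e, True)) (x (e, False)) 0 = x (e, True) + returning k x (e, True)"
    and "edge_wave (L e) (\<alpha> e) k (x (e, True)) (- x (e, False)) 0 = x (e, True) - returning k x (e, True)"
    and "edge_wave (L e) (\<alpha> e) k (x (e, True)) (x (e, False)) (L e) = x (e, False) + returning k x (e, False)"
    and "edge_wave (L e) (\<alpha> e) k (x (e, True)) (- x (e, False)) (L e) = - (x (e, False) - returning k x (e, False))"
  by (simp_all add: edge_wave_0 edge_wave_end returning_def transit_def reverse_def edge_phase_flux
      dart_flux_def mult_ac)

text \<open>Since \<open>\<alpha>\<close> satisfies the Kirchhoff condition, so does \<open>d f\<close> if and only if \<open>d\<^sub>\<alpha> f\<close> does.\<close>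

lemma kirchhoff_covariant:
  fixes u W :: "'e \<Rightarrow> real \<Rightarrow> complex"
  assumes v: "v \<in> verts G"
    and inn: "\<And>e. e \<in> in_arcs G v \<Longrightarrow> u e (L e) = \<phi>" and out: "\<And>e. e \<in> out_arcs G v \<Longrightarrow> u e 0 = \<phi>"
  shows "(\<Sum>e\<in>in_arcs G v. W e (L e) - 2 * pi * \<i> * \<alpha> e (L e) * u e (L e)) -
      (\<Sum>e\<in>out_arcs G v. W e 0 - 2 * pi * \<i> * \<alpha> e 0 * u e 0) =
    (\<Sum>e\<in>in_arcs G v. W e (L e)) - (\<Sum>e\<in>out_arcs G v. W e 0)"
proof -
  have "(\<Sum>e\<in>in_arcs G v. W e (L e) - 2 * pi * \<i> * \<alpha> e (L e) * u e (L e)) =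
      (\<Sum>e\<in>in_arcs G v. W e (L e)) - 2 * pi * \<i> * of_real (\<Sum>e\<in>in_arcs G v. \<alpha> e (L e)) * \<phi>"
    by (simp add: inn sum_subtractf sum_distrib_left sum_distrib_right)
  moreover have "(\<Sum>e\<in>out_arcs G v. W e 0 - 2 * pi * \<i> * \<alpha> e 0 * u e 0) =
      (\<Sum>e\<in>out_arcs G v. W e 0) - 2 * pi * \<i> * of_real (\<Sum>e\<in>out_arcs G v. \<alpha> e 0) * \<phi>"
    by (simp add: out sum_subtractf sum_distrib_left sum_distrib_right)
  moreover have "(\<Sum>e\<in>in_arcs G v. \<alpha> e (L e)) = (\<Sum>e\<in>out_arcs G v. \<alpha> e 0)"
    using kirchhoff_form[OF v] by simp
  ultimately show ?thesis by simp
qed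


lemma sum_normal_derivatives:
  fixes W :: "'e \<Rightarrow> real \<Rightarrow> complex"
  assumes "\<And>e. e \<in> arcs G \<Longrightarrow> W e 0 = c * (x (e, True) - returning k x (e, True))"
    and "\<And>e. e \<in> arcs G \<Longrightarrow> W e (L e) = - c * (x (e, False) - returning k x (e, False))"
  shows "(\<Sum>e\<in>in_arcs G v. W e (L e)) - (\<Sum>e\<in>out_arcs G v. W e 0) =
    - c * (\<Sum>b\<in>out_darts G v. x b - returning k x b)"
  by (simp add: sum_out_darts assms sum_distrib_left distrib_left sum_negf)

lemma wave_function_eigenfunction:
  assumes x: "x \<in> bonds.stationary k" and k: "k \<noteq> 0"
  shows "wave_function k x \<in> eigenspace G L \<alpha> (k\<^sup>2)"
proof -
  define f where "f = wave_function k x"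
  define w where "w e = edge_wave (L e) (\<alpha> e) k (x (e, True)) (x (e, False))" for e
  define W where "W e s = \<i> * k * edge_wave (L e) (\<alpha> e) k (x (e, True)) (- x (e, False)) s" for e s
  have st: "x b + returning k x b = vertex_value k x (origin G b)" if "b \<in> darts G" for b
    using x that by (simp add: stationary_iff)
  have fe: "edgewise f e s = w e s" if "e \<in> arcs G" "s \<in> {0..L e}" for e s
    using that by (simp add: edgewise_def f_def wave_function_def w_def)
  have sys: "edge_system (L e) (\<alpha> e) (k\<^sup>2) (edgewise f e) (W e)" if e: "e \<in> arcs G" for e
  proof -
    have ww: "edge_system (L e) (\<alpha> e) (k\<^sup>2) (w e) (W e)"
      unfolding w_def W_def[abs_def] by (rule edge_system_edge_wave[OF smooth[OF e]])
    show ?thesis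
      unfolding edge_system_def
    proof (intro ballI conjI)
      fix s assume s: "s \<in> {0..L e}"
      have "(w e has_vector_derivative W e s - 2 * pi * \<i> * \<alpha> e s * w e s) (at s within {0..L e})"
        using ww s by (simp add: edge_system_def)
      then show "(edgewise f e has_vector_derivative W e s - 2 * pi * \<i> * \<alpha> e s * edgewise f e s) (at s within {0..L e})"
        unfolding fe[OF e s]
        by (intro has_vector_derivative_transform[where f = "w e" and g = "edgewise f e", OF s fe[OF e]])
      show "(W e has_vector_derivative - k\<^sup>2 * edgewise f e s - 2 * pi * \<i> * \<alpha> e s * W e s) (at s within {0..L e})"
        unfolding fe[OF e s] using ww s by (simp add: edge_system_def)
    qed
  qed
  have eig: "sobolev2 (L e) (edgewise f e)"
    "\<And>s. s \<in> {0..L e} \<Longrightarrow> - cov_deriv L \<alpha> (cov_deriv L \<alpha> (edgewise f)) e s - k\<^sup>2 * edgewise f e s = 0"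
    if e: "e \<in> arcs G" for e
    using eigenfunction_of_edge_system(1,3)[where L = L and e = e and \<alpha> = \<alpha> and u = "edgewise f",
        OF length_pos[OF e] smooth[OF e] sys[OF e]] by blast+
  have ends: "f (At e 0) = vertex_value k x (tail G e)" "f (At e (L e)) = vertex_value k x (head G e)" if e: "e \<in> arcs G" for e
    using st[of "(e, True)"] st[of "(e, False)"] e length_pos[OF e]
    by (simp_all add: f_def wave_function_def edge_wave_ends darts_def origin_def)
  have cont: "f \<in> continuous_functions G L"
    unfolding continuous_functions_def
  proof (intro CollectI conjI allI ballI impI)
    fix p assume "p \<notin> points G L"
    then show "f p = 0" by (cases p) (auto simp: points_def f_def wave_function_def)
  next
    fix e assume e: "e \<in> arcs G"
    show "continuous_on {0..L e} (edgewise f e)"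
      using sys[OF e] has_vector_derivative_continuous
      unfolding edge_system_def continuous_on_eq_continuous_within by blast
    show "f (At e 0) = f (Vertex (tail G e))" "f (At e (L e)) = f (Vertex (head G e))"
      using ends[OF e] e by (simp_all add: f_def wave_function_def)
  qed
  have kirch: "kirchhoff G L (edge_deriv L (edgewise f))"
    unfolding kirchhoff_def
  proof
    fix v assume v: "v \<in> verts G"
    have deriv: "edge_deriv L (edgewise f) e s = W e s - 2 * pi * \<i> * \<alpha> e s * edgewise f e s"
      if "e \<in> arcs G" "s \<in> {0..L e}" for e s
    proof (rule edge_deriv_eq)
      show "(edgewise f e has_vector_derivative W e s - 2 * pi * \<i> * \<alpha> e s * edgewise f e s) (at s within {0..L e})"
        using sys[OF that(1)] that(2) unfolding edge_system_def by blast
    qed (use that length_pos in blast)+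
    have ivl: "0 \<in> {0..L e}" "L e \<in> {0..L e}" if "e \<in> arcs G" for e
      using length_pos[OF that] by auto
    have "(\<Sum>e\<in>in_arcs G v. edge_deriv L (edgewise f) e (L e)) - (\<Sum>e\<in>out_arcs G v. edge_deriv L (edgewise f) e 0) =
        (\<Sum>e\<in>in_arcs G v. W e (L e) - 2 * pi * \<i> * \<alpha> e (L e) * edgewise f e (L e)) -
        (\<Sum>e\<in>out_arcs G v. W e 0 - 2 * pi * \<i> * \<alpha> e 0 * edgewise f e 0)"
      using ivl by (intro arg_cong2[where f = "(-)"] sum.cong refl deriv) auto
    also have "\<dots> = (\<Sum>e\<in>in_arcs G v. W e (L e)) - (\<Sum>e\<in>out_arcs G v. W e 0)"
      by (rule kirchhoff_covariant[OF v, where \<phi> = "vertex_value k x v"]) (auto simp: edgewise_def ends)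
    also have "\<dots> = - (\<i> * k) * (\<Sum>b\<in>out_darts G v. x b - returning k x b)"
      by (rule sum_normal_derivatives) (simp_all add: W_def edge_wave_ends right_diff_distrib)
    also have "(\<Sum>b\<in>out_darts G v. x b - returning k x b) = (\<Sum>b\<in>out_darts G v. vertex_value k x v - 2 * returning k x b)"
    proof (intro sum.cong refl)
      fix b assume b: "b \<in> out_darts G v"
      have "vertex_value k x v = x b + returning k x b"
        using st[of b] b by (simp add: out_darts_def)
      then show "x b - returning k x b = vertex_value k x v - 2 * returning k x b" by simp
    qed
    also have "\<dots> = 0"
      using finite_out_darts[of v] by (cases "out_darts G v = {}")
        (simp_all add: sum_subtractf vertex_value_def card_gt_0_iff flip: sum_distrib_left)
    finally show "(\<Sum>e\<in>in_arcs G v. edge_deriv L (edgewise f) e (L e)) - (\<Sum>e\<in>out_arcs G v. edge_deriv L (edgewise f) e 0) = 0"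
      by simp
  qed
  have iso: "f (Vertex v) = 0" if "v \<in> isolated_verts G" for v
  proof -
    have "out_darts G v = {}"
      using that by (auto simp: isolated_verts_def out_darts_def origin_def darts_def in_arcs_def out_arcs_def split: if_splits)
    then show ?thesis by (simp add: f_def wave_function_def vertex_value_def)
  qed
  show ?thesis
    unfolding eigenspace_def laplace_domain_def L2_eq_def f_def[symmetric]
  proof (intro CollectI conjI ballI)
    show "f \<in> continuous_functions G L" by (fact cont)
    show "kirchhoff G L (edge_deriv L (edgewise f))" by (fact kirch)
    show "sobolev2 (L e) (edgewise f e)" if "e \<in> arcs G" for e
      by (rule eig(1)[OF that])
    show "AE s in lebesgue_on {0..L e}. edgewise (shifted_laplacian L \<alpha> (k\<^sup>2) f) e s = edgewise (\<lambda>p :: ('v, 'e) point. 0) e s"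
      if e: "e \<in> arcs G" for e
    proof (rule AE_I2)
      fix s assume "s \<in> space (lebesgue_on {0..L e})"
      then have s: "s \<in> {0..L e}" by simp
      have "- cov_deriv L \<alpha> (cov_deriv L \<alpha> (edgewise f)) e s - k\<^sup>2 * edgewise f e s = 0"
        by (rule eig(2)[OF e s])
      then show "edgewise (shifted_laplacian L \<alpha> (k\<^sup>2) f) e s = edgewise (\<lambda>p :: ('v, 'e) point. 0) e s"
        by (simp add: shifted_laplacian_def laplacian_def edgewise_def)
    qed
    show "shifted_laplacian L \<alpha> (k\<^sup>2) f (Vertex v) = 0" if "v \<in> isolated_verts G" for v
      using iso[OF that] by (simp add: shifted_laplacian_def laplacian_def)
  qed
qed

text \<open>
  The amplitudes at the two ends of each edge are read off from the solution of the first-order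
  system. Continuity makes the values at a vertex agree, and the Kirchhoff condition identifies
  their common value with \<open>vertex_value\<close>.
\<close>

lemma eigenfunction_is_wave_function:
  assumes f: "f \<in> eigenspace G L \<alpha> (k\<^sup>2)" and k: "k \<noteq> 0"
  shows "f \<in> wave_function k ` bonds.stationary k"
proof -
  have dom: "f \<in> laplace_domain G L" and l2: "L2_eq G L (shifted_laplacian L \<alpha> (k\<^sup>2) f) (\<lambda>p. 0)"
    using f by (simp_all add: eigenspace_def)
  have cont: "\<And>p. p \<notin> points G L \<Longrightarrow> f p = 0"
    "\<And>e. e \<in> arcs G \<Longrightarrow> f (At e 0) = f (Vertex (tail G e))"
    "\<And>e. e \<in> arcs G \<Longrightarrow> f (At e (L e)) = f (Vertex (head G e))"
    and sob: "\<And>e. e \<in> arcs G \<Longrightarrow> sobolev2 (L e) (edgewise f e)"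
    and kirch: "kirchhoff G L (edge_deriv L (edgewise f))"
    using dom unfolding laplace_domain_def continuous_functions_def by blast+
  have ae: "AE s in lebesgue_on {0..L e}. - cov_deriv L \<alpha> (cov_deriv L \<alpha> (edgewise f)) e s - k\<^sup>2 * edgewise f e s = 0"
    if "e \<in> arcs G" for e
  proof -
    show ?thesis
      using bspec[OF conjunct1[OF l2[unfolded L2_eq_def]] that]
      by (simp add: shifted_laplacian_def laplacian_def edgewise_def)
  qed
  have iso: "k\<^sup>2 * f (Vertex v) = 0" if "v \<in> isolated_verts G" for v
  proof -
    have "shifted_laplacian L \<alpha> (k\<^sup>2) f (Vertex v) = 0"
      by (rule bspec[OF conjunct2[OF l2[unfolded L2_eq_def]] that])
    then show ?thesis by (simp add: shifted_laplacian_def laplacian_def)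
  qed
  define W where "W = cov_deriv L \<alpha> (edgewise f)"
  have sys: "edge_system (L e) (\<alpha> e) (k\<^sup>2) (edgewise f e) (W e)" if "e \<in> arcs G" for e
    unfolding W_def using that by (intro edge_system_of_eigenfunction length_pos smooth sob ae)
  have "\<forall>e\<in>arcs G. \<exists>r. \<forall>s\<in>{0..L e}. edgewise f e s = edge_wave (L e) (\<alpha> e) k (fst r) (snd r) s \<and>
      W e s = \<i> * k * edge_wave (L e) (\<alpha> e) k (fst r) (- snd r) s"
  proof
    fix e assume e: "e \<in> arcs G"
    obtain p q where "\<And>s. s \<in> {0..L e} \<Longrightarrow> edgewise f e s = edge_wave (L e) (\<alpha> e) k p q s"
      "\<And>s. s \<in> {0..L e} \<Longrightarrow> W e s = \<i> * k * edge_wave (L e) (\<alpha> e) k p (- q) s"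
      using edge_system_solution[OF sys[OF e] smooth[OF e] k] by blast
    then show "\<exists>r. \<forall>s\<in>{0..L e}. edgewise f e s = edge_wave (L e) (\<alpha> e) k (fst r) (snd r) s \<and>
        W e s = \<i> * k * edge_wave (L e) (\<alpha> e) k (fst r) (- snd r) s"
      by (intro exI[of _ "(p, q)"]) simp
  qed
  from bchoice[OF this] obtain r where r: "\<forall>e\<in>arcs G. \<forall>s\<in>{0..L e}.
      edgewise f e s = edge_wave (L e) (\<alpha> e) k (fst (r e)) (snd (r e)) s \<and>
      W e s = \<i> * k * edge_wave (L e) (\<alpha> e) k (fst (r e)) (- snd (r e)) s"
    by blast
  define p where "p e = fst (r e)" for e
  define q where "q e = snd (r e)" for e
  have pq: "edgewise f e s = edge_wave (L e) (\<alpha> e) k (p e) (q e) s"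
    "W e s = \<i> * k * edge_wave (L e) (\<alpha> e) k (p e) (- q e) s" if "e \<in> arcs G" "s \<in> {0..L e}" for e s
    using r that unfolding p_def q_def by blast+
  define x where "x b = (if b \<in> darts G then if snd b then p (fst b) else q (fst b) else 0)" for b
  have x: "x (e, True) = p e" "x (e, False) = q e" if "e \<in> arcs G" for e
    using that by (simp_all add: x_def darts_def)
  have ends: "0 \<in> {0..L e}" "L e \<in> {0..L e}" if "e \<in> arcs G" for e
    using length_pos[OF that] by auto
  have val: "x b + returning k x b = f (Vertex (origin G b))" if b: "b \<in> darts G" for b
  proof -
    obtain e s where es: "b = (e, s)" "e \<in> arcs G" using b by (auto simp: darts_def)
    show ?thesis
      using pq(1)[OF es(2) ends(1)[OF es(2)]] pq(1)[OF es(2) ends(2)[OF es(2)]] cont(2,3)[OF es(2)]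
        edge_wave_ends(1,3)[of e k x] es
      by (cases s) (simp_all add: x origin_def edgewise_def)
  qed
  have deriv: "edge_deriv L (edgewise f) e s = W e s - 2 * pi * \<i> * \<alpha> e s * edgewise f e s"
    if "e \<in> arcs G" "s \<in> {0..L e}" for e s
    by (simp add: W_def cov_deriv_def)
  have balance: "(\<Sum>b\<in>out_darts G v. x b - returning k x b) = 0" if v: "v \<in> verts G" for v
  proof -
    have "0 = (\<Sum>e\<in>in_arcs G v. edge_deriv L (edgewise f) e (L e)) - (\<Sum>e\<in>out_arcs G v. edge_deriv L (edgewise f) e 0)"
      using kirch v by (simp add: kirchhoff_def)
    also have "\<dots> = (\<Sum>e\<in>in_arcs G v. W e (L e) - 2 * pi * \<i> * \<alpha> e (L e) * edgewise f e (L e)) -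
        (\<Sum>e\<in>out_arcs G v. W e 0 - 2 * pi * \<i> * \<alpha> e 0 * edgewise f e 0)"
      using ends by (intro arg_cong2[where f = "(-)"] sum.cong refl deriv) auto
    also have "\<dots> = (\<Sum>e\<in>in_arcs G v. W e (L e)) - (\<Sum>e\<in>out_arcs G v. W e 0)"
      by (rule kirchhoff_covariant[OF v, where \<phi> = "f (Vertex v)"]) (simp_all add: edgewise_def cont(2,3))
    also have "\<dots> = - (\<i> * k) * (\<Sum>b\<in>out_darts G v. x b - returning k x b)"
    proof (rule sum_normal_derivatives)
      fix e assume e: "e \<in> arcs G"
      show "W e 0 = \<i> * k * (x (e, True) - returning k x (e, True))"
        using edge_wave_ends(2)[of e k x] by (simp add: pq(2)[OF e ends(1)[OF e]] x[OF e])
      show "W e (L e) = - (\<i> * k) * (x (e, False) - returning k x (e, False))"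
        using edge_wave_ends(4)[of e k x] by (simp add: pq(2)[OF e ends(2)[OF e]] x[OF e] right_diff_distrib)
    qed
    finally show ?thesis using k by simp
  qed
  have vertex: "vertex_value k x v = f (Vertex v)" if v: "v \<in> verts G" "out_darts G v \<noteq> {}" for v
  proof -
    have "(\<Sum>b\<in>out_darts G v. f (Vertex v)) = (\<Sum>b\<in>out_darts G v. (x b - returning k x b) + 2 * returning k x b)"
    proof (intro sum.cong refl)
      fix b assume "b \<in> out_darts G v"
      then have "b \<in> darts G" "origin G b = v" by (simp_all add: out_darts_def)
      then have "f (Vertex v) = x b + returning k x b" using val[of b] by simp
      then show "f (Vertex v) = (x b - returning k x b) + 2 * returning k x b" by simp
    qed
    also have "\<dots> = 2 * (\<Sum>b\<in>out_darts G v. returning k x b)"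
      by (simp only: sum.distrib balance[OF v(1)] sum_distrib_left) simp
    finally have "of_nat (card (out_darts G v)) * f (Vertex v) = 2 * (\<Sum>b\<in>out_darts G v. returning k x b)"
      by simp
    moreover have "card (out_darts G v) \<noteq> 0" using v(2) finite_out_darts[of v] by simp
    ultimately show ?thesis by (simp add: vertex_value_def field_simps)
  qed
  have st: "x \<in> bonds.stationary k"
    unfolding stationary_iff
  proof (intro conjI allI ballI impI)
    fix b assume b: "b \<in> darts G"
    then have "b \<in> out_darts G (origin G b)" by (simp add: out_darts_def)
    then have "out_darts G (origin G b) \<noteq> {}" by blast
    moreover have "origin G b \<in> verts G"
      using b by (cases b) (simp add: origin_def darts_def)
    ultimately show "x b + returning k x b = vertex_value k x (origin G b)"
      using val[OF b] vertex by simp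
  qed (simp add: x_def)
  have fw: "f = wave_function k x"
  proof
    fix r
    show "f r = wave_function k x r"
    proof (cases r)
      case (At e s)
      show ?thesis
      proof (cases "e \<in> arcs G \<and> s \<in> {0..L e}")
        case True
        then show ?thesis using At pq(1)[of e s] x[of e] by (simp add: wave_function_def edgewise_def)
      next
        case False
        then have "r \<notin> points G L" using At by (auto simp: points_def)
        then show ?thesis using cont(1)[of r] At False by (auto simp: wave_function_def)
      qed
    next
      case (Vertex v)
      consider "v \<notin> verts G" | "v \<in> verts G" "out_darts G v \<noteq> {}" | "v \<in> verts G" "out_darts G v = {}"
        by blast
      then show ?thesis
      proof cases
        case 1
        then have "r \<notin> points G L" using Vertex by (auto simp: points_def)
        then show ?thesis using cont(1)[of r] Vertex 1 by (simp add: wave_function_def)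
      next
        case 2
        then show ?thesis using Vertex vertex by (simp add: wave_function_def)
      next
        \<comment> \<open>At an isolated vertex the Laplacian is \<open>0\<close>, so \<open>k\<^sup>2 f v = 0\<close>.\<close>
        case 3
        have "v \<in> isolated_verts G"
        proof -
          have "(e, True) \<in> out_darts G v" if "e \<in> out_arcs G v" for e
            using that by (simp add: out_darts_def darts_def origin_def)
          moreover have "(e, False) \<in> out_darts G v" if "e \<in> in_arcs G v" for e
            using that by (simp add: out_darts_def darts_def origin_def)
          ultimately show ?thesis using 3 unfolding isolated_verts_def by blast
        qed
        then show ?thesis using iso[of v] k Vertex 3 by (simp add: wave_function_def vertex_value_def)
      qed
    qed
  qed
  show ?thesis unfolding fw by (rule imageI[OF st])
qed

text \<open>
  For \<open>k \<noteq> 0\<close> the eigenfunctions for \<open>k\<^sup>2\<close> are the superpositions of waves on the edges whose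
  amplitudes are stationary under the scattering at the vertices.
\<close>

theorem dim_eigenspace:
  assumes k: "k \<noteq> 0"
  shows "fs.dim (eigenspace G L \<alpha> (k\<^sup>2)) = fs.dim (bonds.stationary k)"
proof -
  have "eigenspace G L \<alpha> (k\<^sup>2) = wave_function k ` bonds.stationary k"
    using wave_function_eigenfunction[OF _ k] eigenfunction_is_wave_function[OF _ k] by blast
  moreover have "inj_on (wave_function k) (bonds.stationary k)"
  proof (rule inj_onI)
    fix x y assume x: "x \<in> bonds.stationary k" and y: "y \<in> bonds.stationary k"
      and eq: "wave_function k x = wave_function k y"
    have "x b = y b" for b
    proof (cases "b \<in> darts G")
      case True
      obtain e s where es: "b = (e, s)" "e \<in> arcs G" using True by (auto simp: darts_def)
      have "edge_wave (L e) (\<alpha> e) k (x (e, True) - y (e, True)) (x (e, False) - y (e, False)) r = 0" if "r \<in> {0..L e}" for r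
      proof -
        define Y where "Y = edge_wave (L e) (\<alpha> e) k (y (e, True)) (y (e, False)) r"
        have "edge_wave (L e) (\<alpha> e) k (x (e, True)) (x (e, False)) r = Y"
          using fun_cong[OF eq, of "At e r"] that es(2) by (simp add: wave_function_def Y_def)
        moreover have "edge_wave (L e) (\<alpha> e) k (x (e, True)) (x (e, False)) r =
            edge_wave (L e) (\<alpha> e) k (x (e, True) - y (e, True)) (x (e, False) - y (e, False)) r + Y"
          unfolding Y_def edge_wave_add[symmetric] by simp
        ultimately show ?thesis by simp
      qed
      from edge_wave_eq_0[OF length_pos[OF es(2)] k smooth[OF es(2)] this]
      show ?thesis using es by (cases s) simp_all
    next
      case False
      then have "x b = 0" "y b = 0"
        using bonds.supported_stationary[OF x] bonds.supported_stationary[OF y]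
        unfolding bonds.supported_def by blast+
      then show ?thesis by simp
    qed
    then show "x = y" by blast
  qed
  ultimately show ?thesis
    using dim_linear_inj_image[OF linear_wave_function bonds.subspace_stationary] by simp
qed

end


lemma scale_form_in_one_forms:
  assumes "\<alpha> \<in> one_forms G L"
  shows "scale_form t \<alpha> \<in> one_forms G L"
proof -
  have smooth: "smooth_upto l (\<lambda>x. t * f x)" if f: "smooth_upto l f" for l and f :: "real \<Rightarrow> real"
  proof -
    obtain D where "\<forall>x\<in>{0..l}. D 0 x = f x"
      "\<forall>n. \<forall>x\<in>{0..l}. (D n has_vector_derivative D (Suc n) x) (at x within {0..l})"
      using f unfolding smooth_upto_def by blast
    then show ?thesis
      unfolding smooth_upto_def
      by (intro exI[of _ "\<lambda>n x. t * D n x"]) (auto intro: has_vector_derivative_mult_right)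
  qed
  show ?thesis
    using assms smooth unfolding one_forms_def scale_form_def kirchhoff_def
    by (auto simp flip: sum_distrib_left)
qed

lemma dart_flux_scale_form: "dart_flux L (scale_form t \<alpha>) b = t * dart_flux L \<alpha> b"
  by (simp add: dart_flux_def scale_form_def)

section \<open>Eigenvalue multiplicities\<close>

context quantum_graph
begin

lemma zero_eigenfunction: "(\<lambda>p. 0) \<in> eigenspace G L \<alpha> z"
proof -
  have ew: "edgewise (\<lambda>p :: ('v, 'e) point. 0 :: complex) = (\<lambda>e s. 0)"
    by (simp add: edgewise_def fun_eq_iff)
  have ed: "edge_deriv L (\<lambda>e s. 0 :: complex) e s = 0" if "e \<in> arcs G" "s \<in> {0..L e}" for e s
    by (rule edge_deriv_eq) (use that length_pos in auto)
  have kirch: "kirchhoff G L (edge_deriv L (\<lambda>e s. 0 :: complex))"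
    unfolding kirchhoff_def using length_pos by (auto simp: ed less_imp_le)
  have sob: "sobolev2 (L e) (\<lambda>s. 0)" for e
    unfolding sobolev2_def by (rule exI[of _ "\<lambda>s. 0"], rule exI[of _ "\<lambda>s. 0"]) simp
  have cov: "cov_deriv L \<alpha> (\<lambda>e s. 0) e s = 0" if "e \<in> arcs G" "s \<in> {0..L e}" for e s
    using ed[OF that] by (simp add: cov_deriv_def)
  have cov2: "cov_deriv L \<alpha> (cov_deriv L \<alpha> (\<lambda>e s. 0)) e s = 0" if es: "e \<in> arcs G" "s \<in> {0..L e}" for e s
  proof -
    have "(cov_deriv L \<alpha> (\<lambda>e s. 0) e has_vector_derivative 0) (at s within {0..L e})"
      by (rule has_vector_derivative_transform[OF es(2) cov[OF es(1)] has_vector_derivative_const])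
    then have "edge_deriv L (cov_deriv L \<alpha> (\<lambda>e s. 0)) e s = 0"
      by (rule edge_deriv_eq) (use es length_pos in auto)
    then show ?thesis using cov[OF es] by (simp add: cov_deriv_def[of L \<alpha> "cov_deriv L \<alpha> (\<lambda>e s. 0)"])
  qed
  have "AE s in lebesgue_on {0..L e}. edgewise (shifted_laplacian L \<alpha> z (\<lambda>p :: ('v, 'e) point. 0)) e s = edgewise (\<lambda>p :: ('v, 'e) point. 0) e s"
    if "e \<in> arcs G" for e
    by (rule AE_I2) (use cov2[OF that] in \<open>simp add: edgewise_def[of "shifted_laplacian L \<alpha> z (\<lambda>p. 0)"] shifted_laplacian_def laplacian_def ew\<close>)
  then show ?thesis
    unfolding eigenspace_def laplace_domain_def continuous_functions_def L2_eq_def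
    using kirch sob by (simp add: shifted_laplacian_def laplacian_def ew)
qed

lemma eigenvalue_in_spectrum:
  assumes f: "f \<in> eigenspace G L \<alpha> z" and "f \<noteq> (\<lambda>p. 0)"
  shows "z \<notin> laplace_resolvent_set G L \<alpha>"
proof
  assume z: "z \<in> laplace_resolvent_set G L \<alpha>"
  have "(\<lambda>p. 0) \<in> L2_functions G L"
    by (simp add: L2_functions_def edgewise_def[abs_def])
  then have ex1: "\<exists>!f. f \<in> laplace_domain G L \<and> L2_eq G L (shifted_laplacian L \<alpha> z f) (\<lambda>p. 0)"
    using z unfolding laplace_resolvent_set_def by blast
  have "f \<in> laplace_domain G L \<and> L2_eq G L (shifted_laplacian L \<alpha> z f) (\<lambda>p. 0)"
    "(\<lambda>p. 0) \<in> laplace_domain G L \<and> L2_eq G L (shifted_laplacian L \<alpha> z (\<lambda>p. 0)) (\<lambda>p. 0)"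
    using f zero_eigenfunction by (simp_all add: eigenspace_def)
  with ex1 have "f = (\<lambda>p. 0)" by blast
  with assms(2) show False by contradiction
qed

lemma dim_eigenspace_resolvent:
  assumes "z \<in> laplace_resolvent_set G L \<alpha>"
  shows "fs.dim (eigenspace G L \<alpha> z) = 0"
proof -
  have "eigenspace G L \<alpha> z = {0}"
    using eigenvalue_in_spectrum assms zero_eigenfunction unfolding zero_fun_def by blast
  moreover have "fs.dim {0 :: ('v, 'e) point \<Rightarrow> complex} = card ({} :: (('v, 'e) point \<Rightarrow> complex) set)"
    by (rule fs.dim_eq_card) (simp_all add: fs.independent_empty fs.span_insert_0)
  ultimately show ?thesis by simp
qed

end

text \<open>
  A point outside the spectrum has the trivial eigenspace, so the multiplicities agree also
  at the points that \<open>Spec\<close> does not list.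
\<close>

lemma Spec_eq_imp_dim_eq:
  assumes "quantum_graph G L" "quantum_graph G' L'" and Spec: "Spec G L \<alpha> = Spec G' L' \<alpha>'"
  shows "fs.dim (eigenspace G L \<alpha> z) = fs.dim (eigenspace G' L' \<alpha>' z)"
proof -
  have iff: "z \<in> laplace_resolvent_set G L \<alpha> \<longleftrightarrow> z \<in> laplace_resolvent_set G' L' \<alpha>'"
  proof -
    have "(\<exists>m. (z, m) \<in> Spec G L \<alpha>) \<longleftrightarrow> (\<exists>m. (z, m) \<in> Spec G' L' \<alpha>')" using Spec by simp
    then show ?thesis by (simp add: Spec_def)
  qed
  show ?thesis
  proof (cases "z \<in> laplace_resolvent_set G L \<alpha>")
    case True
    then show ?thesis
      using iff quantum_graph.dim_eigenspace_resolvent[OF assms(1)] quantum_graph.dim_eigenspace_resolvent[OF assms(2)]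
      by simp
  next
    case False
    then have "(z, fs.dim (eigenspace G L \<alpha> z)) \<in> Spec G L \<alpha>" by (simp add: Spec_def)
    then have "(z, fs.dim (eigenspace G L \<alpha> z)) \<in> Spec G' L' \<alpha>'" using Spec by simp
    then show ?thesis by (simp add: Spec_def)
  qed
qed

section \<open>Orbit sums\<close>

definition orbit_coefficient :: "('v, 'e) pre_digraph \<Rightarrow> ('e \<Rightarrow> real) \<Rightarrow> ('e \<times> bool) list \<Rightarrow> complex" where
  "orbit_coefficient G L w = orbit_weight (\<lambda>b c. of_real (vertex_scattering G b c)) (\<lambda>b. L (fst b)) w"

text \<open>
  These sequences of directed edges need not be walks; those that are not closed walks have
  coefficient \<open>0\<close>.
\<close>

definition orbits :: "('v, 'e) pre_digraph \<Rightarrow> ('e \<Rightarrow> real) \<Rightarrow> real \<Rightarrow> ('e \<times> bool) list set" where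
  "orbits G L x = {w. set w \<subseteq> darts G \<and> w \<noteq> [] \<and> walk_length L w = x}"

lemma walk_length_alt: "walk_length L w = (\<Sum>b\<leftarrow>w. L (fst b))"
  by (simp add: walk_length_def case_prod_unfold)

lemma walk_integral_alt: "walk_integral L \<alpha> w = (\<Sum>b\<leftarrow>w. dart_flux L \<alpha> b)"
  by (simp add: walk_integral_def dart_flux_def case_prod_unfold)

lemma orbit_weight_bond_matrix:
  "orbit_weight (bond_matrix G L (scale_form t \<alpha>)) (\<lambda>b. L (fst b)) w =
    orbit_coefficient G L w * exp (\<i> * of_real t * of_real (- 2 * pi * walk_integral L \<alpha> w))"
proof -
  have "(\<Prod>c\<leftarrow>w. exp (- (2 * pi * \<i> * dart_flux L (scale_form t \<alpha>) c))) =
      exp (\<i> * of_real t * of_real (- 2 * pi * walk_integral L \<alpha> w))"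
    by (induction w) (simp_all add: walk_integral_alt dart_flux_scale_form algebra_simps flip: exp_add)
  then show ?thesis
    by (simp add: orbit_coefficient_def orbit_weight_def bond_matrix_def[abs_def] path_weight_mult)
qed

lemma (in quantum_graph) finite_walks_bounded: "finite {w. set w \<subseteq> darts G \<and> walk_length L w \<le> x}"
proof -
  interpret scattering "darts G" "bond_matrix G L \<alpha>" "\<lambda>b. L (fst b)" for \<alpha> by (rule scattering_bonds)
  obtain N :: nat where N: "x / min_length < N" using reals_Archimedean2 by blast
  have "length w \<le> N" if "set w \<subseteq> darts G" "walk_length L w \<le> x" for w
  proof -
    have "real (length w) * min_length \<le> x"
      using length_le_orbit_length[OF that(1)] that(2) by (simp add: walk_length_alt)
    then have "real (length w) \<le> x / min_length" using min_length_pos by (simp add: field_simps)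
    then show ?thesis using N by linarith
  qed
  then show ?thesis
    by (intro finite_subset[OF _ finite_lists_length_le[OF finite_darts, of N]]) auto
qed

lemma (in quantum_graph) finite_orbits: "finite (orbits G L x)"
  by (rule finite_subset[OF _ finite_walks_bounded[of x]]) (auto simp: orbits_def)

text \<open>
  The spectra for small \<open>t\<close> determine the trigonometric polynomials in \<open>t\<close> formed by the orbits of
  each length, and hence the contribution of each single frequency.
\<close>

theorem flux_orbit_sums_determined:
  assumes G: "quantum_graph G L" and G': "quantum_graph G' L'"
    and \<alpha>: "\<alpha> \<in> one_forms G L" and \<alpha>': "\<alpha>' \<in> one_forms G' L'" and \<epsilon>: "0 < \<epsilon>"
    and Spec: "\<And>t. t \<in> {0..<\<epsilon>} \<Longrightarrow> Spec G L (scale_form t \<alpha>) = Spec G' L' (scale_form t \<alpha>')"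
  shows "(\<Sum>w | w \<in> orbits G L x \<and> walk_integral L \<alpha> w = y. orbit_coefficient G L w) =
    (\<Sum>w | w \<in> orbits G' L' x \<and> walk_integral L' \<alpha>' w = y. orbit_coefficient G' L' w)"
proof -
  note fin = quantum_graph.finite_orbits[OF G, of x] quantum_graph.finite_orbits[OF G', of x]
  have sums: "(\<Sum>w\<in>orbits G L x. orbit_coefficient G L w * exp (\<i> * of_real t * of_real (- 2 * pi * walk_integral L \<alpha> w))) =
      (\<Sum>w\<in>orbits G' L' x. orbit_coefficient G' L' w * exp (\<i> * of_real t * of_real (- 2 * pi * walk_integral L' \<alpha>' w)))"
    if t: "t \<in> {0..<\<epsilon>}" for t
  proof -
    interpret F: quantum_graph_form G L "scale_form t \<alpha>"
      by (intro quantum_graph_form.intro G quantum_graph_form_axioms.intro scale_form_in_one_forms \<alpha>)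
    interpret F': quantum_graph_form G' L' "scale_form t \<alpha>'"
      by (intro quantum_graph_form.intro G' quantum_graph_form_axioms.intro scale_form_in_one_forms \<alpha>')
    have dims: "fs.dim (F.bonds.stationary \<kappa>) = fs.dim (F'.bonds.stationary \<kappa>)" if "\<kappa> \<noteq> 0" for \<kappa> :: real
      using F.dim_eigenspace[of "of_real \<kappa>"] F'.dim_eigenspace[of "of_real \<kappa>"] that
        Spec_eq_imp_dim_eq[OF G G' Spec[OF t]] by simp
    have "(\<Sum>w | set w \<subseteq> darts G \<and> w \<noteq> [] \<and> (\<Sum>b\<leftarrow>w. L (fst b)) = x. orbit_weight (bond_matrix G L (scale_form t \<alpha>)) (\<lambda>b. L (fst b)) w) =
      (\<Sum>w | set w \<subseteq> darts G' \<and> w \<noteq> [] \<and> (\<Sum>b\<leftarrow>w. L' (fst b)) = x. orbit_weight (bond_matrix G' L' (scale_form t \<alpha>')) (\<lambda>b. L' (fst b)) w)"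
      by (rule orbit_sums_determined[OF F.scattering_bonds F'.scattering_bonds]) (rule dims, simp)
    then show ?thesis
      by (simp only: orbit_weight_bond_matrix orbits_def walk_length_alt)
  qed
  define I where "I = orbits G L x <+> orbits G' L' x"
  define c where "c = case_sum (orbit_coefficient G L) (\<lambda>w. - orbit_coefficient G' L' w)"
  define \<omega> where "\<omega> = case_sum (\<lambda>w. - 2 * pi * walk_integral L \<alpha> w) (\<lambda>w. - 2 * pi * walk_integral L' \<alpha>' w)"
  have "(\<Sum>i | i \<in> I \<and> \<omega> i = - 2 * pi * y. c i) = 0"
  proof (rule trig_sum_coefficients_zero[OF _ \<epsilon>])
    show "finite I" using fin by (simp add: I_def)
    fix t :: real assume "0 \<le> t" "t < \<epsilon>"
    then show "(\<Sum>i\<in>I. c i * exp (\<i> * of_real t * of_real (\<omega> i))) = 0"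
      using sums[of t] fin by (simp add: I_def sum.Plus c_def \<omega>_def sum_negf)
  qed
  moreover have "{i. i \<in> I \<and> \<omega> i = - 2 * pi * y} =
      {w. w \<in> orbits G L x \<and> walk_integral L \<alpha> w = y} <+> {w. w \<in> orbits G' L' x \<and> walk_integral L' \<alpha>' w = y}"
    by (auto simp: I_def \<omega>_def Plus_def)
  ultimately show ?thesis
    using fin by (simp add: sum.Plus c_def sum_negf)
qed

section \<open>Walks\<close>

fun walk :: "('v, 'e) pre_digraph \<Rightarrow> 'v \<Rightarrow> ('e \<times> bool) list \<Rightarrow> 'v \<Rightarrow> bool" where
  "walk G u [] v \<longleftrightarrow> u = v \<and> u \<in> verts G"
| "walk G u (b # w) v \<longleftrightarrow> b \<in> darts G \<and> origin G b = u \<and> walk G (origin G (reverse b)) w v"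

lemma (in wf_digraph) origin_in_verts: "b \<in> darts G \<Longrightarrow> origin G b \<in> verts G"
  by (cases b) (simp add: origin_def darts_def)

lemma (in wf_digraph) awalk_double: "pre_digraph.awalk (double G) u w v \<longleftrightarrow> walk G u w v"
proof -
  have t: "tail (double G) b = origin G b" "head (double G) b = origin G (reverse b)" for b
    by (simp_all add: double_def origin_def reverse_def case_prod_beta)
  have a: "arcs (double G) = darts G" "verts (double G) = verts G"
    by (simp_all add: double_def darts_def)
  show ?thesis
  proof (induction w arbitrary: u)
    case (Cons b w)
    show ?case
      using Cons.IH[of "origin G (reverse b)"] origin_in_verts[of b] origin_in_verts[of "reverse b"]
      by (auto simp: pre_digraph.awalk_def pre_digraph.cas.simps t a)
  qed (auto simp: pre_digraph.awalk_def pre_digraph.cas.simps a)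
qed

lemma (in wf_digraph) closed_walk_iff: "closed_walk G w \<longleftrightarrow> (\<exists>v. walk G v w v)"
  by (simp add: closed_walk_def awalk_double)

lemma (in wf_digraph) walk_in_verts: "walk G u w v \<Longrightarrow> u \<in> verts G \<and> v \<in> verts G"
  by (induction w arbitrary: u) (auto dest: origin_in_verts)

lemma (in wf_digraph) walk_append: "walk G u (p @ q) v \<longleftrightarrow> (\<exists>m. walk G u p m \<and> walk G m q v)"
  by (induction p arbitrary: u) (use walk_in_verts in auto)

lemma walk_set: "walk G u w v \<Longrightarrow> set w \<subseteq> darts G"
  by (induction w arbitrary: u) auto

section \<open>Minimal orbits\<close>

lemma walk_if_path_weight_nonzero:
  assumes "path_weight (\<lambda>b c. of_real (vertex_scattering G b c)) (w @ [d]) \<noteq> 0"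
    and "set w \<subseteq> darts G" "w \<noteq> []" "origin G d \<in> verts G"
  shows "walk G (origin G (hd w)) w (origin G d)"
  using assms
proof (induction w)
  case (Cons b w)
  show ?case
  proof (cases w)
    case Nil
    then have "vertex_scattering G d b \<noteq> 0" using Cons.prems by simp
    then show ?thesis using Cons.prems Nil by (auto simp: vertex_scattering_def split: if_splits)
  next
    case (Cons c v)
    then have "vertex_scattering G c b \<noteq> 0" using Cons.prems by simp
    moreover have "walk G (origin G (hd w)) w (origin G d)"
      using Cons.IH Cons.prems Cons by simp
    ultimately show ?thesis using Cons.prems Cons by (auto simp: vertex_scattering_def split: if_splits)
  qed
qed simp

lemma (in quantum_graph) path_weight_positive:
  assumes "walk G u w (origin G d)" "successively (\<lambda>c d. d \<noteq> reverse c) (w @ [d])" "d \<in> darts G"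
  shows "\<exists>r>0. path_weight (\<lambda>b c. of_real (vertex_scattering G b c)) (w @ [d]) = of_real r"
  using assms
proof (induction w arbitrary: u)
  case Nil
  then show ?case by (intro exI[of _ 1]) simp
next
  case (Cons b w)
  have pos: "0 < vertex_scattering G c b" if "c \<in> darts G" "origin G (reverse b) = origin G c" "c \<noteq> reverse b" for c
  proof -
    have "c \<in> out_darts G (origin G c)" using that by (simp add: out_darts_def)
    then have "0 < card (out_darts G (origin G c))"
      using finite_out_darts by (auto simp: card_gt_0_iff)
    then show ?thesis using that by (simp add: vertex_scattering_def)
  qed
  show ?case
  proof (cases w)
    case Nil
    then show ?thesis using Cons.prems pos[of d] by (intro exI[of _ "vertex_scattering G d b"]) simp
  next
    case w: (Cons c v)
    obtain r where r: "0 < r" "path_weight (\<lambda>b c. of_real (vertex_scattering G b c)) (w @ [d]) = of_real r"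
      using Cons.IH[of "origin G (reverse b)"] Cons.prems w by auto
    then show ?thesis
      using Cons.prems pos[of c] w by (intro exI[of _ "vertex_scattering G c b * r"]) auto
  qed
qed

lemma not_successivelyE:
  assumes "\<not> successively P zs"
  obtains xs a b ys where "zs = xs @ a # b # ys" "\<not> P a b"
proof -
  have "\<exists>xs a b ys. zs = xs @ a # b # ys \<and> \<not> P a b"
    using assms
  proof (induction P zs rule: successively.induct)
    case (3 P x y zs)
    show ?case
    proof (cases "P x y")
      case True
      then obtain xs a b ys where "y # zs = xs @ a # b # ys" "\<not> P a b" using 3 by auto
      then have "x # y # zs = (x # xs) @ a # b # ys" by simp
      then show ?thesis using \<open>\<not> P a b\<close> by blast
    next
      case False
      then show ?thesis by (intro exI[of _ "[]"] exI[of _ x] exI[of _ y] exI[of _ zs]) simp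
    qed
  qed auto
  then show thesis using that by blast
qed

text \<open>Cutting out a backtracking shortens a closed walk and does not change its integral.\<close>

lemma (in quantum_graph) shorten_backtracking:
  assumes w: "walk G v w v" "w \<noteq> []" and backtrack: "\<not> successively (\<lambda>c d. d \<noteq> reverse c) (w @ [hd w])"
  shows "\<exists>w'. closed_walk G w' \<and> walk_integral L \<alpha> w' = walk_integral L \<alpha> w \<and> walk_length L w' < walk_length L w"
proof -
  obtain xs c ys where split: "w @ [hd w] = xs @ c # reverse c # ys"
    using backtrack by (rule not_successivelyE) auto
  show ?thesis
  proof (cases ys rule: rev_cases)
    case (snoc zs z)
    then have w_eq: "w = xs @ [c, reverse c] @ zs" using split by simp
    then obtain m where m: "walk G v xs m" "walk G m [c, reverse c] m" "walk G m zs v"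
      using w(1) unfolding w_eq walk_append by auto
    have "c \<in> darts G" using m(2) by simp
    then have "0 < L (fst c)" using length_pos by (auto simp: darts_def)
    moreover have "walk G v (xs @ zs) v" using m walk_append by blast
    ultimately show ?thesis
      by (intro exI[of _ "xs @ zs"])
        (auto simp: closed_walk_iff w_eq walk_integral_alt walk_length_alt dart_flux_reverse)
  next
    case Nil
    then have w_eq: "w = xs @ [c]" and hd: "hd w = reverse c" using split by auto
    have "xs \<noteq> []"
    proof
      assume "xs = []"
      then have "c = reverse c" using hd w_eq by simp
      then have "snd c = (\<not> snd c)" by (metis reverse_def snd_conv)
      then show False by simp
    qed
    then obtain zs where xs: "xs = reverse c # zs" using hd w_eq by (cases xs) auto
    have "walk G v ((reverse c # zs) @ [c]) v" using w(1) w_eq xs by simp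
    then obtain m where m: "walk G (origin G c) zs m" "c \<in> darts G" "origin G c = m"
      unfolding walk_append by auto
    have "0 < L (fst c)" using m(2) length_pos by (auto simp: darts_def)
    moreover have "walk G m zs m" using m by simp
    ultimately show ?thesis
      by (intro exI[of _ zs])
        (auto simp: closed_walk_iff w_eq xs walk_integral_alt walk_length_alt dart_flux_reverse)
  qed
qed

text \<open>
  The spectra see the integral of a walk and not its homology class. For a generic form the
  integral determines the class.
\<close>

definition flux_minimal :: "('v, 'e) pre_digraph \<Rightarrow> ('e \<Rightarrow> real) \<Rightarrow> ('e \<Rightarrow> real \<Rightarrow> real) \<Rightarrow> ('e \<times> bool) list \<Rightarrow> bool" where
  "flux_minimal G L \<alpha> w \<longleftrightarrow> closed_walk G w \<and>
     (\<forall>w'. closed_walk G w' \<and> walk_integral L \<alpha> w' = walk_integral L \<alpha> w \<longrightarrow> walk_length L w \<le> walk_length L w')"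

definition orbit_sum :: "('v, 'e) pre_digraph \<Rightarrow> ('e \<Rightarrow> real) \<Rightarrow> ('e \<Rightarrow> real \<Rightarrow> real) \<Rightarrow> real \<Rightarrow> real \<Rightarrow> complex" where
  "orbit_sum G L \<alpha> x y = (\<Sum>w | w \<in> orbits G L x \<and> walk_integral L \<alpha> w = y. orbit_coefficient G L w)"

context quantum_graph
begin

lemma closed_if_orbit_coefficient_nonzero:
  assumes "w \<in> orbits G L x" "orbit_coefficient G L w \<noteq> 0"
  shows "closed_walk G w"
proof -
  have w: "set w \<subseteq> darts G" "w \<noteq> []" using assms(1) by (auto simp: orbits_def)
  then have "origin G (hd w) \<in> verts G" by (intro origin_in_verts) auto
  then have "walk G (origin G (hd w)) w (origin G (hd w))"
    using assms(2) w by (intro walk_if_path_weight_nonzero) (auto simp: orbit_coefficient_def orbit_weight_def)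
  then show ?thesis by (auto simp: closed_walk_iff)
qed

lemma orbit_sum_nonzeroD:
  assumes "orbit_sum G L \<alpha> x y \<noteq> 0"
  obtains w where "closed_walk G w" "walk_length L w = x" "walk_integral L \<alpha> w = y"
proof -
  obtain w where "w \<in> orbits G L x" "walk_integral L \<alpha> w = y" "orbit_coefficient G L w \<noteq> 0"
    using assms unfolding orbit_sum_def by (metis (mono_tags, lifting) mem_Collect_eq sum.neutral)
  then show thesis using that closed_if_orbit_coefficient_nonzero by (auto simp: orbits_def)
qed

text \<open>
  Minimal orbits do not backtrack, so their coefficients are positive, and no cancellation
  can occur between them.
\<close>

lemma orbit_coefficient_minimal:
  assumes "flux_minimal G L \<alpha> w" "walk_integral L \<alpha> w \<noteq> 0"
  shows "w \<in> orbits G L (walk_length L w)" "\<exists>r>0. orbit_coefficient G L w = of_real r"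
proof -
  have ne: "w \<noteq> []" using assms(2) by (auto simp: walk_integral_alt)
  obtain v where v: "walk G v w v" using assms(1) by (auto simp: flux_minimal_def closed_walk_iff)
  show "w \<in> orbits G L (walk_length L w)" using walk_set[OF v] ne by (simp add: orbits_def)
  have "successively (\<lambda>c d. d \<noteq> reverse c) (w @ [hd w])"
    using shorten_backtracking[OF v ne, of \<alpha>] assms(1) by (force simp: flux_minimal_def)
  moreover have hd: "hd w \<in> darts G" "origin G (hd w) = v" using v ne by (cases w; auto)+
  ultimately obtain r where "0 < r" "path_weight (\<lambda>b c. of_real (vertex_scattering G b c)) (w @ [hd w]) = of_real r"
    using path_weight_positive[of v w "hd w"] v by auto
  moreover have "0 < L (fst (hd w))" using hd length_pos by (auto simp: darts_def)
  ultimately show "\<exists>r>0. orbit_coefficient G L w = of_real r"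
    by (intro exI[of _ "L (fst (hd w)) * r"]) (simp add: orbit_coefficient_def orbit_weight_def)
qed

lemma orbit_sum_minimal_nonzero:
  assumes w: "flux_minimal G L \<alpha> w" "walk_integral L \<alpha> w \<noteq> 0"
  shows "orbit_sum G L \<alpha> (walk_length L w) (walk_integral L \<alpha> w) \<noteq> 0"
proof -
  define A where "A = {w'. w' \<in> orbits G L (walk_length L w) \<and> walk_integral L \<alpha> w' = walk_integral L \<alpha> w}"
  have fin: "finite A" using finite_orbits by (simp add: A_def)
  have nonneg: "0 \<le> Re (orbit_coefficient G L w')" if w': "w' \<in> A" for w'
  proof (cases "orbit_coefficient G L w' = 0")
    case False
    then have "closed_walk G w'" using w' closed_if_orbit_coefficient_nonzero by (auto simp: A_def)
    then have "flux_minimal G L \<alpha> w'" using w(1) w' by (auto simp: flux_minimal_def A_def orbits_def)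
    then obtain r where "0 < r" "orbit_coefficient G L w' = of_real r"
      using orbit_coefficient_minimal(2)[of \<alpha> w'] w(2) w' by (auto simp: A_def)
    then show ?thesis by simp
  qed simp
  have "w \<in> A" using orbit_coefficient_minimal(1)[OF w] by (simp add: A_def)
  moreover have "0 < Re (orbit_coefficient G L w)" using orbit_coefficient_minimal(2)[OF w] by auto
  ultimately have "0 < (\<Sum>w'\<in>A. Re (orbit_coefficient G L w'))"
    using fin nonneg by (intro sum_pos2) auto
  then have "Re (\<Sum>w'\<in>A. orbit_coefficient G L w') \<noteq> 0" by simp
  then have "(\<Sum>w'\<in>A. orbit_coefficient G L w') \<noteq> 0" by (metis zero_complex.sel(1))
  then show ?thesis unfolding orbit_sum_def A_def .
qed

text \<open>
  A minimum is attained, because only finitely many walks are shorter than a given one.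
\<close>

lemma exists_shortest:
  assumes "P w0" and walks: "\<And>w. P w \<Longrightarrow> closed_walk G w"
  obtains w where "P w" "\<And>w'. P w' \<Longrightarrow> walk_length L w \<le> walk_length L w'"
proof -
  define A where "A = {w. P w \<and> walk_length L w \<le> walk_length L w0}"
  have "A \<subseteq> {w. set w \<subseteq> darts G \<and> walk_length L w \<le> walk_length L w0}"
  proof
    fix w assume w: "w \<in> A"
    then obtain v where "walk G v w v" using walks by (auto simp: A_def closed_walk_iff)
    then show "w \<in> {w. set w \<subseteq> darts G \<and> walk_length L w \<le> walk_length L w0}"
      using walk_set w by (simp add: A_def)
  qed
  then have fin: "finite A" using finite_walks_bounded by (rule finite_subset)
  have "A \<noteq> {}" using assms(1) by (auto simp: A_def)
  then obtain w where w: "w \<in> A" "\<And>w'. w' \<in> A \<Longrightarrow> walk_length L w \<le> walk_length L w'"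
    using arg_min_if_finite[OF fin, of "walk_length L"] by (metis not_le)
  show thesis
  proof (rule that)
    show "P w" using w(1) by (simp add: A_def)
    fix w' assume "P w'"
    then show "walk_length L w \<le> walk_length L w'"
      using w by (cases "w' \<in> A") (auto simp: A_def)
  qed
qed

lemma exists_flux_minimal:
  assumes "closed_walk G w0"
  obtains w where "flux_minimal G L \<alpha> w" "walk_integral L \<alpha> w = walk_integral L \<alpha> w0"
    "walk_length L w \<le> walk_length L w0"
proof -
  obtain w where "closed_walk G w \<and> walk_integral L \<alpha> w = walk_integral L \<alpha> w0"
    "\<And>w'. closed_walk G w' \<and> walk_integral L \<alpha> w' = walk_integral L \<alpha> w0 \<Longrightarrow> walk_length L w \<le> walk_length L w'"
    using exists_shortest[of "\<lambda>w. closed_walk G w \<and> walk_integral L \<alpha> w = walk_integral L \<alpha> w0" w0] assms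
    by blast
  then show thesis using that[of w] assms by (auto simp: flux_minimal_def)
qed

end

text \<open>
  The orbit sum at \<open>w\<close> is non-zero, so the other graph has a walk with the same length and integral;
  if it had a shorter one with this integral, the first graph would have one by symmetry.
\<close>

lemma flux_minimal_transfer:
  assumes G: "quantum_graph G L" and G': "quantum_graph G' L'"
    and eq: "\<And>x y. orbit_sum G L \<alpha> x y = orbit_sum G' L' \<alpha>' x y"
    and w: "flux_minimal G L \<alpha> w" "walk_integral L \<alpha> w \<noteq> 0"
  obtains w' where "flux_minimal G' L' \<alpha>' w'" "walk_integral L' \<alpha>' w' = walk_integral L \<alpha> w"
    "walk_length L' w' = walk_length L w"
proof -
  interpret G: quantum_graph G L by (fact G)
  interpret G': quantum_graph G' L' by (fact G')
  have "orbit_sum G' L' \<alpha>' (walk_length L w) (walk_integral L \<alpha> w) \<noteq> 0"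
    using G.orbit_sum_minimal_nonzero[OF w] eq by simp
  then obtain w1 where w1: "closed_walk G' w1" "walk_length L' w1 = walk_length L w"
    "walk_integral L' \<alpha>' w1 = walk_integral L \<alpha> w"
    by (rule G'.orbit_sum_nonzeroD)
  obtain w' where w': "flux_minimal G' L' \<alpha>' w'" "walk_integral L' \<alpha>' w' = walk_integral L' \<alpha>' w1"
    "walk_length L' w' \<le> walk_length L' w1"
    using w1(1) by (rule G'.exists_flux_minimal)
  have "orbit_sum G L \<alpha> (walk_length L' w') (walk_integral L' \<alpha>' w') \<noteq> 0"
    using G'.orbit_sum_minimal_nonzero[OF w'(1)] w'(2) w1(3) w(2) eq by simp
  then obtain w2 where "closed_walk G w2" "walk_length L w2 = walk_length L' w'"
    "walk_integral L \<alpha> w2 = walk_integral L' \<alpha>' w'"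
    by (rule G.orbit_sum_nonzeroD)
  then have "walk_length L w \<le> walk_length L' w'"
    using w(1) w'(2) w1(3) by (auto simp: flux_minimal_def)
  then show thesis using that[OF w'(1)] w' w1 by simp
qed


section \<open>Connected components\<close>

definition reverse_walk :: "('e \<times> bool) list \<Rightarrow> ('e \<times> bool) list" where
  "reverse_walk w = rev (map reverse w)"

context wf_digraph
begin

lemma walk_reverse: "walk G u w v \<Longrightarrow> walk G v (reverse_walk w) u"
proof (induction w arbitrary: u)
  case (Cons b w)
  then have b: "b \<in> darts G" "origin G b = u" "walk G v (reverse_walk w) (origin G (reverse b))"
    by (simp_all add: Cons.IH)
  have "walk G (origin G (reverse b)) [reverse b] u"
    using b origin_in_verts[OF b(1)] by simp
  then show ?case
    using b(3) walk_append[of v "reverse_walk w" "[reverse b]" u] by (auto simp: reverse_walk_def)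
qed (simp add: reverse_walk_def)

lemma reachable_mk_symmetric_iff: "u \<rightarrow>\<^sup>*\<^bsub>mk_symmetric G\<^esub> v \<longleftrightarrow> (\<exists>w. walk G u w v)"
proof
  have ends: "arcs_ends (with_proj (mk_symmetric G)) = parcs (mk_symmetric G)" by simp
  have dart: "(a, b) \<in> parcs (mk_symmetric G) \<longleftrightarrow> (\<exists>d\<in>darts G. origin G d = a \<and> origin G (reverse d) = b)" for a b
  proof
    assume "(a, b) \<in> parcs (mk_symmetric G)"
    then obtain e where e: "e \<in> arcs G" "(a, b) = (tail G e, head G e) \<or> (a, b) = (head G e, tail G e)"
      by (auto simp: parcs_mk_symmetric)
    from e(2) show "\<exists>d\<in>darts G. origin G d = a \<and> origin G (reverse d) = b"
    proof
      assume "(a, b) = (tail G e, head G e)"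
      then show ?thesis using e(1) by (intro bexI[of _ "(e, True)"]) (auto simp: darts_def origin_def reverse_def)
    next
      assume "(a, b) = (head G e, tail G e)"
      then show ?thesis using e(1) by (intro bexI[of _ "(e, False)"]) (auto simp: darts_def origin_def reverse_def)
    qed
  next
    assume "\<exists>d\<in>darts G. origin G d = a \<and> origin G (reverse d) = b"
    then show "(a, b) \<in> parcs (mk_symmetric G)"
      by (auto simp: parcs_mk_symmetric darts_def origin_def reverse_def split: if_splits)
  qed
  {
    assume "u \<rightarrow>\<^sup>*\<^bsub>mk_symmetric G\<^esub> v"
    then have "(u, v) \<in> rtrancl_on (verts G) (parcs (mk_symmetric G))"
      unfolding reachable_def by simp
    then show "\<exists>w. walk G u w v"
    proof (induction rule: converse_rtrancl_on_induct)
      case base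
      then have "walk G v [] v" by simp
      then show ?case by blast
    next
      case (step x y)
      then obtain d w where "d \<in> darts G" "origin G d = x" "origin G (reverse d) = y" "walk G y w v"
        using dart by blast
      then have "walk G x (d # w) v" by simp
      then show ?case by blast
    qed
  }
  {
    assume "\<exists>w. walk G u w v"
    then obtain w where "walk G u w v" by blast
    then have "(u, v) \<in> rtrancl_on (verts G) (parcs (mk_symmetric G))"
    proof (induction w arbitrary: u)
      case Nil
      then show ?case by (auto intro: rtrancl_on.intros)
    next
      case (Cons b w)
      then have "(u, origin G (reverse b)) \<in> parcs (mk_symmetric G)" unfolding dart by auto
      moreover have "u \<in> verts G" using Cons.prems origin_in_verts[of b] by auto
      ultimately show ?case
        using Cons.IH[of "origin G (reverse b)"] Cons.prems by (auto intro: converse_rtrancl_on_into_rtrancl_on)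
    qed
    then show "u \<rightarrow>\<^sup>*\<^bsub>mk_symmetric G\<^esub> v" unfolding reachable_def by simp
  }
qed

lemma connected_iff_walk:
  "connected G \<longleftrightarrow> verts G \<noteq> {} \<and> (\<forall>u\<in>verts G. \<forall>v\<in>verts G. \<exists>w. walk G u w v)"
  unfolding connected_def strongly_connected_def
  by (simp add: reachable_mk_symmetric_iff)

definition component_of :: "'a \<Rightarrow> ('a, 'b) pre_digraph" where
  "component_of v = G \<restriction> {u. \<exists>w. walk G v w u}"

lemma component_of_simps [simp]:
  "verts (component_of v) = {u. \<exists>w. walk G v w u}"
  "tail (component_of v) = tail G" "head (component_of v) = head G"
  "origin (component_of v) = origin G"
  by (simp_all add: component_of_def induce_subgraph_def origin_def fun_eq_iff)

lemma walk_step: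
  assumes "walk G v w (origin G b)" "b \<in> darts G"
  shows "\<exists>w. walk G v w (origin G (reverse b))"
proof -
  have "walk G (origin G b) [b] (origin G (reverse b))"
    using assms(2) origin_in_verts by simp
  then have "walk G v (w @ [b]) (origin G (reverse b))"
    using assms(1) walk_append by blast
  then show ?thesis by blast
qed

lemma arcs_component_of: "e \<in> arcs (component_of v) \<longleftrightarrow> e \<in> arcs G \<and> (\<exists>w. walk G v w (tail G e))"
proof -
  have "\<exists>w. walk G v w (head G e)" if "e \<in> arcs G" "walk G v w (tail G e)" for w
    using walk_step[of v w "(e, True)"] that by (simp add: origin_def darts_def reverse_def)
  then show ?thesis by (auto simp: component_of_def induce_subgraph_def)
qed

lemma arcs_component_of_head: "e \<in> arcs (component_of v) \<longleftrightarrow> e \<in> arcs G \<and> (\<exists>w. walk G v w (head G e))"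
proof -
  have "\<exists>w. walk G v w (tail G e)" if "e \<in> arcs G" "walk G v w (head G e)" for w
    using walk_step[of v w "(e, False)"] that by (simp add: origin_def darts_def reverse_def)
  then show ?thesis by (auto simp: component_of_def induce_subgraph_def)
qed

lemma darts_component_of: "b \<in> darts (component_of v) \<longleftrightarrow> b \<in> darts G \<and> (\<exists>w. walk G v w (origin G b))"
proof -
  obtain e s where "b = (e, s)" by (cases b)
  then show ?thesis
    using arcs_component_of[of e v] arcs_component_of_head[of e v] by (cases s) (simp_all add: darts_def origin_def)
qed

lemma walk_component_of: "\<exists>p. walk G v p u \<Longrightarrow> walk G u w x \<Longrightarrow> walk (component_of v) u w x"
proof (induction w arbitrary: u)
  case (Cons b w)
  then have "b \<in> darts G" "origin G b = u" by simp_all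
  then show ?case
    using Cons.IH[of "origin G (reverse b)"] Cons.prems walk_step[of v _ b] by (auto simp: darts_component_of)
qed simp

lemma wf_component_of: "wf_digraph (component_of v)"
proof
  fix e assume e: "e \<in> arcs (component_of v)"
  show "tail (component_of v) e \<in> verts (component_of v)"
    using e unfolding arcs_component_of by simp
  show "head (component_of v) e \<in> verts (component_of v)"
    using e unfolding arcs_component_of_head by simp
qed

lemma subgraph_component_of: "subgraph (component_of v) G"
  unfolding subgraph_def compatible_def
  using wf_component_of wf_digraph walk_in_verts by (auto simp: arcs_component_of)

lemma connected_component_of:
  assumes "v \<in> verts G"
  shows "connected (component_of v)"
proof -
  interpret K: wf_digraph "component_of v" by (rule wf_component_of)
  have v: "walk G v [] v" using assms by simp
  have "\<exists>w. walk (component_of v) x w y" if "walk G v p x" "walk G v q y" for x y p q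
  proof -
    have "walk G x (reverse_walk p @ q) y"
      using walk_reverse[OF that(1)] that(2) walk_append by blast
    then show ?thesis using walk_component_of that(1) by blast
  qed
  moreover have "v \<in> verts (component_of v)" unfolding component_of_simps using v by blast
  then have "verts (component_of v) \<noteq> {}" by blast
  ultimately show ?thesis unfolding K.connected_iff_walk by auto
qed

lemma walk_subgraph:
  assumes "subgraph H G" "walk H u w v"
  shows "walk G u w v"
proof -
  have "origin H = origin G" "darts H \<subseteq> darts G" "verts H \<subseteq> verts G"
    using assms(1) by (auto simp: subgraph_def compatible_def origin_def darts_def fun_eq_iff)
  then show ?thesis using assms(2) by (induction w arbitrary: u) auto
qed

lemma connected_subgraph_component_of:
  assumes H: "subgraph H G" "connected H" and v: "v \<in> verts H"
  shows "subgraph H (component_of v)"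
proof -
  interpret H: wf_digraph H using H(1) by (simp add: subgraph_def)
  have reach: "\<exists>w. walk G v w u" if "u \<in> verts H" for u
    using H(2) v that walk_subgraph[OF H(1)] unfolding H.connected_iff_walk by blast
  have "arcs H \<subseteq> arcs (component_of v)"
  proof
    fix e assume e: "e \<in> arcs H"
    then have "tail H e \<in> verts H" by simp
    then show "e \<in> arcs (component_of v)"
      using reach[of "tail H e"] e H(1) unfolding arcs_component_of by (auto simp: subgraph_def compatible_def)
  qed
  then show ?thesis
    using H(1) reach wf_component_of unfolding subgraph_def compatible_def by auto
qed

lemma component_of_in_components:
  assumes "v \<in> verts G"
  shows "component_of v \<in> graph_components G"
  unfolding graph_components_def max_subgraph_def
proof (intro CollectI conjI allI impI notI subgraph_component_of connected_component_of assms)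
  fix H' assume 1: "H' \<noteq> component_of v \<and> subgraph (component_of v) H'" and 2: "subgraph H' G \<and> connected H'"
  have "walk G v [] v" using assms by simp
  then have "v \<in> verts (component_of v)" unfolding component_of_simps by blast
  then have "v \<in> verts H'" using 1 by (auto simp: subgraph_def)
  then have "subgraph H' (component_of v)" using connected_subgraph_component_of 2 by blast
  then have "H' = component_of v"
    using 1 by (intro pre_digraph.equality) (auto simp: subgraph_def compatible_def)
  then show False using 1 by blast
qed

lemma component_eq:
  assumes "H \<in> graph_components G" "v \<in> verts H"
  shows "H = component_of v"
proof -
  have H: "subgraph H G" "connected H" and max: "\<And>H'. H' \<noteq> H \<Longrightarrow> subgraph H H' \<Longrightarrow> \<not> (subgraph H' G \<and> connected H')"
    using assms(1) by (auto simp: graph_components_def max_subgraph_def)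
  have "v \<in> verts G" using H(1) assms(2) by (auto simp: subgraph_def)
  then show ?thesis
    using max[of "component_of v"] connected_subgraph_component_of[OF H assms(2)]
      subgraph_component_of connected_component_of by blast
qed

lemma component_nonempty: "H \<in> graph_components G \<Longrightarrow> \<exists>v. v \<in> verts H"
  by (auto simp: graph_components_def max_subgraph_def connected_def strongly_connected_def)

lemma component_subgraph: "H \<in> graph_components G \<Longrightarrow> subgraph H G"
  by (simp add: graph_components_def max_subgraph_def)

lemma component_connected: "H \<in> graph_components G \<Longrightarrow> connected H"
  by (simp add: graph_components_def max_subgraph_def)

lemma components_eq_image: "graph_components G = component_of ` verts G"
proof (intro equalityI subsetI)
  fix H assume H: "H \<in> graph_components G"
  then obtain v where v: "v \<in> verts H" using component_nonempty by blast
  then have "v \<in> verts G" using component_subgraph[OF H] by (auto simp: subgraph_def)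
  then show "H \<in> component_of ` verts G" using component_eq[OF H v] by blast
qed (use component_of_in_components in auto)

lemma component_unique:
  assumes "H \<in> graph_components G" "H' \<in> graph_components G" "v \<in> verts H" "v \<in> verts H'"
  shows "H = H'"
  using component_eq[OF assms(1,3)] component_eq[OF assms(2,4)] by simp

lemma arcs_component:
  assumes "H \<in> graph_components G"
  shows "e \<in> arcs H \<longleftrightarrow> e \<in> arcs G \<and> tail G e \<in> verts H"
    and "e \<in> arcs H \<longleftrightarrow> e \<in> arcs G \<and> head G e \<in> verts H"
proof -
  obtain v where "v \<in> verts H" using component_nonempty[OF assms] by blast
  then have "H = component_of v" by (rule component_eq[OF assms])
  then show "e \<in> arcs H \<longleftrightarrow> e \<in> arcs G \<and> tail G e \<in> verts H" "e \<in> arcs H \<longleftrightarrow> e \<in> arcs G \<and> head G e \<in> verts H"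
    using arcs_component_of arcs_component_of_head by simp_all
qed

lemma component_of_arc:
  assumes "e \<in> arcs G"
  obtains H where "H \<in> graph_components G" "e \<in> arcs H"
proof -
  have "walk G (tail G e) [] (tail G e)" using assms by simp
  then have "e \<in> arcs (component_of (tail G e))" unfolding arcs_component_of using assms by blast
  then show thesis using that component_of_in_components[of "tail G e"] assms by simp
qed

lemma component_unique_arc:
  assumes "H \<in> graph_components G" "H' \<in> graph_components G" "e \<in> arcs H" "e \<in> arcs H'"
  shows "H = H'"
  using component_unique[OF assms(1,2)] arcs_component(1)[OF assms(1)] arcs_component(1)[OF assms(2)] assms(3,4) by blast

lemma walk_component:
  assumes "H \<in> graph_components G" "u \<in> verts H" "walk G u w v"
  shows "walk H u w v"
proof -
  have "walk G u [] u" using walk_in_verts[OF assms(3)] by simp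
  then have "walk (component_of u) u w v" by (intro walk_component_of[OF _ assms(3)] exI)
  then show ?thesis by (simp only: component_eq[OF assms(1,2)])
qed

end

lemma (in fin_digraph) finite_components: "finite (graph_components G)"
  by (simp add: components_eq_image)

lemma (in fin_digraph) fin_digraph_component:
  assumes "H \<in> graph_components G"
  shows "fin_digraph H"
proof -
  have H: "subgraph H G" by (rule component_subgraph[OF assms])
  then interpret H: wf_digraph H by (simp add: subgraph_def)
  show ?thesis
    using H finite_subset[OF _ finite_verts, of "verts H"] finite_subset[OF _ finite_arcs, of "arcs H"]
    by unfold_locales (simp_all add: subgraph_def)
qed

section \<open>Cycles and closed walks\<close>

text \<open>
  Summation by parts: the boundary of a chain is adjoint to the gradient of a function on the
  vertices. Hence a chain without boundary is orthogonal to every gradient.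
\<close>

lemma (in fin_digraph) sum_gradient_eq_0:
  fixes c :: "'b \<Rightarrow> 'c::comm_ring"
  assumes balanced: "\<And>v. v \<in> verts G \<Longrightarrow> (\<Sum>e\<in>in_arcs G v. c e) - (\<Sum>e\<in>out_arcs G v. c e) = 0"
  shows "(\<Sum>e\<in>arcs G. c e * (\<phi> (head G e) - \<phi> (tail G e))) = 0"
proof -
  have head: "(\<Sum>e\<in>arcs G. c e * \<phi> (head G e)) = (\<Sum>v\<in>verts G. (\<Sum>e\<in>in_arcs G v. c e) * \<phi> v)"
  proof -
    have "(\<Sum>e\<in>arcs G. c e * \<phi> (head G e)) = (\<Sum>v\<in>verts G. \<Sum>e | e \<in> arcs G \<and> head G e = v. c e * \<phi> (head G e))"
      by (rule sum.group[symmetric]) auto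
    also have "\<dots> = (\<Sum>v\<in>verts G. (\<Sum>e\<in>in_arcs G v. c e) * \<phi> v)"
      by (intro sum.cong refl) (simp add: in_arcs_def sum_distrib_right)
    finally show ?thesis .
  qed
  have tail: "(\<Sum>e\<in>arcs G. c e * \<phi> (tail G e)) = (\<Sum>v\<in>verts G. (\<Sum>e\<in>out_arcs G v. c e) * \<phi> v)"
  proof -
    have "(\<Sum>e\<in>arcs G. c e * \<phi> (tail G e)) = (\<Sum>v\<in>verts G. \<Sum>e | e \<in> arcs G \<and> tail G e = v. c e * \<phi> (tail G e))"
      by (rule sum.group[symmetric]) auto
    also have "\<dots> = (\<Sum>v\<in>verts G. (\<Sum>e\<in>out_arcs G v. c e) * \<phi> v)"
      by (intro sum.cong refl) (simp add: out_arcs_def sum_distrib_right)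
    finally show ?thesis .
  qed
  have "(\<Sum>e\<in>arcs G. c e * (\<phi> (head G e) - \<phi> (tail G e))) =
      (\<Sum>v\<in>verts G. ((\<Sum>e\<in>in_arcs G v. c e) - (\<Sum>e\<in>out_arcs G v. c e)) * \<phi> v)"
    by (simp only: right_diff_distrib left_diff_distrib sum_subtractf head tail)
  also have "\<dots> = 0"
  proof (rule sum.neutral, rule ballI)
    fix v assume "v \<in> verts G"
    from balanced[OF this]
    show "((\<Sum>e\<in>in_arcs G v. c e) - (\<Sum>e\<in>out_arcs G v. c e)) * \<phi> v = 0" by (simp only: mult_zero_left)
  qed
  finally show ?thesis .
qed

lemma walk_class_Nil [simp]: "walk_class [] = (\<lambda>e. 0)"
  by (simp add: walk_class_def fun_eq_iff)

lemma walk_class_Cons: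
  "walk_class (b # w) e = (if fst b = e then if snd b then 1 else - 1 else 0) + walk_class w e"
  by (cases b) (auto simp: walk_class_def)

lemma walk_class_append: "walk_class (p @ q) e = walk_class p e + walk_class q e"
  by (simp add: walk_class_def)

lemma walk_class_reverse: "walk_class (reverse_walk w) e = - walk_class w e"
  by (induction w) (auto simp: reverse_walk_def walk_class_append walk_class_Cons reverse_def)

lemma walk_class_support: "set w \<subseteq> darts G \<Longrightarrow> e \<notin> arcs G \<Longrightarrow> walk_class w e = 0"
  by (induction w) (auto simp: walk_class_Cons darts_def)

context fin_digraph
begin

lemma cycle_integral_walk_class:
  assumes "set w \<subseteq> darts G"
  shows "cycle_integral G L \<alpha> (walk_class w) = walk_integral L \<alpha> w"
  using assms
proof (induction w)
  case (Cons b w)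
  then have b: "fst b \<in> arcs G" by (auto simp: darts_def)
  have "cycle_integral G L \<alpha> (walk_class (b # w)) =
      (\<Sum>e\<in>arcs G. (if e = fst b then dart_flux L \<alpha> b else 0) + walk_class w e * integral {0..L e} (\<alpha> e))"
    unfolding cycle_integral_def
    by (intro sum.cong refl) (auto simp: walk_class_Cons dart_flux_def distrib_right)
  also have "\<dots> = dart_flux L \<alpha> b + walk_integral L \<alpha> w"
    using Cons b by (simp add: sum.distrib cycle_integral_def)
  finally show ?case by (simp add: walk_integral_alt)
qed (simp add: cycle_integral_def walk_integral_alt)

lemma walk_boundary:
  assumes "walk G u w v"
  shows "(\<Sum>e\<in>in_arcs G x. walk_class w e) - (\<Sum>e\<in>out_arcs G x. walk_class w e) =
    (if x = v then 1 else 0) - (if x = u then 1 else 0)"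
  using assms
proof (induction w arbitrary: u)
  case (Cons b w)
  obtain f s where b: "b = (f, s)" by (cases b)
  have f: "f \<in> arcs G" using Cons.prems b by (simp add: darts_def)
  define \<delta> :: "'b \<Rightarrow> int" where "\<delta> e = (if f = e then if s then 1 else - 1 else 0)" for e
  have \<delta>_sums: "(\<Sum>e\<in>in_arcs G x. \<delta> e) = (if head G f = x then if s then 1 else - 1 else 0)"
    "(\<Sum>e\<in>out_arcs G x. \<delta> e) = (if tail G f = x then if s then 1 else - 1 else 0)"
    unfolding \<delta>_def using f by (simp_all add: sum.delta'[OF finite_in_arcs] sum.delta'[OF finite_out_arcs])
  have "origin G b = u" using Cons.prems by (simp only: walk.simps)
  moreover have "origin G b = (if s then tail G f else head G f)" by (simp add: b origin_def)
  ultimately have u: "u = (if s then tail G f else head G f)" by (simp only:)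
  have ends: "origin G (reverse b) = (if s then head G f else tail G f)"
    by (simp add: b origin_def reverse_def)
  have 1: "(\<Sum>e\<in>in_arcs G x. \<delta> e) - (\<Sum>e\<in>out_arcs G x. \<delta> e) =
      (if x = origin G (reverse b) then 1 else 0) - (if x = u then 1 else 0)"
    unfolding \<delta>_sums ends u by (simp add: eq_commute[of x])
  have 2: "(\<Sum>e\<in>in_arcs G x. walk_class w e) - (\<Sum>e\<in>out_arcs G x. walk_class w e) =
      (if x = v then 1 else 0) - (if x = origin G (reverse b) then 1 else 0)"
    using Cons.IH[of "origin G (reverse b)"] Cons.prems by simp
  have "walk_class (b # w) e = \<delta> e + walk_class w e" for e
    by (simp add: walk_class_Cons b \<delta>_def)
  then show ?case using 1 2 by (simp only: sum.distrib)
qed auto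

lemma walk_class_in_homology1:
  assumes "walk G v w v"
  shows "walk_class w \<in> carrier (homology1 G)"
proof -
  have "walk_class w e = 0" if "e \<notin> arcs G" for e
    using walk_class_support[OF walk_set[OF assms] that] .
  then show ?thesis using walk_boundary[OF assms] by (simp add: homology1_def)
qed

text \<open>
  In a connected graph every cycle \<open>c\<close> is the class of a closed walk. Choose paths \<open>p v\<close> from a base
  point to the vertices \<open>v\<close>; then \<open>c\<close> is the sum of \<open>c e\<close> times the loops that run along \<open>p (tail e)\<close>,
  \<open>e\<close> and back along \<open>p (head e)\<close>, because the contributions of the paths cancel.
\<close>

lemma cycle_is_walk_class:
  assumes conn: "connected G" and c: "c \<in> carrier (homology1 G)" and v0: "v0 \<in> verts G"
  obtains w where "walk G v0 w v0" "walk_class w = c"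
proof -
  have "\<exists>w. walk G v0 w v" if "v \<in> verts G" for v
    using conn v0 that unfolding connected_iff_walk by blast
  then obtain p where p: "\<And>v. v \<in> verts G \<Longrightarrow> walk G v0 (p v) v" by metis
  define S where "S = {walk_class w | w. walk G v0 w v0}"
  have zero: "(\<lambda>e. 0) \<in> S"
  proof -
    have "walk G v0 [] v0" using v0 by simp
    then have "walk_class [] \<in> S" unfolding S_def by blast
    then show ?thesis by simp
  qed
  have add: "(\<lambda>e. a e + b e) \<in> S" if ab: "a \<in> S" "b \<in> S" for a b
  proof -
    obtain u w where uw: "walk G v0 u v0" "a = walk_class u" "walk G v0 w v0" "b = walk_class w"
      using ab by (auto simp: S_def)
    have "walk G v0 (u @ w) v0" using uw walk_append by blast
    moreover have "(\<lambda>e. a e + b e) = walk_class (u @ w)" using uw by (simp add: walk_class_append fun_eq_iff)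
    ultimately show ?thesis unfolding S_def by blast
  qed
  have uminus: "(\<lambda>e. - a e) \<in> S" if a: "a \<in> S" for a
  proof -
    obtain w where w: "walk G v0 w v0" "a = walk_class w" using a by (auto simp: S_def)
    have "(\<lambda>e. - a e) = walk_class (reverse_walk w)" using w by (simp add: walk_class_reverse fun_eq_iff)
    then show ?thesis using walk_reverse[OF w(1)] unfolding S_def by blast
  qed
  have nat_scale: "(\<lambda>e. int n * a e) \<in> S" if a: "a \<in> S" for n a
  proof (induction n)
    case 0
    then show ?case using zero by simp
  next
    case (Suc n)
    have "(\<lambda>e. a e + int n * a e) \<in> S" by (rule add[OF a Suc])
    then show ?case by (simp add: algebra_simps)
  qed
  have scale: "(\<lambda>e. n * a e) \<in> S" if a: "a \<in> S" for n :: int and a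
  proof (cases n)
    case (nonneg m)
    then show ?thesis using nat_scale[OF a, of m] by simp
  next
    case (neg m)
    then have "(\<lambda>e. n * a e) = (\<lambda>e. - (int (Suc m) * a e))" by (simp only: neg mult_minus_left)
    then show ?thesis using uminus[OF nat_scale[OF a, of "Suc m"]] by simp
  qed
  have sum: "(\<lambda>f. \<Sum>e\<in>A. g e f) \<in> S" if "finite A" "\<And>e. e \<in> A \<Longrightarrow> g e \<in> S" for A :: "'b set" and g
    using that
  proof (induction A rule: finite_induct)
    case (insert e A)
    have "(\<lambda>f. g e f + (\<Sum>e\<in>A. g e f)) \<in> S"
      using insert by (intro add) auto
    then show ?case using insert by simp
  qed (simp add: zero)
  \<comment> \<open>The walks from the base point to the ends of \<open>e\<close> close the edge \<open>e\<close> to a loop.\<close>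
  define loop where "loop e = p (tail G e) @ (e, True) # reverse_walk (p (head G e))" for e
  have loop: "walk_class (loop e) \<in> S" if e: "e \<in> arcs G" for e
  proof -
    have "walk G (tail G e) ((e, True) # reverse_walk (p (head G e))) v0"
      using e walk_reverse[OF p[of "head G e"]] by (simp add: darts_def origin_def reverse_def)
    then have "walk G v0 (loop e) v0"
      unfolding loop_def using p[of "tail G e"] e walk_append by auto
    then show ?thesis unfolding S_def by blast
  qed
  have "(\<lambda>f. \<Sum>e\<in>arcs G. c e * walk_class (loop e) f) \<in> S"
    by (rule sum) (auto intro: scale loop)
  moreover have "(\<Sum>e\<in>arcs G. c e * walk_class (loop e) f) = c f" for f
  proof -
    define P where "P v = walk_class (p v) f" for v
    have "(\<Sum>e\<in>arcs G. c e * walk_class (loop e) f) =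
        (\<Sum>e\<in>arcs G. (if e = f then c e else 0) + (c e * P (tail G e) - c e * P (head G e)))"
      by (intro sum.cong refl)
        (auto simp: loop_def walk_class_append walk_class_Cons walk_class_reverse P_def algebra_simps)
    also have "\<dots> = c f + ((\<Sum>e\<in>arcs G. c e * P (tail G e)) - (\<Sum>e\<in>arcs G. c e * P (head G e)))"
      using c by (auto simp: sum.distrib sum_subtractf homology1_def)
    also have "(\<Sum>e\<in>arcs G. c e * P (tail G e)) - (\<Sum>e\<in>arcs G. c e * P (head G e)) =
        - (\<Sum>e\<in>arcs G. c e * (P (head G e) - P (tail G e)))"
      by (simp add: right_diff_distrib sum_subtractf)
    also have "(\<Sum>e\<in>arcs G. c e * (P (head G e) - P (tail G e))) = 0"
      by (rule sum_gradient_eq_0) (use c in \<open>simp add: homology1_def\<close>)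
    finally show ?thesis by simp
  qed
  ultimately have "c \<in> S" by simp
  then show thesis using that by (auto simp: S_def)
qed

end


section \<open>Harmonic functions\<close>

lemma smooth_upto_zero: "smooth_upto l (\<lambda>x. 0)"
  unfolding smooth_upto_def by (rule exI[of _ "\<lambda>n x. 0"]) simp

context quantum_graph
begin

definition locally_constant :: "(('v, 'e) pre_digraph \<Rightarrow> complex) \<Rightarrow> ('v, 'e) point \<Rightarrow> complex" where
  "locally_constant x p = (\<Sum>H\<in>graph_components G. x H * (if p \<in> points H L then 1 else 0))"

lemma points_component:
  assumes "H \<in> graph_components G"
  shows "Vertex v \<in> points H L \<longleftrightarrow> v \<in> verts H"
    and "At e s \<in> points H L \<longleftrightarrow> e \<in> arcs H \<and> s \<in> {0..L e}"
  by (auto simp: points_def)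

lemma locally_constant_Vertex:
  assumes "H \<in> graph_components G" "v \<in> verts H"
  shows "locally_constant x (Vertex v) = x H"
proof -
  have "locally_constant x (Vertex v) = (\<Sum>H'\<in>graph_components G. if H' = H then x H' else 0)"
    unfolding locally_constant_def
  proof (intro sum.cong refl)
    fix H' assume H': "H' \<in> graph_components G"
    show "x H' * (if Vertex v \<in> points H' L then 1 else 0) = (if H' = H then x H' else 0)"
    proof (cases "H' = H")
      case False
      then have "v \<notin> verts H'" using component_unique[OF H' assms(1) _ assms(2)] by blast
      then show ?thesis using False points_component[OF H'] by simp
    qed (use assms points_component in simp)
  qed
  then show ?thesis using assms(1) finite_components by simp
qed

lemma locally_constant_At:
  assumes "H \<in> graph_components G" "e \<in> arcs H" "s \<in> {0..L e}"
  shows "locally_constant x (At e s) = x H"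
proof -
  have "locally_constant x (At e s) = (\<Sum>H'\<in>graph_components G. if H' = H then x H' else 0)"
    unfolding locally_constant_def
  proof (intro sum.cong refl)
    fix H' assume H': "H' \<in> graph_components G"
    show "x H' * (if At e s \<in> points H' L then 1 else 0) = (if H' = H then x H' else 0)"
    proof (cases "H' = H")
      case False
      then have "e \<notin> arcs H'" using component_unique_arc[OF H' assms(1) _ assms(2)] by blast
      then show ?thesis using False points_component[OF H'] by simp
    qed (use assms points_component in simp)
  qed
  then show ?thesis using assms(1) finite_components by simp
qed

lemma locally_constant_outside:
  assumes "p \<notin> points G L"
  shows "locally_constant x p = 0"
proof -
  have "p \<notin> points H L" if "H \<in> graph_components G" for H
    using assms component_subgraph[OF that] by (auto simp: points_def subgraph_def)
  then show ?thesis by (simp add: locally_constant_def)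
qed

lemma linear_locally_constant:
  "Vector_Spaces.linear (\<lambda>c f p. c * f p) (\<lambda>c f p. c * f p) locally_constant"
  by unfold_locales
    (auto simp: fun_eq_iff locally_constant_def distrib_right sum.distrib sum_distrib_left mult.assoc)

lemma locally_constant_eigenfunction: "locally_constant x \<in> eigenspace G L 0 0"
proof -
  define f where "f = locally_constant x"
  have edge: "\<exists>c. (\<forall>s\<in>{0..L e}. edgewise f e s = c) \<and> f (Vertex (tail G e)) = c \<and> f (Vertex (head G e)) = c"
    if e: "e \<in> arcs G" for e
  proof -
    obtain H where H: "H \<in> graph_components G" "e \<in> arcs H" by (rule component_of_arc[OF e])
    then have "tail G e \<in> verts H" "head G e \<in> verts H" using arcs_component by blast+
    then show ?thesis
      unfolding f_def edgewise_def
      using locally_constant_At[OF H] locally_constant_Vertex[OF H(1)] by blast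
  qed
  have sys: "edge_system (L e) ((0 :: 'e \<Rightarrow> real \<Rightarrow> real) e) 0 (edgewise f e) (\<lambda>s. 0)" if e: "e \<in> arcs G" for e
  proof -
    obtain c where c: "\<And>s. s \<in> {0..L e} \<Longrightarrow> edgewise f e s = c" using edge[OF e] by blast
    have "(edgewise f e has_vector_derivative 0) (at s within {0..L e})" if "s \<in> {0..L e}" for s
      by (rule has_vector_derivative_transform[OF that c has_vector_derivative_const])
    then show ?thesis by (simp add: edge_system_def)
  qed
  have s0: "smooth_upto (L e) ((0 :: 'e \<Rightarrow> real \<Rightarrow> real) e)" for e
    using smooth_upto_zero by (simp add: zero_fun_def)
  have eig: "sobolev2 (L e) (edgewise f e)" "\<And>s. s \<in> {0..L e} \<Longrightarrow> cov_deriv L 0 (edgewise f) e s = 0"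
    "\<And>s. s \<in> {0..L e} \<Longrightarrow> - cov_deriv L 0 (cov_deriv L 0 (edgewise f)) e s - 0 * edgewise f e s = 0"
    if e: "e \<in> arcs G" for e
    using eigenfunction_of_edge_system[where L = L and e = e and \<alpha> = 0 and u = "edgewise f" and z = 0,
        OF length_pos[OF e] s0 sys[OF e]] by blast+
  have ivl: "0 \<in> {0..L e}" "L e \<in> {0..L e}" if "e \<in> arcs G" for e
    using length_pos[OF that] by auto
  have deriv: "edge_deriv L (edgewise f) e s = 0" if "e \<in> arcs G" "s \<in> {0..L e}" for e s
    using eig(2)[OF that] by (simp add: cov_deriv_def)
  have "f \<in> continuous_functions G L"
    unfolding continuous_functions_def
  proof (intro CollectI conjI allI ballI impI)
    show "f p = 0" if "p \<notin> points G L" for p using locally_constant_outside[OF that] by (simp add: f_def)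
    fix e assume e: "e \<in> arcs G"
    then obtain c where c: "\<And>s. s \<in> {0..L e} \<Longrightarrow> edgewise f e s = c"
      "f (Vertex (tail G e)) = c" "f (Vertex (head G e)) = c" using edge[OF e] by blast
    have "continuous_on {0..L e} (edgewise f e) = continuous_on {0..L e} (\<lambda>s. c)"
      by (rule continuous_on_cong[OF refl c(1)])
    then show "continuous_on {0..L e} (edgewise f e)" by simp
    show "f (At e 0) = f (Vertex (tail G e))" "f (At e (L e)) = f (Vertex (head G e))"
      using c(1)[OF ivl(1)[OF e]] c(1)[OF ivl(2)[OF e]] c(2,3) by (simp_all add: edgewise_def)
  qed
  moreover have "kirchhoff G L (edge_deriv L (edgewise f))"
    unfolding kirchhoff_def using deriv ivl by simp
  moreover have "AE s in lebesgue_on {0..L e}. edgewise (shifted_laplacian L 0 0 f) e s = edgewise (\<lambda>p :: ('v, 'e) point. 0) e s"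
    if e: "e \<in> arcs G" for e
  proof (rule AE_I2)
    fix s assume "s \<in> space (lebesgue_on {0..L e})"
    then have "s \<in> {0..L e}" by simp
    from eig(3)[OF e this] show "edgewise (shifted_laplacian L 0 0 f) e s = edgewise (\<lambda>p :: ('v, 'e) point. 0) e s"
      by (simp add: shifted_laplacian_def laplacian_def edgewise_def)
  qed
  ultimately show ?thesis
    using eig(1) unfolding f_def[symmetric] eigenspace_def laplace_domain_def L2_eq_def
    by (simp add: shifted_laplacian_def laplacian_def)
qed

text \<open>
  A harmonic function is affine on every edge, and pairing its slopes with its differential gives
  \<open>\<Sum> \<bar>slope\<bar>\<^sup>2 L = 0\<close> by the Kirchhoff condition.
\<close>

lemma harmonic_function:
  assumes f: "f \<in> eigenspace G L 0 0"
  shows "\<And>p. p \<notin> points G L \<Longrightarrow> f p = 0"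
    and "\<And>e s. e \<in> arcs G \<Longrightarrow> s \<in> {0..L e} \<Longrightarrow> f (At e s) = f (Vertex (tail G e))"
    and "\<And>e. e \<in> arcs G \<Longrightarrow> f (Vertex (head G e)) = f (Vertex (tail G e))"
proof -
  have dom: "f \<in> laplace_domain G L" and l2: "L2_eq G L (shifted_laplacian L 0 0 f) (\<lambda>p. 0)"
    using f by (simp_all add: eigenspace_def)
  have cont: "\<And>p. p \<notin> points G L \<Longrightarrow> f p = 0"
    "\<And>e. e \<in> arcs G \<Longrightarrow> f (At e 0) = f (Vertex (tail G e))"
    "\<And>e. e \<in> arcs G \<Longrightarrow> f (At e (L e)) = f (Vertex (head G e))"
    and sob: "\<And>e. e \<in> arcs G \<Longrightarrow> sobolev2 (L e) (edgewise f e)"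
    and kirch: "kirchhoff G L (edge_deriv L (edgewise f))"
    using dom unfolding laplace_domain_def continuous_functions_def by blast+
  show "\<And>p. p \<notin> points G L \<Longrightarrow> f p = 0" by (fact cont(1))
  have s0: "smooth_upto (L e) ((0 :: 'e \<Rightarrow> real \<Rightarrow> real) e)" for e
    using smooth_upto_zero by (simp add: zero_fun_def)
  have sys: "edge_system (L e) (\<lambda>x. 0) 0 (edgewise f e) (edge_deriv L (edgewise f) e)" if e: "e \<in> arcs G" for e
  proof -
    have "AE s in lebesgue_on {0..L e}. - cov_deriv L 0 (cov_deriv L 0 (edgewise f)) e s - 0 * edgewise f e s = 0"
      using bspec[OF conjunct1[OF l2[unfolded L2_eq_def]] e]
      by (simp add: shifted_laplacian_def laplacian_def edgewise_def)
    from edge_system_of_eigenfunction[where u = "edgewise f" and \<alpha> = 0, OF length_pos[OF e] s0 sob[OF e] this]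
    have "edge_system (L e) (\<lambda>x. 0) 0 (edgewise f e) (cov_deriv L 0 (edgewise f) e)" by (simp add: zero_fun_def)
    moreover have "cov_deriv L 0 (edgewise f) e = edge_deriv L (edgewise f) e" by (simp add: cov_deriv_def fun_eq_iff)
    ultimately show ?thesis by simp
  qed
  define \<sigma> where "\<sigma> e = edge_deriv L (edgewise f) e 0" for e
  have ivl: "0 \<in> {0..L e}" "L e \<in> {0..L e}" if "e \<in> arcs G" for e
    using length_pos[OF that] by auto
  have slope: "edge_deriv L (edgewise f) e s = \<sigma> e" if e: "e \<in> arcs G" and s: "s \<in> {0..L e}" for e s
  proof -
    have "(edge_deriv L (edgewise f) e has_vector_derivative 0) (at s within {0..L e})" if "s \<in> {0..L e}" for s
      using sys[OF e] that by (simp add: edge_system_def)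
    from has_vector_derivative_zero_constant[OF convex_real_interval(5) this]
    obtain c where "\<And>s. s \<in> {0..L e} \<Longrightarrow> edge_deriv L (edgewise f) e s = c" by blast
    then show ?thesis using s ivl(1)[OF e] by (simp add: \<sigma>_def)
  qed
  have affine: "f (At e s) = f (Vertex (tail G e)) + of_real s * \<sigma> e" if e: "e \<in> arcs G" and s: "s \<in> {0..L e}" for e s
  proof -
    have "((\<lambda>s. edgewise f e s - of_real s * \<sigma> e) has_vector_derivative 0) (at s within {0..L e})" if "s \<in> {0..L e}" for s
    proof -
      have "(edgewise f e has_vector_derivative \<sigma> e) (at s within {0..L e})"
        using bspec[OF sys[OF e, unfolded edge_system_def] that] unfolding slope[OF e that] by simp
      moreover have "((\<lambda>s. of_real s * \<sigma> e) has_vector_derivative 1 * \<sigma> e) (at s within {0..L e})"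
        by (rule has_vector_derivative_mult_left[OF of_real_has_vector_derivative])
      ultimately have "((\<lambda>s. edgewise f e s - of_real s * \<sigma> e) has_vector_derivative (\<sigma> e - 1 * \<sigma> e)) (at s within {0..L e})"
        by (rule has_vector_derivative_diff)
      then show ?thesis by simp
    qed
    from has_vector_derivative_zero_constant[OF convex_real_interval(5) this]
    obtain c where c: "\<And>s. s \<in> {0..L e} \<Longrightarrow> edgewise f e s - of_real s * \<sigma> e = c" by blast
    have "f (At e 0) = c" using c[OF ivl(1)[OF e]] by (simp add: edgewise_def)
    moreover have "f (At e s) - of_real s * \<sigma> e = c" using c[OF s] by (simp add: edgewise_def)
    ultimately show ?thesis using cont(2)[OF e] by (simp add: diff_eq_eq)
  qed
  have balance: "(\<Sum>e\<in>in_arcs G v. cnj (\<sigma> e)) - (\<Sum>e\<in>out_arcs G v. cnj (\<sigma> e)) = 0" if v: "v \<in> verts G" for v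
  proof -
    have "(\<Sum>e\<in>in_arcs G v. \<sigma> e) - (\<Sum>e\<in>out_arcs G v. \<sigma> e) = 0"
      using kirch v slope ivl by (simp add: kirchhoff_def)
    then have "cnj ((\<Sum>e\<in>in_arcs G v. \<sigma> e) - (\<Sum>e\<in>out_arcs G v. \<sigma> e)) = 0" by simp
    then show ?thesis by simp
  qed
  have "(\<Sum>e\<in>arcs G. cnj (\<sigma> e) * (f (Vertex (head G e)) - f (Vertex (tail G e)))) = 0"
    by (rule sum_gradient_eq_0[where \<phi> = "\<lambda>v. f (Vertex v)", OF balance])
  moreover have "cnj (\<sigma> e) * (f (Vertex (head G e)) - f (Vertex (tail G e))) = complex_of_real (L e * (cmod (\<sigma> e))\<^sup>2)"
    if e: "e \<in> arcs G" for e
  proof -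
    have "f (Vertex (head G e)) - f (Vertex (tail G e)) = of_real (L e) * \<sigma> e"
      using affine[OF e ivl(2)[OF e]] cont(3)[OF e] by simp
    then show ?thesis by (simp only: of_real_mult complex_norm_square mult_ac)
  qed
  ultimately have "(\<Sum>e\<in>arcs G. complex_of_real (L e * (cmod (\<sigma> e))\<^sup>2)) = 0" by simp
  then have "complex_of_real (\<Sum>e\<in>arcs G. L e * (cmod (\<sigma> e))\<^sup>2) = 0" by (simp only: of_real_sum)
  then have "(\<Sum>e\<in>arcs G. L e * (cmod (\<sigma> e))\<^sup>2) = 0" by (simp only: of_real_eq_0_iff)
  moreover have "0 \<le> L e * (cmod (\<sigma> e))\<^sup>2" if "e \<in> arcs G" for e
    using length_pos[OF that] by simp
  ultimately have square: "L e * (cmod (\<sigma> e))\<^sup>2 = 0" if "e \<in> arcs G" for e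
    using that by (simp add: sum_nonneg_eq_0_iff)
  have \<sigma>0: "\<sigma> e = 0" if "e \<in> arcs G" for e
    using square[OF that] length_pos[OF that] by simp
  show "f (At e s) = f (Vertex (tail G e))" if "e \<in> arcs G" "s \<in> {0..L e}" for e s
    using affine[OF that] \<sigma>0[OF that(1)] by simp
  show "f (Vertex (head G e)) = f (Vertex (tail G e))" if "e \<in> arcs G" for e
    using affine[OF that ivl(2)[OF that]] \<sigma>0[OF that] cont(3)[OF that] by simp
qed

text \<open>
  By \<open>harmonic_function\<close>, the eigenfunctions for \<open>0\<close> are the locally constant functions.
\<close>

theorem dim_zero_eigenspace: "fs.dim (eigenspace G L 0 0) = card (graph_components G)"
proof -
  define S where "S = {x :: ('v, 'e) pre_digraph \<Rightarrow> complex. \<forall>H. H \<notin> graph_components G \<longrightarrow> x H = 0}"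
  have "eigenspace G L 0 0 \<subseteq> locally_constant ` S"
  proof
    fix f assume f: "f \<in> eigenspace G L 0 0"
    note harm = harmonic_function[OF f]
    have walk_const: "f (Vertex u) = f (Vertex v)" if "walk G u w v" for u w v
      using that
    proof (induction w arbitrary: u)
      case (Cons b w)
      obtain e s where b: "b = (e, s)" by (cases b)
      have e: "e \<in> arcs G" using Cons.prems b by (simp add: darts_def)
      have "f (Vertex (origin G (reverse b))) = f (Vertex (origin G b))"
        using harm(3)[OF e] by (cases s) (simp_all add: b origin_def reverse_def)
      then show ?case using Cons.IH[of "origin G (reverse b)"] Cons.prems by simp
    qed simp
    define base where "base H = (SOME v. v \<in> verts H)" for H :: "('v, 'e) pre_digraph"
    have base: "base H \<in> verts H" if "H \<in> graph_components G" for H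
      using component_nonempty[OF that] unfolding base_def by (rule someI_ex)
    define x where "x H = (if H \<in> graph_components G then f (Vertex (base H)) else 0)" for H
    have vertex: "f (Vertex v) = x H" if H: "H \<in> graph_components G" "v \<in> verts H" for v H
    proof -
      interpret H: wf_digraph H using component_subgraph[OF H(1)] by (simp add: subgraph_def)
      obtain w where "walk H v w (base H)"
        using component_connected[OF H(1)] H(2) base[OF H(1)] unfolding H.connected_iff_walk by blast
      then have "walk G v w (base H)" by (rule walk_subgraph[OF component_subgraph[OF H(1)]])
      then show ?thesis using walk_const H(1) by (simp add: x_def)
    qed
    have "f p = locally_constant x p" for p
    proof (cases "p \<in> points G L")
      case False
      then show ?thesis using harm(1) locally_constant_outside by simp
    next
      case True
      then consider v where "p = Vertex v" "v \<in> verts G" | e s where "p = At e s" "e \<in> arcs G" "s \<in> {0..L e}"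
        by (auto simp: points_def)
      then show ?thesis
      proof cases
        case (1 v)
        have "walk G v [] v" using 1 by simp
        then have "v \<in> verts (component_of v)" unfolding component_of_simps by blast
        then show ?thesis
          using vertex[OF component_of_in_components[OF 1(2)]] locally_constant_Vertex[OF component_of_in_components[OF 1(2)]] 1(1)
          by simp
      next
        case (2 e s)
        obtain H where H: "H \<in> graph_components G" "e \<in> arcs H" by (rule component_of_arc[OF 2(2)])
        then have "tail G e \<in> verts H" using arcs_component by blast
        then show ?thesis
          using harm(2)[OF 2(2,3)] vertex[OF H(1)] locally_constant_At[OF H 2(3)] 2(1) by simp
      qed
    qed
    then have "f = locally_constant x" by blast
    moreover have "x \<in> S" by (simp add: S_def x_def)
    ultimately show "f \<in> locally_constant ` S" by blast
  qed
  then have "eigenspace G L 0 0 = locally_constant ` S"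
    using locally_constant_eigenfunction by blast
  moreover have "inj_on locally_constant S"
  proof (rule inj_onI)
    fix x y assume x: "x \<in> S" and y: "y \<in> S" and eq: "locally_constant x = locally_constant y"
    have "x H = y H" for H
    proof (cases "H \<in> graph_components G")
      case True
      then obtain v where "v \<in> verts H" using component_nonempty by blast
      then show ?thesis
        using fun_cong[OF eq, of "Vertex v"] locally_constant_Vertex[OF True] by simp
    qed (use x y in \<open>simp add: S_def\<close>)
    then show "x = y" by blast
  qed
  moreover have "fs.subspace S" by (auto simp: fs.subspace_def S_def)
  ultimately have "fs.dim (eigenspace G L 0 0) = fs.dim S"
    using dim_linear_inj_image[OF linear_locally_constant] by simp
  also have "\<dots> = card (graph_components G)"
    unfolding S_def by (rule dim_supported[OF finite_components])
  finally show ?thesis .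
qed

end


section \<open>Generic forms\<close>

context quantum_graph
begin

definition edge_integrable :: "('e \<Rightarrow> real \<Rightarrow> real) \<Rightarrow> bool" where
  "edge_integrable \<beta> \<longleftrightarrow> (\<forall>e\<in>arcs G. \<beta> e integrable_on {0..L e})"

lemma one_form_integrable:
  assumes "\<beta> \<in> one_forms G L"
  shows "edge_integrable \<beta>"
  unfolding edge_integrable_def
proof
  fix e assume "e \<in> arcs G"
  then have "smooth_upto (L e) (\<beta> e)" using assms by (simp add: one_forms_def)
  then have "continuous_on {0..L e} (\<beta> e)" by (rule smooth_upto_C1)
  then show "\<beta> e integrable_on {0..L e}" by (rule integrable_continuous_interval)
qed

lemma cycle_integral_add:
  assumes "edge_integrable \<beta>" "edge_integrable \<gamma>"
  shows "edge_integrable (\<beta> + \<gamma>)"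
    and "cycle_integral G L (\<beta> + \<gamma>) c = cycle_integral G L \<beta> c + cycle_integral G L \<gamma> c"
proof -
  have fn: "(\<beta> + \<gamma>) e = (\<lambda>x. \<beta> e x + \<gamma> e x)" for e by (simp add: plus_fun_def)
  show "edge_integrable (\<beta> + \<gamma>)"
    using assms unfolding edge_integrable_def fn by (blast intro: integrable_add)
  have "integral {0..L e} ((\<beta> + \<gamma>) e) = integral {0..L e} (\<beta> e) + integral {0..L e} (\<gamma> e)" if "e \<in> arcs G" for e
    unfolding fn by (rule integral_add) (use assms that in \<open>simp_all add: edge_integrable_def\<close>)
  then show "cycle_integral G L (\<beta> + \<gamma>) c = cycle_integral G L \<beta> c + cycle_integral G L \<gamma> c"
    by (simp add: cycle_integral_def sum.distrib[symmetric] distrib_left)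
qed

lemma differential_integral:
  assumes f: "f \<in> zero_forms G L" and e: "e \<in> arcs G"
  shows "(differential G L f e has_integral f (Vertex (head G e)) - f (Vertex (tail G e))) {0..L e}"
proof -
  have "smooth_upto (L e) (edgewise f e)" using assms by (simp add: zero_forms_def)
  then obtain f' where f': "\<And>x. x \<in> {0..L e} \<Longrightarrow> (edgewise f e has_vector_derivative f' x) (at x within {0..L e})"
    using smooth_upto_C1 by blast
  have eq: "f' x = differential G L f e x" if "x \<in> {0..L e}" for x
    using vector_derivative_within_closed_interval[OF length_pos[OF e] that f'[OF that]] that e
    by (simp add: differential_def edge_deriv_def)
  have ends: "f (At e 0) = f (Vertex (tail G e))" "f (At e (L e)) = f (Vertex (head G e))"
    using assms by (simp_all add: zero_forms_def continuous_functions_def)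
  have "(f' has_integral edgewise f e (L e) - edgewise f e 0) {0..L e}"
    by (rule fundamental_theorem_of_calculus[OF less_imp_le[OF length_pos[OF e]] f'])
  from has_integral_eq[OF eq this] show ?thesis
    unfolding edgewise_def ends by simp
qed

lemma exact_form_cycle_integral:
  assumes d: "d \<in> exact_forms G L"
  shows "edge_integrable d"
    and "c \<in> carrier (homology1 G) \<Longrightarrow> cycle_integral G L d c = 0"
proof -
  obtain f where f: "f \<in> zero_forms G L" "d = differential G L f"
    using d unfolding exact_forms_def by blast
  show "edge_integrable d"
    using differential_integral[OF f(1)] unfolding f(2) edge_integrable_def integrable_on_def by blast
  assume c: "c \<in> carrier (homology1 G)"
  have "cycle_integral G L d c =
      (\<Sum>e\<in>arcs G. of_int (c e) * (f (Vertex (head G e)) - f (Vertex (tail G e))))"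
    unfolding cycle_integral_def f(2)
    by (rule sum.cong[OF refl]) (simp only: integral_unique[OF differential_integral[OF f(1)]])
  also have "\<dots> = 0"
  proof (rule sum_gradient_eq_0[where \<phi> = "\<lambda>v. f (Vertex v)"])
    fix v assume "v \<in> verts G"
    then have "(\<Sum>e\<in>in_arcs G v. c e) - (\<Sum>e\<in>out_arcs G v. c e) = 0"
      using c by (simp add: homology1_def)
    then have "of_int ((\<Sum>e\<in>in_arcs G v. c e) - (\<Sum>e\<in>out_arcs G v. c e)) = (0 :: real)"
      by (simp only: of_int_0)
    then show "(\<Sum>e\<in>in_arcs G v. of_int (c e)) - (\<Sum>e\<in>out_arcs G v. of_int (c e)) = (0 :: real)"
      by (simp only: of_int_diff of_int_sum)
  qed
  finally show "cycle_integral G L d c = 0" .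
qed

lemma component_in_arcs:
  assumes "H \<in> graph_components G" "v \<in> verts H"
  shows "in_arcs H v = in_arcs G v" "out_arcs H v = out_arcs G v"
proof -
  have ht: "head H = head G" "tail H = tail G"
    using component_eq[OF assms] component_of_simps by metis+
  show "in_arcs H v = in_arcs G v" "out_arcs H v = out_arcs G v"
    using arcs_component[OF assms(1)] assms(2) unfolding in_arcs_def out_arcs_def ht by blast+
qed

lemma component_verts_subset: "H \<in> graph_components G \<Longrightarrow> verts H \<subseteq> verts G \<and> arcs H \<subseteq> arcs G"
  using component_subgraph by (simp add: subgraph_def)

lemma restrict_cycle:
  assumes H: "H \<in> graph_components G" and c: "c \<in> carrier (homology1 G)"
  shows "(\<lambda>e. if e \<in> arcs H then c e else 0) \<in> carrier (homology1 H)"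
proof -
  have "(\<Sum>e\<in>in_arcs H v. if e \<in> arcs H then c e else 0) - (\<Sum>e\<in>out_arcs H v. if e \<in> arcs H then c e else 0) = 0"
    if v: "v \<in> verts H" for v
  proof -
    have "(\<Sum>e\<in>in_arcs H v. if e \<in> arcs H then c e else 0) = (\<Sum>e\<in>in_arcs G v. c e)"
      "(\<Sum>e\<in>out_arcs H v. if e \<in> arcs H then c e else 0) = (\<Sum>e\<in>out_arcs G v. c e)"
      unfolding component_in_arcs[OF H v, symmetric] by (auto intro!: sum.cong)
    moreover have "v \<in> verts G" using component_verts_subset[OF H] v by blast
    ultimately show ?thesis using c by (simp add: homology1_def)
  qed
  then show ?thesis by (simp add: homology1_def)
qed

lemma extend_cycle:
  assumes H: "H \<in> graph_components G" and c: "c \<in> carrier (homology1 H)"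
  shows "c \<in> carrier (homology1 G)"
proof -
  have sup: "c e = 0" if "e \<notin> arcs H" for e using c that by (simp add: homology1_def)
  have "(\<Sum>e\<in>in_arcs G v. c e) - (\<Sum>e\<in>out_arcs G v. c e) = 0" for v
  proof (cases "v \<in> verts H")
    case True
    have "(\<Sum>e\<in>in_arcs H v. c e) - (\<Sum>e\<in>out_arcs H v. c e) = 0"
      using c True by (simp add: homology1_def)
    then show ?thesis unfolding component_in_arcs[OF H True] .
  next
    case False
    then have "c e = 0" if "e \<in> in_arcs G v \<or> e \<in> out_arcs G v" for e
      using sup[of e] arcs_component[OF H, of e] that by auto
    then show ?thesis by simp
  qed
  then show ?thesis using sup component_verts_subset[OF H] by (auto simp: homology1_def)
qed

lemma cycle_integral_component:
  assumes H: "H \<in> graph_components G" and c: "c \<in> carrier (homology1 H)"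
  shows "cycle_integral H L \<alpha> c = cycle_integral G L \<alpha> c"
  unfolding cycle_integral_def
proof (rule sum.mono_neutral_left)
  show "arcs H \<subseteq> arcs G" using component_verts_subset[OF H] by blast
  show "\<forall>e\<in>arcs G - arcs H. of_int (c e) * integral {0..L e} (\<alpha> e) = 0"
    using c by (simp add: homology1_def)
qed simp

lemma cycle_in_component_is_walk_class:
  assumes H: "H \<in> graph_components G" and c: "c \<in> carrier (homology1 H)"
  obtains v w where "v \<in> verts H" "walk H v w v" "walk_class w = c"
proof -
  obtain v where v: "v \<in> verts H" using component_nonempty[OF H] by blast
  show ?thesis
    by (rule fin_digraph.cycle_is_walk_class[OF fin_digraph_component[OF H] component_connected[OF H] c v])
      (rule that[OF v])
qed

text \<open>
  Only a cycle in a connected graph is the class of a closed walk; any other cycle is the sum of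
  its restrictions to the components.
\<close>

lemma integral_periods:
  assumes periods: "\<And>w. closed_walk G w \<Longrightarrow> walk_integral L \<gamma> w \<in> \<int>" and c: "c \<in> carrier (homology1 G)"
  shows "cycle_integral G L \<gamma> c \<in> \<int>"
proof -
  define r where "r H e = (if e \<in> arcs H then c e else 0)" for H :: "('v, 'e) pre_digraph" and e
  have part: "cycle_integral G L \<gamma> (r H) \<in> \<int>" if H: "H \<in> graph_components G" for H
  proof -
    have "r H \<in> carrier (homology1 H)" using restrict_cycle[OF H c] unfolding r_def .
    then obtain v w where w: "walk H v w v" "walk_class w = r H"
      using cycle_in_component_is_walk_class[OF H] by blast
    have wG: "walk G v w v" by (rule walk_subgraph[OF component_subgraph[OF H] w(1)])
    then have "closed_walk G w" unfolding closed_walk_iff by blast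
    from periods[OF this] show ?thesis
      unfolding cycle_integral_walk_class[OF walk_set[OF wG], unfolded w(2)] .
  qed
  have "(\<Sum>H\<in>graph_components G. r H e) = c e" if e: "e \<in> arcs G" for e
  proof -
    obtain H where H: "H \<in> graph_components G" "e \<in> arcs H" by (rule component_of_arc[OF e])
    have "r H' e = (if H' = H then c e else 0)" if H': "H' \<in> graph_components G" for H'
    proof (cases "H' = H")
      case False
      then have "e \<notin> arcs H'" using component_unique_arc[OF H' H(1) _ H(2)] by blast
      with False show ?thesis by (simp only: r_def if_False)
    qed (use H(2) in \<open>simp add: r_def\<close>)
    then have "(\<Sum>H'\<in>graph_components G. r H' e) = (\<Sum>H'\<in>graph_components G. if H' = H then c e else 0)"
      by (rule sum.cong[OF refl])
    then show ?thesis using H(1) finite_components by simp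
  qed
  then have "cycle_integral G L \<gamma> c =
      (\<Sum>e\<in>arcs G. of_int (\<Sum>H\<in>graph_components G. r H e) * integral {0..L e} (\<gamma> e))"
    by (simp add: cycle_integral_def)
  also have "\<dots> = (\<Sum>H\<in>graph_components G. cycle_integral G L \<gamma> (r H))"
    unfolding cycle_integral_def of_int_sum sum_distrib_right by (rule sum.swap)
  also have "\<dots> \<in> \<int>" by (rule Ints_sum[OF part])
  finally show ?thesis .
qed

lemma zero_in_exact_forms: "0 \<in> exact_forms G L"
proof -
  have deriv: "edge_deriv L (edgewise (\<lambda>p :: ('v, 'e) point. 0 :: real)) e x = 0" if "e \<in> arcs G" "x \<in> {0..L e}" for e x
    unfolding edge_deriv_def edgewise_def
    by (rule vector_derivative_within_closed_interval[OF length_pos[OF that(1)] that(2) has_vector_derivative_const])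
  have ivl: "0 \<in> {0..L e}" "L e \<in> {0..L e}" if "e \<in> arcs G" for e
    using length_pos[OF that] by auto
  have smooth: "smooth_upto (L e) (edgewise (\<lambda>p :: ('v, 'e) point. 0 :: real) e)" for e
    using smooth_upto_zero by (simp add: edgewise_def[abs_def])
  have "(\<lambda>p :: ('v, 'e) point. 0 :: real) \<in> zero_forms G L"
    unfolding zero_forms_def continuous_functions_def kirchhoff_def
    using smooth deriv ivl by (simp add: edgewise_def)
  moreover have "differential G L (\<lambda>p. 0) = 0"
    using deriv by (simp add: differential_def fun_eq_iff)
  ultimately show ?thesis unfolding exact_forms_def by (metis image_eqI)
qed

text \<open>
  The two forms differ by an exact form and a form with integral periods.
\<close>

lemma torus_class_eqD:
  assumes \<beta>: "\<beta> \<in> one_forms G L" and \<beta>': "\<beta>' \<in> one_forms G L"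
    and eq: "torus_class G L \<beta> = torus_class G L \<beta>'" and c: "c \<in> carrier (homology1 G)"
  shows "cycle_integral G L \<beta> c - cycle_integral G L \<beta>' c \<in> \<int>"
proof -
  have coset: "exact_forms G L #>\<^bsub>one_form_group G L\<^esub> \<gamma> = {d + \<gamma> | d. d \<in> exact_forms G L}" for \<gamma>
    by (auto simp: r_coset_def one_form_group_def)
  have product: "A \<otimes>\<^bsub>de_rham G L\<^esub> B = {a + b | a b. a \<in> A \<and> b \<in> B}" for A B
    by (auto simp: de_rham_def FactGroup_def set_mult_def one_form_group_def)
  have "walk_integral L d w = 0" if d: "d \<in> exact_forms G L" and closed: "closed_walk G w" for d w
  proof -
    obtain v where w: "walk G v w v" using closed closed_walk_iff by blast
    show ?thesis
      using exact_form_cycle_integral(2)[OF d walk_class_in_homology1[OF w]]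
        cycle_integral_walk_class[OF walk_set[OF w]] by simp
  qed
  moreover have "exact_forms G L \<in> carrier (de_rham G L)"
  proof -
    have "exact_forms G L = exact_forms G L #>\<^bsub>one_form_group G L\<^esub> 0" by (simp add: coset)
    moreover have "0 \<in> carrier (one_form_group G L)"
      by (simp add: one_form_group_def one_forms_def kirchhoff_def zero_fun_def smooth_upto_zero)
    ultimately show ?thesis unfolding de_rham_def FactGroup_def RCOSETS_def by auto
  qed
  ultimately have E: "exact_forms G L \<in> de_rham_int G L" by (simp add: de_rham_int_def)
  have "exact_forms G L \<otimes>\<^bsub>de_rham G L\<^esub> {d + \<beta> | d. d \<in> exact_forms G L} \<in> torus_class G L \<beta>"
    unfolding torus_class_def coset r_coset_def[of "de_rham G L"] using E by blast
  then obtain D where D: "D \<in> de_rham_int G L"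
    and eqD: "exact_forms G L \<otimes>\<^bsub>de_rham G L\<^esub> {d + \<beta> | d. d \<in> exact_forms G L} =
      D \<otimes>\<^bsub>de_rham G L\<^esub> {d + \<beta>' | d. d \<in> exact_forms G L}"
    unfolding eq unfolding torus_class_def coset r_coset_def[of "de_rham G L"] by blast
  have "0 + (0 + \<beta>) \<in> exact_forms G L \<otimes>\<^bsub>de_rham G L\<^esub> {d + \<beta> | d. d \<in> exact_forms G L}"
    unfolding product using zero_in_exact_forms by blast
  then obtain \<gamma> d where \<gamma>: "\<gamma> \<in> D" and d: "d \<in> exact_forms G L" and sum: "\<beta> = \<gamma> + (d + \<beta>')"
    unfolding eqD unfolding product by auto
  have "D \<in> carrier (de_rham G L)" using D by (simp add: de_rham_int_def)
  then obtain \<delta> where \<delta>: "\<delta> \<in> one_forms G L" "D = {d + \<delta> | d. d \<in> exact_forms G L}"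
    unfolding de_rham_def FactGroup_def RCOSETS_def coset by (auto simp: one_form_group_def)
  then obtain d' where d': "d' \<in> exact_forms G L" "\<gamma> = d' + \<delta>" using \<gamma> by blast
  have int: "edge_integrable \<gamma>" "edge_integrable d" "edge_integrable \<beta>'" "edge_integrable (d + \<beta>')"
    using one_form_integrable[OF \<delta>(1)] one_form_integrable[OF \<beta>'] exact_form_cycle_integral(1)[OF d]
      exact_form_cycle_integral(1)[OF d'(1)] cycle_integral_add(1) d'(2) by blast+
  have "cycle_integral G L \<beta> c - cycle_integral G L \<beta>' c = cycle_integral G L \<gamma> c"
    unfolding sum cycle_integral_add(2)[OF int(1,4)] cycle_integral_add(2)[OF int(2,3)]
      exact_form_cycle_integral(2)[OF d c] by simp
  also have "\<dots> \<in> \<int>"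
    using integral_periods[OF _ c] D \<gamma> by (auto simp: de_rham_int_def)
  finally show ?thesis .
qed

text \<open>
  For \<open>s = 1\<close>, this is the harmonic form that corresponds to the cycle \<open>c\<close>.
\<close>

definition cycle_form :: "real \<Rightarrow> ('e \<Rightarrow> int) \<Rightarrow> 'e \<Rightarrow> real \<Rightarrow> real" where
  "cycle_form s c e x = (if e \<in> arcs G \<and> x \<in> {0..L e} then s * of_int (c e) else 0)"

lemma cycle_form_in_one_forms:
  assumes c: "c \<in> carrier (homology1 G)"
  shows "cycle_form s c \<in> one_forms G L"
proof -
  have "smooth_upto (L e) (cycle_form s c e)" if e: "e \<in> arcs G" for e
    unfolding smooth_upto_def
    by (rule exI[of _ "\<lambda>n x. if n = 0 then s * of_int (c e) else 0"]) (simp add: cycle_form_def e)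
  moreover have "kirchhoff G L (cycle_form s c)"
    unfolding kirchhoff_def
  proof
    fix v assume "v \<in> verts G"
    then have bal: "(\<Sum>e\<in>in_arcs G v. c e) - (\<Sum>e\<in>out_arcs G v. c e) = 0"
      using c by (simp add: homology1_def)
    have pos: "0 \<le> L e" if "e \<in> arcs G" for e using length_pos[OF that] by simp
    have "(\<Sum>e\<in>in_arcs G v. cycle_form s c e (L e)) = s * of_int (\<Sum>e\<in>in_arcs G v. c e)"
      "(\<Sum>e\<in>out_arcs G v. cycle_form s c e 0) = s * of_int (\<Sum>e\<in>out_arcs G v. c e)"
      unfolding of_int_sum sum_distrib_left using pos by (auto intro!: sum.cong simp: cycle_form_def)
    moreover have "s * of_int ((\<Sum>e\<in>in_arcs G v. c e) - (\<Sum>e\<in>out_arcs G v. c e)) = 0"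
      unfolding bal by simp
    ultimately show "(\<Sum>e\<in>in_arcs G v. cycle_form s c e (L e)) - (\<Sum>e\<in>out_arcs G v. cycle_form s c e 0) = 0"
      by (simp only: of_int_diff right_diff_distrib)
  qed
  ultimately show ?thesis by (simp add: one_forms_def cycle_form_def)
qed

lemma cycle_integral_cycle_form:
  "cycle_integral G L (cycle_form s c) c = s * (\<Sum>e\<in>arcs G. (of_int (c e))\<^sup>2 * L e)"
proof -
  have "integral {0..L e} (cycle_form s c e) = s * of_int (c e) * L e" if e: "e \<in> arcs G" for e
  proof -
    have "integral {0..L e} (cycle_form s c e) = integral {0..L e} (\<lambda>x. s * of_int (c e))"
      by (rule integral_cong) (simp add: cycle_form_def e)
    then show ?thesis using length_pos[OF e] by simp
  qed
  then show ?thesis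
    unfolding cycle_integral_def sum_distrib_left
    by (intro sum.cong refl) (simp add: power2_eq_square mult_ac)
qed

lemma cycle_integral_bound:
  assumes "\<alpha> \<in> one_forms G L" "\<beta> \<in> one_forms G L"
    and close: "\<And>e x. e \<in> arcs G \<Longrightarrow> x \<in> {0..L e} \<Longrightarrow> \<bar>\<beta> e x - \<alpha> e x\<bar> \<le> \<epsilon>"
  shows "\<bar>cycle_integral G L \<beta> c - cycle_integral G L \<alpha> c\<bar> \<le> (\<Sum>e\<in>arcs G. \<bar>of_int (c e)\<bar> * L e) * \<epsilon>"
proof -
  have int: "\<alpha> e integrable_on {0..L e}" "\<beta> e integrable_on {0..L e}" if "e \<in> arcs G" for e
    using assms(1,2) that one_form_integrable by (auto simp: edge_integrable_def)
  have edge: "\<bar>integral {0..L e} (\<beta> e) - integral {0..L e} (\<alpha> e)\<bar> \<le> \<epsilon> * L e" if e: "e \<in> arcs G" for e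
  proof -
    have "((\<lambda>x. \<beta> e x - \<alpha> e x) has_integral integral {0..L e} (\<beta> e) - integral {0..L e} (\<alpha> e)) {0..L e}"
      by (intro has_integral_diff integrable_integral int e)
    moreover have "0 \<le> \<epsilon>" using close[OF e, of 0] length_pos[OF e] by fastforce
    ultimately have "norm (integral {0..L e} (\<beta> e) - integral {0..L e} (\<alpha> e)) \<le> \<epsilon> * measure lborel {0..L e}"
      by (intro has_integral_bound_real[where S = "{}"]) (use close[OF e] in auto)
    then show ?thesis using length_pos[OF e] by simp
  qed
  have "\<bar>cycle_integral G L \<beta> c - cycle_integral G L \<alpha> c\<bar> =
      \<bar>\<Sum>e\<in>arcs G. of_int (c e) * (integral {0..L e} (\<beta> e) - integral {0..L e} (\<alpha> e))\<bar>"
    by (simp add: cycle_integral_def sum_subtractf right_diff_distrib)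
  also have "\<dots> \<le> (\<Sum>e\<in>arcs G. \<bar>of_int (c e)\<bar> * (\<epsilon> * L e))"
    by (rule order_trans[OF sum_abs], rule sum_mono) (simp add: abs_mult edge mult_left_mono)
  finally show ?thesis by (simp add: sum_distrib_right sum_distrib_left mult_ac)
qed

text \<open>
  The function \<open>\<beta> \<mapsto> \<integral>\<^sub>c \<beta> mod \<int>\<close> is a character of the torus. If it were trivial on the ray
  of a generic form, it would be trivial, whereas multiples of the harmonic form dual to \<open>c\<close>
  give it every value.
\<close>

theorem generic_cycle_integral_nonzero:
  assumes gen: "generic G L \<alpha>" and c: "c \<in> carrier (homology1 G)" and zero: "cycle_integral G L \<alpha> c = 0"
  shows "c = 0"
proof (rule ccontr)
  assume "c \<noteq> 0"
  define \<tau> where "\<tau> \<beta> = cycle_integral G L \<beta> c" for \<beta>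
  define U where "U = {torus_class G L \<beta> | \<beta>. \<beta> \<in> one_forms G L \<and> \<tau> \<beta> \<notin> \<int>}"
  have class_in_U: "\<tau> \<beta> \<notin> \<int>" if \<beta>: "\<beta> \<in> one_forms G L" and U: "torus_class G L \<beta> \<in> U" for \<beta>
  proof
    assume "\<tau> \<beta> \<in> \<int>"
    obtain \<gamma> where \<gamma>: "\<gamma> \<in> one_forms G L" "\<tau> \<gamma> \<notin> \<int>" "torus_class G L \<beta> = torus_class G L \<gamma>"
      using U unfolding U_def by blast
    from torus_class_eqD[OF \<beta> \<gamma>(1,3) c] have "\<tau> \<beta> - \<tau> \<gamma> \<in> \<int>" by (simp add: \<tau>_def)
    from Ints_diff[OF \<open>\<tau> \<beta> \<in> \<int>\<close> this] \<gamma>(2) show False by simp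
  qed
  have "torus_open G L U"
    unfolding torus_open_def
  proof (intro conjI ballI impI)
    show "U \<subseteq> carrier (torus G L)"
      by (auto simp: U_def torus_def torus_class_def FactGroup_def RCOSETS_def de_rham_def one_form_group_def)
    fix \<beta> assume \<beta>: "\<beta> \<in> one_forms G L" "torus_class G L \<beta> \<in> U"
    have "open (- \<int> :: real set)" using closed_Ints by (simp add: open_Compl)
    then obtain \<delta> where \<delta>: "\<delta> > 0" "\<And>y. dist y (\<tau> \<beta>) < \<delta> \<Longrightarrow> y \<in> - \<int>"
      using class_in_U[OF \<beta>] unfolding open_dist by (metis ComplI)
    define M where "M = (\<Sum>e\<in>arcs G. \<bar>of_int (c e)\<bar> * L e)"
    have M: "0 \<le> M" unfolding M_def by (intro sum_nonneg mult_nonneg_nonneg) (auto intro: less_imp_le length_pos)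
    show "\<exists>\<epsilon>>0. \<forall>\<gamma>\<in>one_forms G L. (\<forall>e\<in>arcs G. \<forall>x\<in>{0..L e}. \<bar>\<gamma> e x - \<beta> e x\<bar> < \<epsilon>) \<longrightarrow> torus_class G L \<gamma> \<in> U"
    proof (intro exI conjI ballI impI)
      show pos: "0 < \<delta> / (M + 1)" using \<delta>(1) M by simp
      fix \<gamma> assume \<gamma>: "\<gamma> \<in> one_forms G L" and close: "\<forall>e\<in>arcs G. \<forall>x\<in>{0..L e}. \<bar>\<gamma> e x - \<beta> e x\<bar> < \<delta> / (M + 1)"
      have "\<bar>\<tau> \<gamma> - \<tau> \<beta>\<bar> \<le> M * (\<delta> / (M + 1))"
        unfolding \<tau>_def M_def[symmetric] unfolding M_def
        by (rule cycle_integral_bound[OF \<beta>(1) \<gamma>]) (use close M_def in \<open>auto intro: less_imp_le\<close>)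
      also have "\<dots> < (M + 1) * (\<delta> / (M + 1))"
        by (rule mult_strict_right_mono[OF _ pos]) simp
      also have "\<dots> = \<delta>" using M by simp
      finally have "\<tau> \<gamma> \<notin> \<int>" using \<delta>(2)[of "\<tau> \<gamma>"] by (simp add: dist_real_def)
      then show "torus_class G L \<gamma> \<in> U" using \<gamma> unfolding U_def by blast
    qed
  qed
  then have open_U: "openin (torus_topology G L) U" by (simp add: openin_torus_topology)
  define S where "S = (\<Sum>e\<in>arcs G. (of_int (c e))\<^sup>2 * L e)"
  obtain e where e: "c e \<noteq> 0" using \<open>c \<noteq> 0\<close> by (auto simp: fun_eq_iff)
  then have "e \<in> arcs G" using c by (auto simp: homology1_def)
  have "0 < S" unfolding S_def
  proof (rule sum_pos2[OF finite_arcs \<open>e \<in> arcs G\<close>])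
    show "0 < (of_int (c e))\<^sup>2 * L e" using e length_pos[OF \<open>e \<in> arcs G\<close>] by simp
    show "0 \<le> (of_int (c i))\<^sup>2 * L i" if "i \<in> arcs G" for i using length_pos[OF that] by simp
  qed
  define \<beta> where "\<beta> = cycle_form (1 / (2 * S)) c"
  have "\<tau> \<beta> = 1 / 2" using \<open>0 < S\<close> unfolding \<tau>_def \<beta>_def cycle_integral_cycle_form S_def[symmetric] by simp
  moreover have "(1 / 2 :: real) \<notin> \<int>"
  proof
    assume "(1 / 2 :: real) \<in> \<int>"
    then obtain n :: int where "(1 / 2 :: real) = of_int n" by (rule Ints_cases)
    then have "(1 :: real) = of_int (2 * n)" by simp
    then have "1 = 2 * n" by linarith
    then show False by presburger
  qed
  ultimately have "\<tau> \<beta> \<notin> \<int>" by (simp only: not_False_eq_True)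
  moreover have "\<beta> \<in> one_forms G L" unfolding \<beta>_def by (rule cycle_form_in_one_forms[OF c])
  ultimately have \<beta>U: "torus_class G L \<beta> \<in> U" unfolding U_def by blast
  have "torus_class G L \<beta> \<in> torus_topology G L closure_of {torus_class G L (scale_form t \<alpha>) | t. t \<ge> 0}"
    using gen openin_subset[OF open_U] \<beta>U unfolding generic_def by blast
  then obtain t where t: "torus_class G L (scale_form t \<alpha>) \<in> U"
    unfolding in_closure_of using open_U \<beta>U by blast
  have "\<alpha> \<in> one_forms G L" using gen by (simp add: generic_def)
  from class_in_U[OF scale_form_in_one_forms[OF this] t]
  have "\<tau> (scale_form t \<alpha>) \<notin> \<int>" .
  moreover have "\<tau> (scale_form t \<alpha>) = t * \<tau> \<alpha>"
    by (simp add: \<tau>_def cycle_integral_def scale_form_def sum_distrib_left mult_ac)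
  ultimately show False using zero by (simp add: \<tau>_def)
qed

end


section \<open>Matching the components\<close>

lemma cycle_integral_plus:
  "cycle_integral G L \<alpha> (c + d) = cycle_integral G L \<alpha> c + cycle_integral G L \<alpha> d"
  by (simp add: cycle_integral_def distrib_right sum.distrib)

lemma cycle_integral_minus:
  "cycle_integral G L \<alpha> (c - d) = cycle_integral G L \<alpha> c - cycle_integral G L \<alpha> d"
  by (simp add: cycle_integral_def left_diff_distrib sum_subtractf)

lemma cycle_plus:
  "c \<in> carrier (homology1 G) \<Longrightarrow> d \<in> carrier (homology1 G) \<Longrightarrow> c + d \<in> carrier (homology1 G)"
  by (simp add: homology1_def sum.distrib)

lemma cycle_minus:
  "c \<in> carrier (homology1 G) \<Longrightarrow> d \<in> carrier (homology1 G) \<Longrightarrow> c - d \<in> carrier (homology1 G)"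
  by (simp add: homology1_def sum_subtractf)

lemma zero_cycle: "0 \<in> carrier (homology1 G)"
  by (simp add: homology1_def)

lemma minimal_length_walk_class:
  assumes "minimal_orbit G L w"
  shows "minimal_length G L (walk_class w) = walk_length L w"
  unfolding minimal_length_def
proof (rule the_equality)
  show "\<exists>w'. minimal_orbit G L w' \<and> walk_class w' = walk_class w \<and> walk_length L w' = walk_length L w"
    using assms by blast
  fix l assume "\<exists>w'. minimal_orbit G L w' \<and> walk_class w' = walk_class w \<and> walk_length L w' = l"
  then obtain w' where w': "minimal_orbit G L w'" "walk_class w' = walk_class w" "walk_length L w' = l" by blast
  have "walk_length L w \<le> walk_length L w'" "walk_length L w' \<le> walk_length L w"
    using assms w'(1,2) unfolding minimal_orbit_def by metis+
  then show "l = walk_length L w" using w'(3) by simp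
qed

definition periods :: "('e \<Rightarrow> real) \<Rightarrow> ('e \<Rightarrow> real \<Rightarrow> real) \<Rightarrow> ('v, 'e) pre_digraph \<Rightarrow> real set" where
  "periods L \<alpha> H = cycle_integral H L \<alpha> ` carrier (homology1 H)"

lemma zero_period: "0 \<in> periods L \<alpha> H"
proof -
  have "cycle_integral H L \<alpha> 0 = 0" by (simp add: cycle_integral_def)
  then show ?thesis unfolding periods_def by (rule image_eqI[OF sym zero_cycle])
qed

lemma periods_plus: "x \<in> periods L \<alpha> H \<Longrightarrow> y \<in> periods L \<alpha> H \<Longrightarrow> x + y \<in> periods L \<alpha> H"
proof -
  assume "x \<in> periods L \<alpha> H" "y \<in> periods L \<alpha> H"
  then obtain c d where c: "c \<in> carrier (homology1 H)" "x = cycle_integral H L \<alpha> c"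
    and d: "d \<in> carrier (homology1 H)" "y = cycle_integral H L \<alpha> d"
    unfolding periods_def by blast
  show "x + y \<in> periods L \<alpha> H"
    unfolding periods_def c(2) d(2) cycle_integral_plus[symmetric] by (rule imageI[OF cycle_plus[OF c(1) d(1)]])
qed

lemma periods_minus: "x \<in> periods L \<alpha> H \<Longrightarrow> y \<in> periods L \<alpha> H \<Longrightarrow> x - y \<in> periods L \<alpha> H"
proof -
  assume "x \<in> periods L \<alpha> H" "y \<in> periods L \<alpha> H"
  then obtain c d where c: "c \<in> carrier (homology1 H)" "x = cycle_integral H L \<alpha> c"
    and d: "d \<in> carrier (homology1 H)" "y = cycle_integral H L \<alpha> d"
    unfolding periods_def by blast
  show "x - y \<in> periods L \<alpha> H"
    unfolding periods_def c(2) d(2) cycle_integral_minus[symmetric] by (rule imageI[OF cycle_minus[OF c(1) d(1)]])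
qed

context quantum_graph
begin

lemma period_of_closed_walk:
  assumes "closed_walk G w"
  obtains H where "H \<in> graph_components G" "walk_integral L \<alpha> w \<in> periods L \<alpha> H"
proof -
  obtain v where w: "walk G v w v" using assms closed_walk_iff by blast
  define H where "H = component_of v"
  have H: "H \<in> graph_components G" unfolding H_def by (rule component_of_in_components) (use walk_in_verts[OF w] in blast)
  have "walk G v [] v" using walk_in_verts[OF w] by simp
  then have "v \<in> verts H" unfolding H_def component_of_simps by blast
  then have wH: "walk H v w v" by (rule walk_component[OF H _ w])
  note fin = fin_digraph_component[OF H]
  have "cycle_integral H L \<alpha> (walk_class w) = walk_integral L \<alpha> w"
    by (rule fin_digraph.cycle_integral_walk_class[OF fin walk_set[OF wH]])
  then have "walk_integral L \<alpha> w \<in> periods L \<alpha> H"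
    unfolding periods_def by (rule image_eqI[OF sym fin_digraph.walk_class_in_homology1[OF fin wH]])
  then show ?thesis by (rule that[OF H])
qed

lemma minimal_walk_of_cycle:
  assumes H: "H \<in> graph_components G" and c: "c \<in> carrier (homology1 H)"
  obtains w where "flux_minimal G L \<alpha> w" "walk_integral L \<alpha> w = cycle_integral H L \<alpha> c"
proof -
  obtain v w0 where w0: "walk H v w0 v" "walk_class w0 = c"
    using cycle_in_component_is_walk_class[OF H c] by blast
  have "walk G v w0 v" by (rule walk_subgraph[OF component_subgraph[OF H] w0(1)])
  then have closed: "closed_walk G w0" unfolding closed_walk_iff by blast
  have int: "cycle_integral H L \<alpha> c = walk_integral L \<alpha> w0"
    using fin_digraph.cycle_integral_walk_class[OF fin_digraph_component[OF H] walk_set[OF w0(1)]] w0(2) by simp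
  obtain w where w: "flux_minimal G L \<alpha> w" "walk_integral L \<alpha> w = walk_integral L \<alpha> w0"
    by (rule exists_flux_minimal[OF closed])
  show ?thesis by (rule that[OF w(1)]) (simp only: int w(2))
qed

lemma minimal_length_zero:
  assumes H: "H \<in> graph_components G"
  shows "minimal_length H L 0 = 0"
proof -
  have wf: "wf_digraph H" using component_subgraph[OF H] by (simp add: subgraph_def)
  obtain v where "v \<in> verts H" using component_nonempty[OF H] by blast
  then have "walk H v [] v" by simp
  then have "closed_walk H []" unfolding wf_digraph.closed_walk_iff[OF wf] by blast
  moreover have "0 \<le> walk_length L w" if w: "closed_walk H w" for w
  proof -
    obtain u where "walk H u w u" using w unfolding wf_digraph.closed_walk_iff[OF wf] by blast
    then have "walk G u w u" by (rule walk_subgraph[OF component_subgraph[OF H]])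
    then have "set w \<subseteq> darts G" by (rule walk_set)
    then have "0 \<le> L (fst b)" if "b \<in> set w" for b
      using that length_pos by (force simp: darts_def intro: less_imp_le)
    then show ?thesis unfolding walk_length_alt by (intro sum_list_nonneg) auto
  qed
  ultimately have "minimal_orbit H L []" by (simp add: minimal_orbit_def walk_length_alt)
  from minimal_length_walk_class[OF this] show ?thesis by (simp add: walk_length_alt zero_fun_def)
qed

end

locale generic_quantum_graph = quantum_graph G L
  for G :: "('v, 'e) pre_digraph" and L +
  fixes \<alpha> :: "'e \<Rightarrow> real \<Rightarrow> real"
  assumes generic: "generic G L \<alpha>"
begin

lemma cycle_integral_inj:
  assumes "c \<in> carrier (homology1 G)" "d \<in> carrier (homology1 G)"
    and "cycle_integral G L \<alpha> c = cycle_integral G L \<alpha> d"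
  shows "c = d"
proof -
  have "cycle_integral G L \<alpha> (c - d) = 0" unfolding cycle_integral_minus using assms(3) by simp
  from generic_cycle_integral_nonzero[OF generic cycle_minus[OF assms(1,2)] this]
  show ?thesis by simp
qed

lemma cycle_integral_component_inj:
  assumes "H \<in> graph_components G"
  shows "inj_on (cycle_integral H L \<alpha>) (carrier (homology1 H))"
proof (rule inj_onI)
  fix c d assume c: "c \<in> carrier (homology1 H)" and d: "d \<in> carrier (homology1 H)"
    and eq: "cycle_integral H L \<alpha> c = cycle_integral H L \<alpha> d"
  show "c = d"
    using eq unfolding cycle_integral_component[OF assms c] cycle_integral_component[OF assms d]
    by (rule cycle_integral_inj[OF extend_cycle[OF assms c] extend_cycle[OF assms d]])
qed

text \<open>
  The sum of a non-trivial cycle in \<open>H\<^sub>1\<close> and one in \<open>H\<^sub>2\<close> meets both components, so it is not contained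
  in a third one; by genericity this is visible from the integrals.
\<close>

lemma periods_independent:
  assumes H: "H1 \<in> graph_components G" "H2 \<in> graph_components G" "H3 \<in> graph_components G"
    and x: "x \<in> periods L \<alpha> H1" "x \<noteq> 0" and y: "y \<in> periods L \<alpha> H2" "y \<noteq> 0"
    and xy: "x + y \<in> periods L \<alpha> H3"
  shows "H1 = H2"
proof (rule ccontr)
  assume ne: "H1 \<noteq> H2"
  obtain c1 c2 c3 where c: "c1 \<in> carrier (homology1 H1)" "c2 \<in> carrier (homology1 H2)" "c3 \<in> carrier (homology1 H3)"
    and int: "x = cycle_integral H1 L \<alpha> c1" "y = cycle_integral H2 L \<alpha> c2" "x + y = cycle_integral H3 L \<alpha> c3"
    using x(1) y(1) xy unfolding periods_def by blast
  note cG = extend_cycle[OF H(1) c(1)] extend_cycle[OF H(2) c(2)] extend_cycle[OF H(3) c(3)]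
  have "c1 + c2 = c3"
    using int unfolding cycle_integral_component[OF H(1) c(1)] cycle_integral_component[OF H(2) c(2)]
      cycle_integral_component[OF H(3) c(3)]
    by (intro cycle_integral_inj cycle_plus cG) (simp add: cycle_integral_plus)
  then have sum: "c3 e = c1 e + c2 e" for e by auto
  have sup: "e \<in> arcs H1" if "c1 e \<noteq> 0" for e using c(1) that by (auto simp: homology1_def)
  have sup2: "e \<in> arcs H2" if "c2 e \<noteq> 0" for e using c(2) that by (auto simp: homology1_def)
  have sup3: "e \<in> arcs H3" if "c3 e \<noteq> 0" for e using c(3) that by (auto simp: homology1_def)
  have disj: "c1 e = 0 \<or> c2 e = 0" for e
    using sup[of e] sup2[of e] component_unique_arc[OF H(1,2)] ne by blast
  have "c1 \<noteq> 0" using x(2) int(1) by (auto simp: cycle_integral_def)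
  then obtain e1 where e1: "c1 e1 \<noteq> 0" by (auto simp: fun_eq_iff)
  then have "c3 e1 \<noteq> 0" using disj[of e1] sum[of e1] by simp
  then have "H3 = H1" using component_unique_arc[OF H(3,1)] sup[OF e1] sup3 by blast
  have "c2 \<noteq> 0" using y(2) int(2) by (auto simp: cycle_integral_def)
  then obtain e2 where e2: "c2 e2 \<noteq> 0" by (auto simp: fun_eq_iff)
  then have "c3 e2 \<noteq> 0" using disj[of e2] sum[of e2] by simp
  then have "H3 = H2" using component_unique_arc[OF H(3,2)] sup2[OF e2] sup3 by blast
  with \<open>H3 = H1\<close> ne show False by simp
qed

lemma period_component_unique:
  assumes "H1 \<in> graph_components G" "H2 \<in> graph_components G"
    and x: "x \<in> periods L \<alpha> H1" "x \<in> periods L \<alpha> H2" "x \<noteq> 0"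
  shows "H1 = H2"
  by (rule periods_independent[OF assms(1,2,1) x(1,3,2,3) periods_plus[OF x(1,1)]])

lemma nonzero_period:
  assumes "periods L \<alpha> H \<noteq> {0}"
  obtains x where "x \<in> periods L \<alpha> H" "x \<noteq> 0"
  using assms zero_period by blast

lemma periods_inj: "inj_on (periods L \<alpha>) {H \<in> graph_components G. periods L \<alpha> H \<noteq> {0}}"
proof (rule inj_onI)
  fix H K
  assume H: "H \<in> {H \<in> graph_components G. periods L \<alpha> H \<noteq> {0}}"
    and K: "K \<in> {H \<in> graph_components G. periods L \<alpha> H \<noteq> {0}}"
    and eq: "periods L \<alpha> H = periods L \<alpha> K"
  have "periods L \<alpha> H \<noteq> {0}" using H by blast
  then obtain x where x: "x \<in> periods L \<alpha> H" "x \<noteq> 0" by (rule nonzero_period)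
  have "x \<in> periods L \<alpha> K" using x(1) unfolding eq .
  then show "H = K" using period_component_unique[OF _ _ x(1) _ x(2)] H K by blast
qed

text \<open>
  A closed walk in \<open>G\<close> with the same integral as \<open>c\<close> has the class \<open>c\<close> and hence runs in \<open>H\<close>.
\<close>

lemma minimal_length_flux_minimal:
  assumes H: "H \<in> graph_components G" and c: "c \<in> carrier (homology1 H)" "c \<noteq> 0"
    and w: "flux_minimal G L \<alpha> w" and int: "walk_integral L \<alpha> w = cycle_integral H L \<alpha> c"
  shows "minimal_length H L c = walk_length L w"
proof -
  have wf: "wf_digraph H" using component_subgraph[OF H] by (simp add: subgraph_def)
  have "closed_walk G w" using w by (simp add: flux_minimal_def)
  then obtain v where wv: "walk G v w v" using closed_walk_iff by blast
  have class_c: "walk_class w = c"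
    using int unfolding cycle_integral_component[OF H c(1)] cycle_integral_walk_class[OF walk_set[OF wv], symmetric]
    by (rule cycle_integral_inj[OF walk_class_in_homology1[OF wv] extend_cycle[OF H c(1)]])
  define K where "K = component_of v"
  have K: "K \<in> graph_components G" unfolding K_def by (rule component_of_in_components) (use walk_in_verts[OF wv] in blast)
  have "walk G v [] v" using walk_in_verts[OF wv] by simp
  then have "v \<in> verts K" unfolding K_def component_of_simps by blast
  then have wK: "walk K v w v" by (rule walk_component[OF K _ wv])
  obtain e where e: "c e \<noteq> 0" using c(2) by (auto simp: fun_eq_iff)
  have "e \<in> arcs H" using c(1) e by (auto simp: homology1_def)
  moreover have "e \<in> arcs K" using walk_class_support[OF walk_set[OF wK], of e] e class_c by blast
  ultimately have "K = H" using component_unique_arc[OF K H] by blast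
  then have "closed_walk H w" unfolding wf_digraph.closed_walk_iff[OF wf] using wK by blast
  moreover have "walk_length L w \<le> walk_length L w'" if closed: "closed_walk H w'" and eq: "walk_class w' = walk_class w" for w'
  proof -
    obtain u where u: "walk H u w' u" using closed unfolding wf_digraph.closed_walk_iff[OF wf] by blast
    have uG: "walk G u w' u" by (rule walk_subgraph[OF component_subgraph[OF H] u])
    have "walk_integral L \<alpha> w' = walk_integral L \<alpha> w"
      using cycle_integral_walk_class[OF walk_set[OF uG], of L \<alpha>] cycle_integral_walk_class[OF walk_set[OF wv], of L \<alpha>]
      unfolding eq by simp
    moreover have "closed_walk G w'" unfolding closed_walk_iff using uG by blast
    ultimately show ?thesis using w unfolding flux_minimal_def by blast
  qed
  ultimately have "minimal_orbit H L w" unfolding minimal_orbit_def by blast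
  from minimal_length_walk_class[OF this] class_c show ?thesis by simp
qed

end

text \<open>
  Components with the trivial invariant \<open>z\<close> are matched arbitrarily; counting all components
  shows that there are equally many of them.
\<close>

lemma exists_matching:
  assumes fin: "finite C" "finite C'" and card: "card C = card C'"
    and inj: "inj_on P {H \<in> C. P H \<noteq> z}" "inj_on P' {H \<in> C'. P' H \<noteq> z}"
    and img: "P ` {H \<in> C. P H \<noteq> z} = P' ` {H \<in> C'. P' H \<noteq> z}"
  shows "\<exists>\<sigma>. bij_betw \<sigma> C C' \<and> (\<forall>H\<in>C. P' (\<sigma> H) = P H)"
proof -
  define N N' where "N = {H \<in> C. P H \<noteq> z}" and "N' = {H \<in> C'. P' H \<noteq> z}"
  have N: "bij_betw P N (P ` N)" and N': "bij_betw P' N' (P ` N)"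
    using inj img unfolding N_def N'_def by (simp_all add: bij_betw_def)
  define \<mu> where "\<mu> = inv_into N' P' \<circ> P"
  have \<mu>: "bij_betw \<mu> N N'"
    unfolding \<mu>_def by (rule bij_betw_trans[OF N bij_betw_inv_into[OF N']])
  have \<mu>P: "P' (\<mu> H) = P H" if "H \<in> N" for H
    using bij_betw_inv_into_right[OF N'] that by (simp add: \<mu>_def)
  have sub: "N \<subseteq> C" "N' \<subseteq> C'" by (auto simp: N_def N'_def)
  have "card N = card N'" using \<mu> by (rule bij_betw_same_card)
  then have "card (C - N) = card (C' - N')"
    using card sub finite_subset[OF sub(1) fin(1)] finite_subset[OF sub(2) fin(2)]
    by (simp add: card_Diff_subset)
  from finite_same_card_bij[OF finite_Diff[OF fin(1)] finite_Diff[OF fin(2)] this]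
  obtain \<nu> where \<nu>: "bij_betw \<nu> (C - N) (C' - N')" by (rule exE)
  define \<sigma> where "\<sigma> H = (if H \<in> N then \<mu> H else \<nu> H)" for H
  have "bij_betw \<sigma> N N'" using \<mu> by (subst bij_betw_cong[where g = \<mu>]) (simp_all add: \<sigma>_def)
  moreover have "bij_betw \<sigma> (C - N) (C' - N')" using \<nu> by (subst bij_betw_cong[where g = \<nu>]) (simp_all add: \<sigma>_def)
  ultimately have "bij_betw \<sigma> (N \<union> (C - N)) (N' \<union> (C' - N'))" by (rule bij_betw_combine) auto
  moreover have "N \<union> (C - N) = C" "N' \<union> (C' - N') = C'" using sub by auto
  ultimately have bij: "bij_betw \<sigma> C C'" by simp
  have "P' (\<sigma> H) = P H" if H: "H \<in> C" for H
  proof (cases "H \<in> N")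
    case True
    then show ?thesis using \<mu>P by (simp add: \<sigma>_def)
  next
    case False
    then have "\<nu> H \<in> C' - N'" using \<nu> H by (auto simp: bij_betw_def)
    then have "P' (\<nu> H) = z" by (simp add: N'_def)
    moreover have "P H = z" using False H by (simp add: N_def)
    ultimately show ?thesis using False by (simp add: \<sigma>_def)
  qed
  with bij show ?thesis by (intro exI[of _ \<sigma>] conjI ballI)
qed

locale flux_isospectral =
  G: generic_quantum_graph G L \<alpha> + G': generic_quantum_graph G' L' \<alpha>'
  for G :: "('v, 'e) pre_digraph" and L \<alpha> and G' :: "('w, 'f) pre_digraph" and L' \<alpha>' +
  assumes orbit_sums: "orbit_sum G L \<alpha> x y = orbit_sum G' L' \<alpha>' x y"
begin

lemma flux_isospectral_sym: "flux_isospectral G' L' \<alpha>' G L \<alpha>"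
  by unfold_locales (rule orbit_sums[symmetric])

lemma nonzero_period_shared:
  assumes H: "H \<in> graph_components G" and x: "x \<in> periods L \<alpha> H" "x \<noteq> 0"
  obtains H' where "H' \<in> graph_components G'" "x \<in> periods L' \<alpha>' H'"
proof -
  obtain c where c: "c \<in> carrier (homology1 H)" "x = cycle_integral H L \<alpha> c" using x(1) unfolding periods_def by blast
  obtain w where w: "flux_minimal G L \<alpha> w" "walk_integral L \<alpha> w = cycle_integral H L \<alpha> c"
    by (rule G.minimal_walk_of_cycle[OF H c(1)])
  have "walk_integral L \<alpha> w \<noteq> 0" using w(2) c(2) x(2) by simp
  from flux_minimal_transfer[OF G.quantum_graph_axioms G'.quantum_graph_axioms orbit_sums w(1) this]
  obtain w' where w': "flux_minimal G' L' \<alpha>' w'" "walk_integral L' \<alpha>' w' = walk_integral L \<alpha> w" by blast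
  have "closed_walk G' w'" using w'(1) by (simp add: flux_minimal_def)
  then obtain H' where "H' \<in> graph_components G'" "walk_integral L' \<alpha>' w' \<in> periods L' \<alpha>' H'"
    by (rule G'.period_of_closed_walk)
  then show ?thesis using that w'(2) w(2) c(2) by simp
qed

text \<open>
  If the periods of \<open>H\<close> were spread over two components of \<open>G'\<close>, the sum of a period from each
  would belong to neither.
\<close>

lemma periods_subset:
  assumes H: "H \<in> graph_components G" and x: "x \<in> periods L \<alpha> H" "x \<noteq> 0"
    and H': "H' \<in> graph_components G'" "x \<in> periods L' \<alpha>' H'"
  shows "periods L \<alpha> H \<subseteq> periods L' \<alpha>' H'"
proof
  fix y assume y: "y \<in> periods L \<alpha> H"
  show "y \<in> periods L' \<alpha>' H'"
  proof (cases "y = 0 \<or> x + y = 0")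
    case True
    then have "y = 0 \<or> y = 0 - x" by auto
    then show ?thesis using zero_period periods_minus[OF zero_period H'(2)] by metis
  next
    case False
    then have nz: "y \<noteq> 0" "x + y \<noteq> 0" by auto
    obtain K where K: "K \<in> graph_components G'" "y \<in> periods L' \<alpha>' K"
      by (rule nonzero_period_shared[OF H y nz(1)])
    obtain M where M: "M \<in> graph_components G'" "x + y \<in> periods L' \<alpha>' M"
      by (rule nonzero_period_shared[OF H periods_plus[OF x(1) y] nz(2)])
    have "H' = K" by (rule G'.periods_independent[OF H'(1) K(1) M(1) H'(2) x(2) K(2) nz(1) M(2)])
    then show ?thesis using K(2) by simp
  qed
qed

lemma periods_shared:
  assumes H: "H \<in> graph_components G" and nz: "periods L \<alpha> H \<noteq> {0}"
  obtains H' where "H' \<in> graph_components G'" "periods L' \<alpha>' H' = periods L \<alpha> H"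
proof -
  obtain x where x: "x \<in> periods L \<alpha> H" "x \<noteq> 0" by (rule G.nonzero_period[OF nz])
  obtain H' where H': "H' \<in> graph_components G'" "x \<in> periods L' \<alpha>' H'"
    by (rule nonzero_period_shared[OF H x])
  have "periods L' \<alpha>' H' = periods L \<alpha> H"
    using flux_isospectral.periods_subset[OF flux_isospectral_sym H' x(2) H x(1)] periods_subset[OF H x H'] by blast
  then show ?thesis by (rule that[OF H'(1)])
qed

lemma minimal_length_eq:
  assumes H: "H \<in> graph_components G" and H': "H' \<in> graph_components G'"
    and c: "c \<in> carrier (homology1 H)" and c': "c' \<in> carrier (homology1 H')"
    and int: "cycle_integral H' L' \<alpha>' c' = cycle_integral H L \<alpha> c"
  shows "minimal_length H' L' c' = minimal_length H L c"
proof (cases "c = 0")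
  case True
  then have "cycle_integral H L \<alpha> c = 0" by (simp add: cycle_integral_def)
  moreover have "cycle_integral H' L' \<alpha>' 0 = 0" by (simp add: cycle_integral_def)
  ultimately have "c' = 0"
    using inj_onD[OF G'.cycle_integral_component_inj[OF H'] _ c' zero_cycle] int by simp
  then show ?thesis using True G.minimal_length_zero[OF H] G'.minimal_length_zero[OF H'] by simp
next
  case False
  have nz: "cycle_integral H L \<alpha> c \<noteq> 0"
  proof
    assume "cycle_integral H L \<alpha> c = 0"
    moreover have "cycle_integral H L \<alpha> 0 = 0" by (simp add: cycle_integral_def)
    ultimately have "c = 0" using inj_onD[OF G.cycle_integral_component_inj[OF H] _ c zero_cycle] by simp
    with False show False by simp
  qed
  then have c'0: "c' \<noteq> 0" using int by (auto simp: cycle_integral_def)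
  obtain w where w: "flux_minimal G L \<alpha> w" "walk_integral L \<alpha> w = cycle_integral H L \<alpha> c"
    by (rule G.minimal_walk_of_cycle[OF H c])
  have "walk_integral L \<alpha> w \<noteq> 0" using w(2) nz by simp
  from flux_minimal_transfer[OF G.quantum_graph_axioms G'.quantum_graph_axioms orbit_sums w(1) this]
  obtain w' where w': "flux_minimal G' L' \<alpha>' w'" "walk_integral L' \<alpha>' w' = walk_integral L \<alpha> w"
    "walk_length L' w' = walk_length L w" by blast
  have "walk_integral L' \<alpha>' w' = cycle_integral H' L' \<alpha>' c'" using w'(2) w(2) int by simp
  from G'.minimal_length_flux_minimal[OF H' c' c'0 w'(1) this] G.minimal_length_flux_minimal[OF H c False w] w'(3)
  show ?thesis by simp
qed

text \<open>
  Both groups are identified with their common group of periods.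
\<close>

lemma homology_iso:
  assumes H: "H \<in> graph_components G" and H': "H' \<in> graph_components G'"
    and eq: "periods L' \<alpha>' H' = periods L \<alpha> H"
  shows "\<exists>\<phi>\<in>iso (homology1 H) (homology1 H'). \<forall>c\<in>carrier (homology1 H).
    cycle_integral H' L' \<alpha>' (\<phi> c) = cycle_integral H L \<alpha> c"
proof -
  define I I' where "I = cycle_integral H L \<alpha>" and "I' = cycle_integral H' L' \<alpha>'"
  have I: "bij_betw I (carrier (homology1 H)) (periods L \<alpha> H)"
    using G.cycle_integral_component_inj[OF H] by (simp add: bij_betw_def I_def periods_def)
  have I': "bij_betw I' (carrier (homology1 H')) (periods L \<alpha> H)"
    using G'.cycle_integral_component_inj[OF H'] unfolding eq[symmetric] by (simp add: bij_betw_def I'_def periods_def)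
  define \<phi> where "\<phi> = inv_into (carrier (homology1 H')) I' \<circ> I"
  have \<phi>: "bij_betw \<phi> (carrier (homology1 H)) (carrier (homology1 H'))"
    unfolding \<phi>_def by (rule bij_betw_trans[OF I bij_betw_inv_into[OF I']])
  have in': "\<phi> c \<in> carrier (homology1 H')" if "c \<in> carrier (homology1 H)" for c
    using \<phi> that by (rule bij_betwE[THEN bspec])
  have int: "I' (\<phi> c) = I c" if "c \<in> carrier (homology1 H)" for c
    using bij_betw_inv_into_right[OF I'] I that by (auto simp: \<phi>_def bij_betw_def)
  have add: "\<phi> (c + d) = \<phi> c + \<phi> d" if c: "c \<in> carrier (homology1 H)" and d: "d \<in> carrier (homology1 H)" for c d
  proof (rule inj_onD[OF bij_betw_imp_inj_on[OF I']])
    have "I' (\<phi> c + \<phi> d) = I' (\<phi> c) + I' (\<phi> d)" unfolding I'_def by (rule cycle_integral_plus)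
    moreover have "I (c + d) = I c + I d" unfolding I_def by (rule cycle_integral_plus)
    ultimately show "I' (\<phi> (c + d)) = I' (\<phi> c + \<phi> d)"
      unfolding int[OF cycle_plus[OF c d]] int[OF c] int[OF d] by simp
    show "\<phi> (c + d) \<in> carrier (homology1 H')" by (rule in'[OF cycle_plus[OF c d]])
    show "\<phi> c + \<phi> d \<in> carrier (homology1 H')" by (rule cycle_plus[OF in'[OF c] in'[OF d]])
  qed
  have mult: "c \<otimes>\<^bsub>homology1 K\<^esub> d = c + d" for K :: "('x, 'y) pre_digraph" and c d
    by (simp add: homology1_def)
  have "\<phi> \<in> iso (homology1 H) (homology1 H')"
    unfolding iso_def hom_def mult using \<phi> in' add by blast
  then show ?thesis using int unfolding I_def I'_def by blast
qed

theorem components_match: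
  assumes card: "card (graph_components G) = card (graph_components G')"
  shows "\<exists>\<sigma>. bij_betw \<sigma> (graph_components G) (graph_components G') \<and>
    (\<forall>H\<in>graph_components G. periods L' \<alpha>' (\<sigma> H) = periods L \<alpha> H)"
proof -
  let ?N = "{H \<in> graph_components G. periods L \<alpha> H \<noteq> {0}}"
  let ?N' = "{H \<in> graph_components G'. periods L' \<alpha>' H \<noteq> {0}}"
  have "periods L \<alpha> ` ?N = periods L' \<alpha>' ` ?N'"
  proof
    show "periods L \<alpha> ` ?N \<subseteq> periods L' \<alpha>' ` ?N'"
    proof (rule image_subsetI)
      fix H assume H: "H \<in> ?N"
      then have "H \<in> graph_components G" "periods L \<alpha> H \<noteq> {0}" by blast+
      then obtain H' where H': "H' \<in> graph_components G'" "periods L' \<alpha>' H' = periods L \<alpha> H"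
        by (rule periods_shared)
      show "periods L \<alpha> H \<in> periods L' \<alpha>' ` ?N'"
        unfolding H'(2)[symmetric] by (rule imageI) (use H H' in simp)
    qed
    show "periods L' \<alpha>' ` ?N' \<subseteq> periods L \<alpha> ` ?N"
    proof (rule image_subsetI)
      fix H' assume H': "H' \<in> ?N'"
      then have "H' \<in> graph_components G'" "periods L' \<alpha>' H' \<noteq> {0}" by blast+
      then obtain H where H: "H \<in> graph_components G" "periods L \<alpha> H = periods L' \<alpha>' H'"
        by (rule flux_isospectral.periods_shared[OF flux_isospectral_sym])
      show "periods L' \<alpha>' H' \<in> periods L \<alpha> ` ?N"
        unfolding H(2)[symmetric] by (rule imageI) (use H H' in simp)
    qed
  qed
  from exists_matching[OF G.finite_components G'.finite_components card G.periods_inj G'.periods_inj this]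
  show ?thesis .
qed

theorem homology_and_lengths_match:
  assumes card: "card (graph_components G) = card (graph_components G')"
  shows "\<exists>k (H :: nat \<Rightarrow> ('v, 'e) pre_digraph) (H' :: nat \<Rightarrow> ('w, 'f) pre_digraph).
    bij_betw H {1..k} (graph_components G) \<and> bij_betw H' {1..k} (graph_components G') \<and>
    (\<forall>i\<in>{1..k}. \<exists>\<phi>\<in>iso (homology1 (H i)) (homology1 (H' i)).
       \<forall>c\<in>carrier (homology1 (H i)).
         \<bar>cycle_integral (H' i) L' \<alpha>' (\<phi> c)\<bar> = \<bar>cycle_integral (H i) L \<alpha> c\<bar> \<and>
         minimal_length (H' i) L' (\<phi> c) = minimal_length (H i) L c)"
proof -
  from components_match[OF card]
  obtain \<sigma> where \<sigma>: "bij_betw \<sigma> (graph_components G) (graph_components G')"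
    "\<forall>H\<in>graph_components G. periods L' \<alpha>' (\<sigma> H) = periods L \<alpha> H" by (elim exE conjE)
  obtain H where H: "bij_betw H {1..card (graph_components G)} (graph_components G)"
    using ex_bij_betw_nat_finite_1[OF G.finite_components] by blast
  show ?thesis
  proof (intro exI conjI ballI)
    show "bij_betw H {1..card (graph_components G)} (graph_components G)" by (fact H)
    show "bij_betw (\<sigma> \<circ> H) {1..card (graph_components G)} (graph_components G')"
      by (rule bij_betw_trans[OF H \<sigma>(1)])
    fix i assume i: "i \<in> {1..card (graph_components G)}"
    have Hi: "H i \<in> graph_components G" by (rule bij_betwE[OF H, THEN bspec, OF i])
    have Hi': "\<sigma> (H i) \<in> graph_components G'" by (rule bij_betwE[OF \<sigma>(1), THEN bspec, OF Hi])
    from homology_iso[OF Hi Hi' bspec[OF \<sigma>(2) Hi]]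
    obtain \<phi> where \<phi>: "\<phi> \<in> iso (homology1 (H i)) (homology1 (\<sigma> (H i)))"
      and flux: "\<forall>c\<in>carrier (homology1 (H i)).
        cycle_integral (\<sigma> (H i)) L' \<alpha>' (\<phi> c) = cycle_integral (H i) L \<alpha> c" by (rule bexE)
    have length: "minimal_length (\<sigma> (H i)) L' (\<phi> c) = minimal_length (H i) L c"
      if c: "c \<in> carrier (homology1 (H i))" for c
    proof (rule minimal_length_eq[OF Hi Hi' c _ bspec[OF flux c]])
      show "\<phi> c \<in> carrier (homology1 (\<sigma> (H i)))"
        using \<phi> c by (auto simp: iso_def bij_betw_def)
    qed
    show "\<exists>\<phi>\<in>iso (homology1 (H i)) (homology1 ((\<sigma> \<circ> H) i)).
        \<forall>c\<in>carrier (homology1 (H i)).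
          \<bar>cycle_integral ((\<sigma> \<circ> H) i) L' \<alpha>' (\<phi> c)\<bar> = \<bar>cycle_integral (H i) L \<alpha> c\<bar> \<and>
          minimal_length ((\<sigma> \<circ> H) i) L' (\<phi> c) = minimal_length (H i) L c"
      unfolding comp_def
    proof (rule bexI[OF _ \<phi>], intro ballI conjI)
      fix c assume c: "c \<in> carrier (homology1 (H i))"
      show "\<bar>cycle_integral (\<sigma> (H i)) L' \<alpha>' (\<phi> c)\<bar> = \<bar>cycle_integral (H i) L \<alpha> c\<bar>"
        by (rule arg_cong[where f = abs, OF bspec[OF flux c]])
      show "minimal_length (\<sigma> (H i)) L' (\<phi> c) = minimal_length (H i) L c"
        by (rule length[OF c])
    qed
  qed
qed

end

lemma flux_isospectral_if_Spec_eq: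
  assumes G: "quantum_graph G L" and G': "quantum_graph G' L'"
    and gen: "generic G L \<alpha>" "generic G' L' \<alpha>'" and \<epsilon>: "0 < \<epsilon>"
    and Spec: "\<And>t. t \<in> {0..<\<epsilon>} \<Longrightarrow> Spec G L (scale_form t \<alpha>) = Spec G' L' (scale_form t \<alpha>')"
  shows "flux_isospectral G L \<alpha> G' L' \<alpha>'"
proof (rule flux_isospectral.intro)
  show "generic_quantum_graph G L \<alpha>" "generic_quantum_graph G' L' \<alpha>'"
    using G G' gen by (simp_all add: generic_quantum_graph_def generic_quantum_graph_axioms_def)
  have forms: "\<alpha> \<in> one_forms G L" "\<alpha>' \<in> one_forms G' L'" using gen by (simp_all add: generic_def)
  show "flux_isospectral_axioms G L \<alpha> G' L' \<alpha>'"
    by (rule flux_isospectral_axioms.intro, unfold orbit_sum_def,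
        rule flux_orbit_sums_determined[OF G G' forms \<epsilon> Spec])
qed

lemma card_components_determined:
  assumes "quantum_graph G L" "quantum_graph G' L'" "Spec G L 0 = Spec G' L' 0"
  shows "card (graph_components G) = card (graph_components G')"
  using Spec_eq_imp_dim_eq[OF assms, of 0]
  unfolding quantum_graph.dim_zero_eigenspace[OF assms(1)] quantum_graph.dim_zero_eigenspace[OF assms(2)] .

theorem proposition10p1:
  fixes G :: "('v, 'e) pre_digraph" and L :: "'e \<Rightarrow> real"
    and G' :: "('w, 'f) pre_digraph" and L' :: "'f \<Rightarrow> real"
  assumes "quantum_graph G L" and "quantum_graph G' L'"
  shows "(Spec G L 0 = Spec G' L' 0 \<longrightarrow> card (graph_components G) = card (graph_components G')) \<and>
    (\<forall>\<alpha> \<alpha>' \<epsilon>. generic G L \<alpha> \<and> generic G' L' \<alpha>' \<and> 0 < \<epsilon> \<and>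
       (\<forall>t\<in>{0..<\<epsilon>}. Spec G L (scale_form t \<alpha>) = Spec G' L' (scale_form t \<alpha>')) \<longrightarrow>
       (\<exists>k (H :: nat \<Rightarrow> ('v, 'e) pre_digraph) (H' :: nat \<Rightarrow> ('w, 'f) pre_digraph).
          bij_betw H {1..k} (graph_components G) \<and> bij_betw H' {1..k} (graph_components G') \<and>
          (\<forall>i\<in>{1..k}. \<exists>\<phi>\<in>iso (homology1 (H i)) (homology1 (H' i)).
             \<forall>c\<in>carrier (homology1 (H i)).
               \<bar>cycle_integral (H' i) L' \<alpha>' (\<phi> c)\<bar> = \<bar>cycle_integral (H i) L \<alpha> c\<bar> \<and>
               minimal_length (H' i) L' (\<phi> c) = minimal_length (H i) L c)))"
  (is "_ \<and> ?bloch_part")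
proof (rule conjI, rule impI)
  assume "Spec G L 0 = Spec G' L' 0"
  then show "card (graph_components G) = card (graph_components G')"
    by (rule card_components_determined[OF assms])
next
  show "?bloch_part"
  proof (rule allI, rule allI, rule allI, rule impI)
  fix \<alpha> \<alpha>' \<epsilon>
  assume *: "generic G L \<alpha> \<and> generic G' L' \<alpha>' \<and> 0 < \<epsilon> \<and>
    (\<forall>t\<in>{0..<\<epsilon>}. Spec G L (scale_form t \<alpha>) = Spec G' L' (scale_form t \<alpha>'))"
  note gen = conjunct1[OF *] conjunct1[OF conjunct2[OF *]]
  note \<epsilon> = conjunct1[OF conjunct2[OF conjunct2[OF *]]]
  note Spec = bspec[OF conjunct2[OF conjunct2[OF conjunct2[OF *]]]]
  have iso: "flux_isospectral G L \<alpha> G' L' \<alpha>'"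
    by (rule flux_isospectral_if_Spec_eq[OF assms gen \<epsilon>]) (rule Spec)
  have zero: "scale_form 0 \<alpha> = 0" "scale_form 0 \<alpha>' = 0"
    by (simp_all add: scale_form_def fun_eq_iff)
  have "0 \<in> {0..<\<epsilon>}" using \<epsilon> by simp
  from Spec[OF this] have "card (graph_components G) = card (graph_components G')"
    unfolding zero by (rule card_components_determined[OF assms])
  then show "\<exists>k (H :: nat \<Rightarrow> ('v, 'e) pre_digraph) (H' :: nat \<Rightarrow> ('w, 'f) pre_digraph).
      bij_betw H {1..k} (graph_components G) \<and> bij_betw H' {1..k} (graph_components G') \<and>
      (\<forall>i\<in>{1..k}. \<exists>\<phi>\<in>iso (homology1 (H i)) (homology1 (H' i)).
         \<forall>c\<in>carrier (homology1 (H i)).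
           \<bar>cycle_integral (H' i) L' \<alpha>' (\<phi> c)\<bar> = \<bar>cycle_integral (H i) L \<alpha> c\<bar> \<and>
           minimal_length (H' i) L' (\<phi> c) = minimal_length (H i) L c)"
    by (rule flux_isospectral.homology_and_lengths_match[OF iso])
  qed
qed

end
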